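(* Suppose $\alpha$ is an endomorphism of a unital $C^*$-algebra $A$ and $L$ is a transfer operator for $(A,\alpha)$. Let $K_\alpha:=\overline{A\alpha(A)A}\cap J(M_L)$. Then there is an isomorphism $\theta:\mathcal{O}(K_\alpha,M_L)\to A\rtimes_{\alpha,L}\mathbb{N}$ such that $\theta\circ k_A=j_A$ and $\theta(k_{M_L}(q(1)))=T$.
   Context: Endomorphisms are $*$-homomorphisms $\alpha:A\to A$, not assumed unital or injective. A transfer operator for $(A,\alpha)$ is a continuous linear map $L:A\to A$ that is positive ($a\ge 0\Rightarrow L(a)\ge 0$) and satisfies $L(\alpha(a)b)=aL(b)$ for all $a,b\in A$. Relative Cuntz-Pimsner algebras: a Hilbert bimodule $X$ over $A$ is a right Hilbert $A$-module with a left action given by a homomorphism $\phi:A\to\mathcal{L}(X)$ into the adjointable operators. A Toeplitz representation $(\psi,\pi)$ of $X$ in a $C^*$-algebra $B$ consists of a linear map $\psi:X\to B$ and a homomorphism $\pi:A\to B$ with $\psi(x\cdot a)=\psi(x)\pi(a)$, $\psi(x)^*\psi(y)=\pi(\langle x,y\rangle_A)$, $\psi(\phi(a)x)=\pi(a)\psi(x)$. It induces a homomorphism $(\psi,\pi)^{(1)}:\mathcal{K}(X)\to B$ with $(\psi,\pi)^{(1)}(\Theta_{x,y})=\psi(x)\psi(y)^*$, where $\Theta_{x,y}(z)=x\cdot\langle y,z\rangle_A$ and $\mathcal{K}(X)$ is the closed span of the $\Theta_{x,y}$. Put $J(X):=\phi^{-1}(\mathcal{K}(X))$. For a closed ideal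 $K\subseteq J(X)$, $(\psi,\pi)$ is coisometric on $K$ if $(\psi,\pi)^{(1)}(\phi(a))=\pi(a)$ for all $a\in K$. The relative Cuntz-Pimsner algebra $\mathcal{O}(K,X)$ is the $C^*$-algebra, unique up to canonical isomorphism, generated by the ranges of a Toeplitz representation $(k_X,k_A)$ which is coisometric on $K$ and universal: every Toeplitz representation $(\psi,\pi)$ coisometric on $K$ has the form $(\mu\circ k_X,\mu\circ k_A)$ for a homomorphism $\mu$ of $\mathcal{O}(K,X)$. Toeplitz algebra: $\mathcal{T}(A,\alpha,L)$ is the universal unital $C^*$-algebra generated by a copy of $A$ (via a unital homomorphism $i_A:A\to\mathcal{T}(A,\alpha,L)$, which is injective) and an element $S$ with $S\,i_A(a)=i_A(\alpha(a))S$ and $S^*i_A(a)S=i_A(L(a))$ for all $a\in A$. The bimodule $M_L$: let $A_L$ be a copy of the vector space $A$ with right action $m\cdot a=m\alpha(a)$ and $A$-valued form $\langle m,n\rangle_L=L(m^*n)$; let $N=\{a\in A_L:\langle a,a\rangle_L=0\}$, let $q:A_L\to A_L/N$ be the quotient map, and let $M_L$ be the completion of $A_L/N$; the left action is $\phi(a)q(b)=q(ab)$. $\overline{A\alpha(A)A}$ denotes the closed linear span of the products $a\alpha(b)c$. Crossed product: a redundancy is a pair $(i_A(a),k)$ with $a\in A$, $k\in\overline{i_A(A)SS^*i_A(A)}$ (closed linear span) and $i_A(a)i_A(b)S=k\,i_A(b)S$ for all $b\in A$. Exel's crossed product $A\rtimes_{\alpha,L}\mathbb{N}$ is the quotient of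 $\mathcal{T}(A,\alpha,L)$ by the closed two-sided ideal generated by $\{i_A(a)-k: (i_A(a),k)\text{ is a redundancy with } a\in\overline{A\alpha(A)A}\}$; $Q$ denotes the quotient map, $j_A:=Q\circ i_A$ and $T:=Q(S)$. *)

theory Defs
  imports
    "HOL-Analysis.Analysis"
    "HOL-Algebra.Module"
    "HOL-Algebra.QuotRing"
begin

section \<open>$C^*$-algebras on carrier sets\<close>

text \<open>
  Universal properties quantify over all $C^*$-algebras, so these are structures on carrier sets
  rather than types of a type class. The field \<open>one\<close> is only meaningful in the unital case; it is
  unconstrained otherwise.
\<close>

record 'a cstar = "(complex, 'a) module" +
  star :: "'a \<Rightarrow> 'a"
  cnorm :: "'a \<Rightarrow> real"

definition complex_field :: "complex ring"
  where "complex_field = \<lparr>carrier = UNIV, monoid.mult = (*), one = 1, zero = 0, add = (+)\<rparr>"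

text \<open>
  The value outside the carrier only serves to meet the locale \<^locale>\<open>Metric_space\<close>, which requires
  a distance to be nonnegative and symmetric on the whole type.
\<close>

definition norm_dist :: "('v, 'z) ring_scheme \<Rightarrow> ('v \<Rightarrow> real) \<Rightarrow> 'v \<Rightarrow> 'v \<Rightarrow> real"
  where "norm_dist V n x y =
    (if x \<in> carrier V \<and> y \<in> carrier V then n (x \<ominus>\<^bsub>V\<^esub> y) else 0)"

definition norm_topology :: "('v, 'z) ring_scheme \<Rightarrow> ('v \<Rightarrow> real) \<Rightarrow> 'v topology"
  where "norm_topology V n = Metric_space.mtopology (carrier V) (norm_dist V n)"

definition norm_complete :: "('v, 'z) ring_scheme \<Rightarrow> ('v \<Rightarrow> real) \<Rightarrow> bool"
  where "norm_complete V n \<longleftrightarrow> Metric_space.mcomplete (carrier V) (norm_dist V n)"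

abbreviation cstar_topology :: "'a cstar \<Rightarrow> 'a topology"
  where "cstar_topology A \<equiv> norm_topology A (cnorm A)"

locale cstar_algebra = Module.module complex_field A for A :: "'a cstar" (structure) +
  assumes mult_closed: "\<lbrakk>x \<in> carrier A; y \<in> carrier A\<rbrakk> \<Longrightarrow> x \<otimes> y \<in> carrier A"
    and mult_assoc:
      "\<lbrakk>x \<in> carrier A; y \<in> carrier A; z \<in> carrier A\<rbrakk> \<Longrightarrow> (x \<otimes> y) \<otimes> z = x \<otimes> (y \<otimes> z)"
    and mult_add_left:
      "\<lbrakk>x \<in> carrier A; y \<in> carrier A; z \<in> carrier A\<rbrakk> \<Longrightarrow> (x \<oplus> y) \<otimes> z = x \<otimes> z \<oplus> y \<otimes> z"
    and mult_add_right:
      "\<lbrakk>x \<in> carrier A; y \<in> carrier A; z \<in> carrier A\<rbrakk> \<Longrightarrow> z \<otimes> (x \<oplus> y) = z \<otimes> x \<oplus> z \<otimes> y"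
    and mult_smult_left:
      "\<lbrakk>x \<in> carrier A; y \<in> carrier A\<rbrakk> \<Longrightarrow> (c \<odot> x) \<otimes> y = c \<odot> (x \<otimes> y)"
    and mult_smult_right:
      "\<lbrakk>x \<in> carrier A; y \<in> carrier A\<rbrakk> \<Longrightarrow> x \<otimes> (c \<odot> y) = c \<odot> (x \<otimes> y)"
    and star_closed: "x \<in> carrier A \<Longrightarrow> star A x \<in> carrier A"
    and star_star: "x \<in> carrier A \<Longrightarrow> star A (star A x) = x"
    and star_add: "\<lbrakk>x \<in> carrier A; y \<in> carrier A\<rbrakk> \<Longrightarrow> star A (x \<oplus> y) = star A x \<oplus> star A y"
    and star_smult: "x \<in> carrier A \<Longrightarrow> star A (c \<odot> x) = cnj c \<odot> star A x"
    and star_mult: "\<lbrakk>x \<in> carrier A; y \<in> carrier A\<rbrakk> \<Longrightarrow> star A (x \<otimes> y) = star A y \<otimes> star A x"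
    and cnorm_nonneg: "x \<in> carrier A \<Longrightarrow> 0 \<le> cnorm A x"
    and cnorm_eq_zero: "x \<in> carrier A \<Longrightarrow> cnorm A x = 0 \<longleftrightarrow> x = \<zero>"
    and cnorm_triangle:
      "\<lbrakk>x \<in> carrier A; y \<in> carrier A\<rbrakk> \<Longrightarrow> cnorm A (x \<oplus> y) \<le> cnorm A x + cnorm A y"
    and cnorm_smult: "x \<in> carrier A \<Longrightarrow> cnorm A (c \<odot> x) = cmod c * cnorm A x"
    and cnorm_mult: "\<lbrakk>x \<in> carrier A; y \<in> carrier A\<rbrakk> \<Longrightarrow> cnorm A (x \<otimes> y) \<le> cnorm A x * cnorm A y"
    and cstar_identity: "x \<in> carrier A \<Longrightarrow> cnorm A (star A x \<otimes> x) = (cnorm A x)\<^sup>2"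
    and complete: "norm_complete A (cnorm A)"

locale unital_cstar_algebra = cstar_algebra +
  assumes one_closed: "\<one> \<in> carrier A"
    and mult_one_left: "x \<in> carrier A \<Longrightarrow> \<one> \<otimes> x = x"
    and mult_one_right: "x \<in> carrier A \<Longrightarrow> x \<otimes> \<one> = x"

definition cpositive :: "'a cstar \<Rightarrow> 'a \<Rightarrow> bool"
  where "cpositive A a \<longleftrightarrow> (\<exists>b\<in>carrier A. a = star A b \<otimes>\<^bsub>A\<^esub> b)"

definition linear_map ::
    "(complex, 'v, 'y) module_scheme \<Rightarrow> (complex, 'w, 'z) module_scheme \<Rightarrow> ('v \<Rightarrow> 'w) \<Rightarrow> bool"
  where "linear_map V W f \<longleftrightarrow>
    f \<in> carrier V \<rightarrow> carrier W \<and>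
    (\<forall>x\<in>carrier V. \<forall>y\<in>carrier V. f (x \<oplus>\<^bsub>V\<^esub> y) = f x \<oplus>\<^bsub>W\<^esub> f y) \<and>
    (\<forall>c. \<forall>x\<in>carrier V. f (c \<odot>\<^bsub>V\<^esub> x) = c \<odot>\<^bsub>W\<^esub> f x)"

definition star_hom :: "'a cstar \<Rightarrow> 'b cstar \<Rightarrow> ('a \<Rightarrow> 'b) set"
  where "star_hom A B = {h. linear_map A B h \<and>
    (\<forall>x\<in>carrier A. \<forall>y\<in>carrier A. h (x \<otimes>\<^bsub>A\<^esub> y) = h x \<otimes>\<^bsub>B\<^esub> h y) \<and>
    (\<forall>x\<in>carrier A. h (star A x) = star B (h x))}"

definition star_iso :: "'a cstar \<Rightarrow> 'b cstar \<Rightarrow> ('a \<Rightarrow> 'b) set"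
  where "star_iso A B = {h \<in> star_hom A B. bij_betw h (carrier A) (carrier B)}"

definition closed_span :: "'a cstar \<Rightarrow> 'a set \<Rightarrow> 'a set"
  where "closed_span A G =
    cstar_topology A closure_of (\<Inter>{W. submodule W complex_field A \<and> G \<subseteq> W})"

definition cstar_generated :: "'a cstar \<Rightarrow> 'a set \<Rightarrow> 'a set"
  where "cstar_generated A G = \<Inter>{D. submodule D complex_field A \<and>
    (\<forall>x\<in>D. \<forall>y\<in>D. x \<otimes>\<^bsub>A\<^esub> y \<in> D) \<and> (\<forall>x\<in>D. star A x \<in> D) \<and>
    closedin (cstar_topology A) D \<and> G \<subseteq> D}"

definition closed_ideal_generated :: "'a cstar \<Rightarrow> 'a set \<Rightarrow> 'a set"
  where "closed_ideal_generated A G =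
    \<Inter>{I. ideal I A \<and> closedin (cstar_topology A) I \<and> G \<subseteq> I}"

text \<open>The quotient ring \<^term>\<open>A Quot I\<close> with the induced operations and the quotient norm.\<close>

definition cstar_quot :: "'a cstar \<Rightarrow> 'a set \<Rightarrow> 'a set cstar"
  where "cstar_quot A I = \<lparr>
    carrier = carrier (A Quot I),
    monoid.mult = monoid.mult (A Quot I),
    one = one (A Quot I),
    zero = zero (A Quot I),
    add = add (A Quot I),
    smult = (\<lambda>c X. \<Union>x\<in>X. I +>\<^bsub>A\<^esub> (c \<odot>\<^bsub>A\<^esub> x)),
    star = (\<lambda>X. \<Union>x\<in>X. I +>\<^bsub>A\<^esub> star A x),
    cnorm = (\<lambda>X. INF x\<in>X. cnorm A x)\<rparr>"


section \<open>Hilbert bimodules\<close>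

text \<open>As in \<^locale>\<open>Module.module\<close>, the fields \<open>mult\<close> and \<open>one\<close> of the underlying ring record are unused.\<close>

record ('a, 'm) hilbert_mod = "(complex, 'm) module" +
  raction :: "'m \<Rightarrow> 'a \<Rightarrow> 'm"
  ip :: "'m \<Rightarrow> 'm \<Rightarrow> 'a"

definition hnorm :: "'a cstar \<Rightarrow> ('a, 'm) hilbert_mod \<Rightarrow> 'm \<Rightarrow> real"
  where "hnorm A X x = sqrt (cnorm A (ip X x x))"

locale hilbert_module = A: cstar_algebra A + X: Module.module complex_field X
  for A :: "'a cstar" and X :: "('a, 'm) hilbert_mod" +
  assumes raction_closed:
      "\<lbrakk>x \<in> carrier X; a \<in> carrier A\<rbrakk> \<Longrightarrow> raction X x a \<in> carrier X"
    and raction_add_left: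
      "\<lbrakk>x \<in> carrier X; y \<in> carrier X; a \<in> carrier A\<rbrakk>
        \<Longrightarrow> raction X (x \<oplus>\<^bsub>X\<^esub> y) a = raction X x a \<oplus>\<^bsub>X\<^esub> raction X y a"
    and raction_add_right:
      "\<lbrakk>x \<in> carrier X; a \<in> carrier A; b \<in> carrier A\<rbrakk>
        \<Longrightarrow> raction X x (a \<oplus>\<^bsub>A\<^esub> b) = raction X x a \<oplus>\<^bsub>X\<^esub> raction X x b"
    and raction_smult_left:
      "\<lbrakk>x \<in> carrier X; a \<in> carrier A\<rbrakk> \<Longrightarrow> raction X (c \<odot>\<^bsub>X\<^esub> x) a = c \<odot>\<^bsub>X\<^esub> raction X x a"
    and raction_smult_right:
      "\<lbrakk>x \<in> carrier X; a \<in> carrier A\<rbrakk> \<Longrightarrow> raction X x (c \<odot>\<^bsub>A\<^esub> a) = c \<odot>\<^bsub>X\<^esub> raction X x a"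
    and raction_mult:
      "\<lbrakk>x \<in> carrier X; a \<in> carrier A; b \<in> carrier A\<rbrakk>
        \<Longrightarrow> raction X x (a \<otimes>\<^bsub>A\<^esub> b) = raction X (raction X x a) b"
    and ip_closed: "\<lbrakk>x \<in> carrier X; y \<in> carrier X\<rbrakk> \<Longrightarrow> ip X x y \<in> carrier A"
    and ip_add_right:
      "\<lbrakk>x \<in> carrier X; y \<in> carrier X; z \<in> carrier X\<rbrakk>
        \<Longrightarrow> ip X x (y \<oplus>\<^bsub>X\<^esub> z) = ip X x y \<oplus>\<^bsub>A\<^esub> ip X x z"
    and ip_smult_right:
      "\<lbrakk>x \<in> carrier X; y \<in> carrier X\<rbrakk> \<Longrightarrow> ip X x (c \<odot>\<^bsub>X\<^esub> y) = c \<odot>\<^bsub>A\<^esub> ip X x y"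
    and ip_raction_right:
      "\<lbrakk>x \<in> carrier X; y \<in> carrier X; a \<in> carrier A\<rbrakk>
        \<Longrightarrow> ip X x (raction X y a) = ip X x y \<otimes>\<^bsub>A\<^esub> a"
    and ip_star: "\<lbrakk>x \<in> carrier X; y \<in> carrier X\<rbrakk> \<Longrightarrow> star A (ip X x y) = ip X y x"
    and ip_positive: "x \<in> carrier X \<Longrightarrow> cpositive A (ip X x x)"
    and ip_definite: "\<lbrakk>x \<in> carrier X; ip X x x = \<zero>\<^bsub>A\<^esub>\<rbrakk> \<Longrightarrow> x = \<zero>\<^bsub>X\<^esub>"
    and complete: "norm_complete X (hnorm A X)"

definition is_adjoint :: "('a, 'm) hilbert_mod \<Rightarrow> ('m \<Rightarrow> 'm) \<Rightarrow> ('m \<Rightarrow> 'm) \<Rightarrow> bool"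
  where "is_adjoint X F G \<longleftrightarrow>
    (\<forall>x\<in>carrier X. \<forall>y\<in>carrier X. ip X (F x) y = ip X x (G y))"

text \<open>
  The algebra of adjointable operators. Operators are extensional functions on the carrier, so that
  equal operators are equal functions.
\<close>

definition adjointables :: "'a cstar \<Rightarrow> ('a, 'm) hilbert_mod \<Rightarrow> ('m \<Rightarrow> 'm) cstar"
  where "adjointables A X = \<lparr>
    carrier = {F \<in> carrier X \<rightarrow>\<^sub>E carrier X. \<exists>G \<in> carrier X \<rightarrow>\<^sub>E carrier X. is_adjoint X F G},
    monoid.mult = (\<lambda>F G. compose (carrier X) F G),
    one = (\<lambda>x\<in>carrier X. x),
    zero = (\<lambda>x\<in>carrier X. \<zero>\<^bsub>X\<^esub>),
    add = (\<lambda>F G. \<lambda>x\<in>carrier X. F x \<oplus>\<^bsub>X\<^esub> G x),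
    smult = (\<lambda>c F. \<lambda>x\<in>carrier X. c \<odot>\<^bsub>X\<^esub> F x),
    star = (\<lambda>F. THE G. G \<in> carrier X \<rightarrow>\<^sub>E carrier X \<and> is_adjoint X F G),
    cnorm = (\<lambda>F. SUP x\<in>{x \<in> carrier X. hnorm A X x \<le> 1}. hnorm A X (F x))\<rparr>"

definition rank_one :: "('a, 'm) hilbert_mod \<Rightarrow> 'm \<Rightarrow> 'm \<Rightarrow> 'm \<Rightarrow> 'm"
  where "rank_one X x y = (\<lambda>z\<in>carrier X. raction X x (ip X y z))"

definition compacts :: "'a cstar \<Rightarrow> ('a, 'm) hilbert_mod \<Rightarrow> ('m \<Rightarrow> 'm) set"
  where "compacts A X =
    closed_span (adjointables A X) {rank_one X x y | x y. x \<in> carrier X \<and> y \<in> carrier X}"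

locale hilbert_bimodule = hilbert_module A X
  for A :: "'a cstar" and X :: "('a, 'm) hilbert_mod" and \<phi> :: "'a \<Rightarrow> 'm \<Rightarrow> 'm" +
  assumes left_action: "\<phi> \<in> star_hom A (adjointables A X)"

definition J_ideal :: "'a cstar \<Rightarrow> ('a, 'm) hilbert_mod \<Rightarrow> ('a \<Rightarrow> 'm \<Rightarrow> 'm) \<Rightarrow> 'a set"
  where "J_ideal A X \<phi> = {a \<in> carrier A. \<phi> a \<in> compacts A X}"


section \<open>Relative Cuntz--Pimsner algebras\<close>

definition toeplitz_representation ::
    "'a cstar \<Rightarrow> ('a, 'm) hilbert_mod \<Rightarrow> ('a \<Rightarrow> 'm \<Rightarrow> 'm) \<Rightarrow>
      'b cstar \<Rightarrow> ('m \<Rightarrow> 'b) \<Rightarrow> ('a \<Rightarrow> 'b) \<Rightarrow> bool"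
  where "toeplitz_representation A X \<phi> B \<psi> \<pi> \<longleftrightarrow>
    linear_map X B \<psi> \<and> \<pi> \<in> star_hom A B \<and>
    (\<forall>x\<in>carrier X. \<forall>a\<in>carrier A. \<psi> (raction X x a) = \<psi> x \<otimes>\<^bsub>B\<^esub> \<pi> a) \<and>
    (\<forall>x\<in>carrier X. \<forall>y\<in>carrier X. star B (\<psi> x) \<otimes>\<^bsub>B\<^esub> \<psi> y = \<pi> (ip X x y)) \<and>
    (\<forall>a\<in>carrier A. \<forall>x\<in>carrier X. \<psi> (\<phi> a x) = \<pi> a \<otimes>\<^bsub>B\<^esub> \<psi> x)"

text \<open>
  \<open>\<rho>\<close> is the homomorphism $(\psi,\pi)^{(1)}$ of the compact operators. As a homomorphism of
  $C^*$-algebras it is continuous, hence determined by its values on the rank-one operators.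
\<close>

definition induced_hom ::
    "'a cstar \<Rightarrow> ('a, 'm) hilbert_mod \<Rightarrow> 'b cstar \<Rightarrow> ('m \<Rightarrow> 'b) \<Rightarrow> (('m \<Rightarrow> 'm) \<Rightarrow> 'b) \<Rightarrow> bool"
  where "induced_hom A X B \<psi> \<rho> \<longleftrightarrow>
    \<rho> \<in> star_hom ((adjointables A X)\<lparr>carrier := compacts A X\<rparr>) B \<and>
    (\<forall>x\<in>carrier X. \<forall>y\<in>carrier X. \<rho> (rank_one X x y) = \<psi> x \<otimes>\<^bsub>B\<^esub> star B (\<psi> y))"

definition coisometric_on ::
    "'a set \<Rightarrow> 'a cstar \<Rightarrow> ('a, 'm) hilbert_mod \<Rightarrow> ('a \<Rightarrow> 'm \<Rightarrow> 'm) \<Rightarrow>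
      'b cstar \<Rightarrow> ('m \<Rightarrow> 'b) \<Rightarrow> ('a \<Rightarrow> 'b) \<Rightarrow> bool"
  where "coisometric_on K A X \<phi> B \<psi> \<pi> \<longleftrightarrow>
    (\<exists>\<rho>. induced_hom A X B \<psi> \<rho> \<and> (\<forall>a\<in>K. \<rho> (\<phi> a) = \<pi> a))"

text \<open>
  \<open>Ob\<close> together with \<open>(kX, kA)\<close> is the algebra $\mathcal{O}(K,X)$. The target \<open>B\<close> of the universal
  property ranges over all $C^*$-algebras whose carrier is a set of elements of the type of \<open>Ob\<close>.
\<close>

definition relative_cuntz_pimsner ::
    "'a set \<Rightarrow> 'a cstar \<Rightarrow> ('a, 'm) hilbert_mod \<Rightarrow> ('a \<Rightarrow> 'm \<Rightarrow> 'm) \<Rightarrow>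
      'u cstar \<Rightarrow> ('m \<Rightarrow> 'u) \<Rightarrow> ('a \<Rightarrow> 'u) \<Rightarrow> bool"
  where "relative_cuntz_pimsner K A X \<phi> Ob kX kA \<longleftrightarrow>
    cstar_algebra Ob \<and>
    toeplitz_representation A X \<phi> Ob kX kA \<and> coisometric_on K A X \<phi> Ob kX kA \<and>
    cstar_generated Ob (kX ` carrier X \<union> kA ` carrier A) = carrier Ob \<and>
    (\<forall>(B :: 'u cstar) \<psi> \<pi>.
      cstar_algebra B \<and> toeplitz_representation A X \<phi> B \<psi> \<pi> \<and> coisometric_on K A X \<phi> B \<psi> \<pi> \<longrightarrow>
      (\<exists>\<mu>\<in>star_hom Ob B.
        (\<forall>x\<in>carrier X. \<psi> x = \<mu> (kX x)) \<and> (\<forall>a\<in>carrier A. \<pi> a = \<mu> (kA a))))"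


section \<open>Transfer operators and Exel's crossed product\<close>

definition transfer_operator :: "'a cstar \<Rightarrow> ('a \<Rightarrow> 'a) \<Rightarrow> ('a \<Rightarrow> 'a) \<Rightarrow> bool"
  where "transfer_operator A \<alpha> L \<longleftrightarrow>
    linear_map A A L \<and> continuous_map (cstar_topology A) (cstar_topology A) L \<and>
    (\<forall>a\<in>carrier A. cpositive A a \<longrightarrow> cpositive A (L a)) \<and>
    (\<forall>a\<in>carrier A. \<forall>b\<in>carrier A. L (\<alpha> a \<otimes>\<^bsub>A\<^esub> b) = a \<otimes>\<^bsub>A\<^esub> L b)"

text \<open>
  \<open>M\<close> is a completion of $A_L/N$, with \<open>q\<close> the quotient map followed by the canonical embedding of
  $A_L/N$ into the completion. By the clause on the kernel, \<open>q\<close> induces an injection of $A_L/N$ into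
  \<open>M\<close>; by the next clauses this preserves the $A$-valued form and both actions; its range is dense.
\<close>

definition exel_bimodule ::
    "'a cstar \<Rightarrow> ('a \<Rightarrow> 'a) \<Rightarrow> ('a \<Rightarrow> 'a) \<Rightarrow>
      ('a, 'm) hilbert_mod \<Rightarrow> ('a \<Rightarrow> 'm \<Rightarrow> 'm) \<Rightarrow> ('a \<Rightarrow> 'm) \<Rightarrow> bool"
  where "exel_bimodule A \<alpha> L M \<phi> q \<longleftrightarrow>
    hilbert_bimodule A M \<phi> \<and>
    linear_map A M q \<and>
    {a \<in> carrier A. q a = \<zero>\<^bsub>M\<^esub>} = {a \<in> carrier A. L (star A a \<otimes>\<^bsub>A\<^esub> a) = \<zero>\<^bsub>A\<^esub>} \<and>
    (\<forall>m\<in>carrier A. \<forall>n\<in>carrier A. ip M (q m) (q n) = L (star A m \<otimes>\<^bsub>A\<^esub> n)) \<and>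
    (\<forall>m\<in>carrier A. \<forall>a\<in>carrier A. raction M (q m) a = q (m \<otimes>\<^bsub>A\<^esub> \<alpha> a)) \<and>
    (\<forall>a\<in>carrier A. \<forall>b\<in>carrier A. \<phi> a (q b) = q (a \<otimes>\<^bsub>A\<^esub> b)) \<and>
    norm_topology M (hnorm A M) closure_of (q ` carrier A) = carrier M"

definition toeplitz_covariant ::
    "'a cstar \<Rightarrow> ('a \<Rightarrow> 'a) \<Rightarrow> ('a \<Rightarrow> 'a) \<Rightarrow> 'b cstar \<Rightarrow> ('a \<Rightarrow> 'b) \<Rightarrow> 'b \<Rightarrow> bool"
  where "toeplitz_covariant A \<alpha> L B \<pi> V \<longleftrightarrow>
    \<pi> \<in> star_hom A B \<and> \<pi> \<one>\<^bsub>A\<^esub> = \<one>\<^bsub>B\<^esub> \<and> V \<in> carrier B \<and>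
    (\<forall>a\<in>carrier A. V \<otimes>\<^bsub>B\<^esub> \<pi> a = \<pi> (\<alpha> a) \<otimes>\<^bsub>B\<^esub> V) \<and>
    (\<forall>a\<in>carrier A. star B V \<otimes>\<^bsub>B\<^esub> \<pi> a \<otimes>\<^bsub>B\<^esub> V = \<pi> (L a))"

text \<open>
  \<open>T\<close> together with \<open>(iA, S)\<close> is the Toeplitz algebra $\mathcal{T}(A,\alpha,L)$. The targets of the
  universal property again range over the $C^*$-algebras on the type of \<open>T\<close>. This is no restriction:
  a $C^*$-algebra generated by the image of $A$ and one further element has at most $|A|^{\aleph_0}$
  elements, which is $|A|$ for the Banach space $A$, and \<open>iA\<close> embeds $A$ into that type. The same
  count applies to \<^const>\<open>relative_cuntz_pimsner\<close> on this type when the bimodule is $M_L$, since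
  $q(a) = \phi(a) q(1)$.
\<close>

definition toeplitz_algebra ::
    "'a cstar \<Rightarrow> ('a \<Rightarrow> 'a) \<Rightarrow> ('a \<Rightarrow> 'a) \<Rightarrow> 'u cstar \<Rightarrow> ('a \<Rightarrow> 'u) \<Rightarrow> 'u \<Rightarrow> bool"
  where "toeplitz_algebra A \<alpha> L T iA S \<longleftrightarrow>
    unital_cstar_algebra T \<and> toeplitz_covariant A \<alpha> L T iA S \<and> inj_on iA (carrier A) \<and>
    cstar_generated T (insert S (iA ` carrier A)) = carrier T \<and>
    (\<forall>(B :: 'u cstar) \<pi> V.
      unital_cstar_algebra B \<and> toeplitz_covariant A \<alpha> L B \<pi> V \<longrightarrow>
      (\<exists>\<mu>\<in>star_hom T B. \<mu> \<one>\<^bsub>T\<^esub> = \<one>\<^bsub>B\<^esub> \<and> (\<forall>a\<in>carrier A. \<pi> a = \<mu> (iA a)) \<and> V = \<mu> S))"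

definition A_alphaA_A :: "'a cstar \<Rightarrow> ('a \<Rightarrow> 'a) \<Rightarrow> 'a set"
  where "A_alphaA_A A \<alpha> = closed_span A
    {a \<otimes>\<^bsub>A\<^esub> \<alpha> b \<otimes>\<^bsub>A\<^esub> c | a b c. a \<in> carrier A \<and> b \<in> carrier A \<and> c \<in> carrier A}"

text \<open>\<open>redundancy A T iA S a k\<close> says that $(i_A(a),k)$ is a redundancy.\<close>

definition redundancy :: "'a cstar \<Rightarrow> 'u cstar \<Rightarrow> ('a \<Rightarrow> 'u) \<Rightarrow> 'u \<Rightarrow> 'a \<Rightarrow> 'u \<Rightarrow> bool"
  where "redundancy A T iA S a k \<longleftrightarrow>
    a \<in> carrier A \<and>
    k \<in> closed_span T
      {iA b \<otimes>\<^bsub>T\<^esub> S \<otimes>\<^bsub>T\<^esub> star T S \<otimes>\<^bsub>T\<^esub> iA c | b c. b \<in> carrier A \<and> c \<in> carrier A} \<and>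
    (\<forall>b\<in>carrier A. iA a \<otimes>\<^bsub>T\<^esub> iA b \<otimes>\<^bsub>T\<^esub> S = k \<otimes>\<^bsub>T\<^esub> iA b \<otimes>\<^bsub>T\<^esub> S)"

definition redundancy_ideal ::
    "'a cstar \<Rightarrow> ('a \<Rightarrow> 'a) \<Rightarrow> 'u cstar \<Rightarrow> ('a \<Rightarrow> 'u) \<Rightarrow> 'u \<Rightarrow> 'u set"
  where "redundancy_ideal A \<alpha> T iA S = closed_ideal_generated T
    {iA a \<ominus>\<^bsub>T\<^esub> k | a k. redundancy A T iA S a k \<and> a \<in> A_alphaA_A A \<alpha>}"

definition exel_crossed_product ::
    "'a cstar \<Rightarrow> ('a \<Rightarrow> 'a) \<Rightarrow> 'u cstar \<Rightarrow> ('a \<Rightarrow> 'u) \<Rightarrow> 'u \<Rightarrow> 'u set cstar"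
  where "exel_crossed_product A \<alpha> T iA S = cstar_quot T (redundancy_ideal A \<alpha> T iA S)"

definition exel_quotient_map ::
    "'a cstar \<Rightarrow> ('a \<Rightarrow> 'a) \<Rightarrow> 'u cstar \<Rightarrow> ('a \<Rightarrow> 'u) \<Rightarrow> 'u \<Rightarrow> 'u \<Rightarrow> 'u set"
  where "exel_quotient_map A \<alpha> T iA S x = redundancy_ideal A \<alpha> T iA S +>\<^bsub>T\<^esub> x"

end

theory Submission
  imports Defs
begin

text \<open>
  Since $i_A$ is isometric, $q(a) \mapsto i_A(a)S$ extends to an isometric Toeplitz representation
  \<open>\<psi>\<close> of $M_L$ in the Toeplitz algebra. The $C^*$-algebra $C$ spanned by the elements
  $\psi(x)\psi(y)^*$, which is the closed span of the $i_A(b)SS^*i_A(c)$, is then identified with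
  $\mathcal{K}(M_L)$ by $k\,\psi(m) = \psi(F m)$, and $(i_A(a),k)$ is a redundancy iff $k \in C$
  corresponds to $\phi(a)$. Hence redundancies with $a \in \overline{A\alpha(A)A}$ are exactly the
  coisometry relations for $K_\alpha$, and the two universal properties give mutually inverse
  homomorphisms. The general facts on $C^*$-algebras needed for this are obtained without spectral
  theory, from square roots of self-adjoint elements and from unitaries of the form
  $h + i\sqrt{1 - h^2}$.
\<close>

section \<open>Normed spaces on carrier sets\<close>

text \<open>Three obstacles shape the proof. First, the norm of \<open>adjointables\<close> is a
  bare supremum, and the definition asks of an operator only that it has an adjoint; linearity and
  boundedness are derived before \<open>compacts\<close> can be handled as a closed span. The
  crucial estimate is then |k| <= |F| for a finite-rank operator F and its partner k in the Toeplitz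
  algebra: it turns a Cauchy sequence of operators into a Cauchy sequence of partners, and in the
  absence of functional calculus it comes from powers of a self-adjoint k. Second, the universal
  property of \<open>Ob\<close> admits only targets on the type of T, whereas
  \<open>exel_crossed_product\<close> consists of sets; an intermediate quotient on chosen
  representatives bridges the gap. Third, the Toeplitz algebra is universal for unital targets, and
  no unit of \<open>Ob\<close> is given; the image under \<open>kA\<close> of the unit of A turns
  out to be one and is written into the record. Homomorphisms are shown to be contractive on domains
  without a unit, since such domains occur: the span C, and \<open>Ob\<close> with its original
  \<open>one\<close> field.\<close>

lemma complex_field_simps [simp]:
  "carrier complex_field = UNIV" "x \<otimes>\<^bsub>complex_field\<^esub> y = x * y" "\<one>\<^bsub>complex_field\<^esub> = 1"
  "\<zero>\<^bsub>complex_field\<^esub> = 0" "x \<oplus>\<^bsub>complex_field\<^esub> y = x + y"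
  by (simp_all add: complex_field_def)

lemma cring_complex_field: "cring complex_field"
proof (rule cringI)
  show "abelian_group complex_field"
  proof (rule abelian_groupI)
    fix x :: complex
    show "\<exists>y\<in>carrier complex_field. y \<oplus>\<^bsub>complex_field\<^esub> x = \<zero>\<^bsub>complex_field\<^esub>"
      by (intro bexI[of _ "- x"]) simp_all
  qed (simp_all add: algebra_simps)
  show "comm_monoid complex_field"
    by (rule comm_monoidI) (simp_all add: algebra_simps)
qed (simp add: algebra_simps)

lemma a_inv_complex_field [simp]: "\<ominus>\<^bsub>complex_field\<^esub> x = - x"
proof -
  interpret cring complex_field by (rule cring_complex_field)
  have "\<ominus>\<^bsub>complex_field\<^esub> x \<oplus>\<^bsub>complex_field\<^esub> x = \<zero>\<^bsub>complex_field\<^esub>"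
    by (rule l_neg) simp
  then show ?thesis by (simp add: eq_neg_iff_add_eq_0)
qed

text \<open>One locale serves algebras, Hilbert modules and spaces of operators. The norm is a
  parameter because the record of a Hilbert module has no norm field.\<close>

locale normed_space = Module.module complex_field V
  for V :: "(complex, 'v, 'z) module_scheme" (structure) +
  fixes nrm :: "'v \<Rightarrow> real"
  assumes nrm_nonneg: "x \<in> carrier V \<Longrightarrow> 0 \<le> nrm x"
    and nrm_eq_zero: "x \<in> carrier V \<Longrightarrow> nrm x = 0 \<longleftrightarrow> x = \<zero>"
    and nrm_triangle: "\<lbrakk>x \<in> carrier V; y \<in> carrier V\<rbrakk> \<Longrightarrow> nrm (x \<oplus> y) \<le> nrm x + nrm y"
    and nrm_smult: "x \<in> carrier V \<Longrightarrow> nrm (c \<odot> x) = cmod c * nrm x"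

context Module.module
begin

lemma add_minus_cancel: "\<lbrakk>x \<in> carrier M; y \<in> carrier M\<rbrakk> \<Longrightarrow> (x \<ominus>\<^bsub>M\<^esub> y) \<oplus>\<^bsub>M\<^esub> y = x"
  by (simp add: M.minus_eq M.add.m_assoc M.l_neg)

lemma minus_split: "\<lbrakk>x \<in> carrier M; y \<in> carrier M; z \<in> carrier M\<rbrakk>
    \<Longrightarrow> x \<ominus>\<^bsub>M\<^esub> z = (x \<ominus>\<^bsub>M\<^esub> y) \<oplus>\<^bsub>M\<^esub> (y \<ominus>\<^bsub>M\<^esub> z)"
  by (simp add: M.minus_eq M.add.m_assoc M.r_neg1 M.r_neg2)

lemma minus_minus_swap: "\<lbrakk>x \<in> carrier M; y \<in> carrier M\<rbrakk> \<Longrightarrow> \<ominus>\<^bsub>M\<^esub> (x \<ominus>\<^bsub>M\<^esub> y) = y \<ominus>\<^bsub>M\<^esub> x"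
  by (simp add: M.minus_eq M.minus_add M.add.m_comm)

lemma minus_add_distrib:
  "\<lbrakk>x \<in> carrier M; y \<in> carrier M; u \<in> carrier M; v \<in> carrier M\<rbrakk>
    \<Longrightarrow> (x \<oplus>\<^bsub>M\<^esub> u) \<ominus>\<^bsub>M\<^esub> (y \<oplus>\<^bsub>M\<^esub> v) = (x \<ominus>\<^bsub>M\<^esub> y) \<oplus>\<^bsub>M\<^esub> (u \<ominus>\<^bsub>M\<^esub> v)"
  by (simp add: M.minus_eq M.minus_add M.add.m_ac)

lemma minus_self: "x \<in> carrier M \<Longrightarrow> x \<ominus>\<^bsub>M\<^esub> x = \<zero>\<^bsub>M\<^esub>"
  by (simp add: M.minus_eq M.r_neg)

lemma minus_eq_zero_iff: "\<lbrakk>x \<in> carrier M; y \<in> carrier M\<rbrakk> \<Longrightarrow> x \<ominus>\<^bsub>M\<^esub> y = \<zero>\<^bsub>M\<^esub> \<longleftrightarrow> x = y"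
  by (metis add_minus_cancel minus_self M.l_zero)

lemma smult_minus_distrib: "\<lbrakk>a \<in> carrier R; x \<in> carrier M; y \<in> carrier M\<rbrakk>
    \<Longrightarrow> a \<odot>\<^bsub>M\<^esub> (x \<ominus>\<^bsub>M\<^esub> y) = a \<odot>\<^bsub>M\<^esub> x \<ominus>\<^bsub>M\<^esub> a \<odot>\<^bsub>M\<^esub> y"
  by (simp add: M.minus_eq smult_r_distr smult_r_minus)

end

context normed_space
begin

lemma smult_smult: "x \<in> carrier V \<Longrightarrow> c \<odot> (d \<odot> x) = (c * d) \<odot> x"
  and smult_1 [simp]: "x \<in> carrier V \<Longrightarrow> 1 \<odot> x = x"
  and smult_0 [simp]: "x \<in> carrier V \<Longrightarrow> 0 \<odot> x = \<zero>"
  and smult_add_left: "x \<in> carrier V \<Longrightarrow> (c + d) \<odot> x = c \<odot> x \<oplus> d \<odot> x"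
  and minus_as_smult: "x \<in> carrier V \<Longrightarrow> \<ominus> x = (- 1) \<odot> x"
  and smult_neg: "x \<in> carrier V \<Longrightarrow> (- c) \<odot> x = \<ominus> (c \<odot> x)"
  using smult_assoc1[of c d x] smult_one[of x] smult_l_null[of x] smult_l_distr[of c d x]
    smult_l_minus[of 1 x] smult_l_minus[of c x]
  by simp_all

lemma smult_closed' [simp]: "x \<in> carrier V \<Longrightarrow> c \<odot> x \<in> carrier V"
  by (simp add: smult_closed)

lemma smult_add_right: "\<lbrakk>x \<in> carrier V; y \<in> carrier V\<rbrakk> \<Longrightarrow> c \<odot> (x \<oplus> y) = c \<odot> x \<oplus> c \<odot> y"
  by (simp add: smult_r_distr)

lemma smult_minus_right: "\<lbrakk>x \<in> carrier V; y \<in> carrier V\<rbrakk> \<Longrightarrow> c \<odot> (x \<ominus> y) = c \<odot> x \<ominus> c \<odot> y"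
  by (simp add: smult_minus_distrib)

lemma nrm_zero [simp]: "nrm \<zero> = 0"
  by (simp add: nrm_eq_zero)

lemma nrm_a_inv: "x \<in> carrier V \<Longrightarrow> nrm (\<ominus> x) = nrm x"
  by (simp add: minus_as_smult[of x] nrm_smult)

lemma nrm_minus_commute: "\<lbrakk>x \<in> carrier V; y \<in> carrier V\<rbrakk> \<Longrightarrow> nrm (x \<ominus> y) = nrm (y \<ominus> x)"
  by (metis minus_minus_swap nrm_a_inv M.minus_closed)

lemma nrm_minus_le: "\<lbrakk>x \<in> carrier V; y \<in> carrier V\<rbrakk> \<Longrightarrow> nrm (x \<ominus> y) \<le> nrm x + nrm y"
  by (metis M.minus_eq nrm_a_inv nrm_triangle M.a_inv_closed)

lemma nrm_minus_triangle: "\<lbrakk>x \<in> carrier V; y \<in> carrier V; z \<in> carrier V\<rbrakk>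
    \<Longrightarrow> nrm (x \<ominus> z) \<le> nrm (x \<ominus> y) + nrm (y \<ominus> z)"
  by (metis minus_split nrm_triangle M.minus_closed)

lemma nrm_le_minus: "\<lbrakk>x \<in> carrier V; y \<in> carrier V\<rbrakk> \<Longrightarrow> nrm x \<le> nrm (x \<ominus> y) + nrm y"
  by (metis add_minus_cancel nrm_triangle M.minus_closed)

lemma eq_if_nrm_less:
  assumes "x \<in> carrier V" "y \<in> carrier V" and "\<And>e. 0 < e \<Longrightarrow> nrm (x \<ominus> y) < e"
  shows "x = y"
proof -
  have "nrm (x \<ominus> y) = 0"
    using assms(3)[of "nrm (x \<ominus> y)"] nrm_nonneg[of "x \<ominus> y"] assms(1,2) by force
  then show ?thesis by (simp add: assms nrm_eq_zero minus_eq_zero_iff)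
qed

lemma metric_space: "Metric_space (carrier V) (norm_dist V nrm)"
proof
  show "0 \<le> norm_dist V nrm x y" for x y
    by (simp add: norm_dist_def nrm_nonneg)
  show "norm_dist V nrm x y = norm_dist V nrm y x" for x y
    by (simp add: norm_dist_def nrm_minus_commute)
  show "(norm_dist V nrm x y = 0) = (x = y)" if "x \<in> carrier V" "y \<in> carrier V" for x y
    using that by (simp add: norm_dist_def nrm_eq_zero minus_eq_zero_iff)
  show "norm_dist V nrm x z \<le> norm_dist V nrm x y + norm_dist V nrm y z"
    if "x \<in> carrier V" "y \<in> carrier V" "z \<in> carrier V" for x y z
    using that by (simp add: norm_dist_def nrm_minus_triangle)
qed

lemma in_closure_iff:
  assumes "S \<subseteq> carrier V"
  shows "x \<in> Abstract_Topology.closure_of (norm_topology V nrm) S \<longleftrightarrow>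
    x \<in> carrier V \<and> (\<forall>e>0. \<exists>y\<in>S. nrm (x \<ominus> y) < e)"
proof -
  interpret Metric_space "carrier V" "norm_dist V nrm" by (rule metric_space)
  show ?thesis
    using assms unfolding norm_topology_def metric_closure_of in_mball norm_dist_def
    by (auto simp: subset_iff)
qed

lemma closedin_iff:
  "closedin (norm_topology V nrm) S \<longleftrightarrow> S \<subseteq> carrier V \<and>
    (\<forall>x\<in>carrier V. (\<forall>e>0. \<exists>y\<in>S. nrm (x \<ominus> y) < e) \<longrightarrow> x \<in> S)"
proof -
  interpret Metric_space "carrier V" "norm_dist V nrm" by (rule metric_space)
  have top: "topspace (norm_topology V nrm) = carrier V"
    by (simp add: norm_topology_def)
  show ?thesis
  proof (cases "S \<subseteq> carrier V")
    case True
    then have "closedin (norm_topology V nrm) S \<longleftrightarrow> Abstract_Topology.closure_of (norm_topology V nrm) S \<subseteq> S"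
      by (metis closure_of_eq closure_of_subset top subset_antisym order_refl)
    also have "\<dots> \<longleftrightarrow> (\<forall>x\<in>carrier V. (\<forall>e>0. \<exists>y\<in>S. nrm (x \<ominus> y) < e) \<longrightarrow> x \<in> S)"
      using in_closure_iff[OF True] by auto
    finally show ?thesis using True by simp
  qed (use closedin_subset[of "norm_topology V nrm" S] top in auto)
qed

text \<open>\<open>norm_dist\<close> is 0 off the carrier, so Cauchy sequences and limits translate
  into statements on norms only when all terms are known to lie in the carrier; hence the guard
  \<open>?P\<close>.\<close>

lemma norm_complete_iff:
  "norm_complete V nrm \<longleftrightarrow> (\<forall>f. (\<forall>k. f k \<in> carrier V) \<longrightarrow>
     (\<forall>e>0. \<exists>N. \<forall>m\<ge>N. \<forall>k\<ge>N. nrm (f m \<ominus> f k) < e) \<longrightarrow>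
     (\<exists>l\<in>carrier V. (\<lambda>k. nrm (f k \<ominus> l)) \<longlonglongrightarrow> 0))" (is "_ \<longleftrightarrow> (\<forall>f. ?P f \<longrightarrow> ?Q f \<longrightarrow> ?R f)")
proof -
  interpret Metric_space "carrier V" "norm_dist V nrm" by (rule metric_space)
  have 1: "MCauchy f \<longleftrightarrow> ?P f \<and> ?Q f" for f
    unfolding MCauchy_def norm_dist_def by (auto simp: image_subset_iff)
  have 2: "(\<exists>x. limitin mtopology f x sequentially) \<longleftrightarrow> ?R f" if "?P f" for f
    using that unfolding limitin_metric norm_dist_def LIMSEQ_iff eventually_sequentially
    by (auto simp: nrm_nonneg Bex_def)
  show ?thesis
    unfolding norm_complete_def mcomplete_def
  proof (rule iff_allI)
    show "(MCauchy f \<longrightarrow> (\<exists>x. limitin mtopology f x sequentially)) \<longleftrightarrow> (?P f \<longrightarrow> ?Q f \<longrightarrow> ?R f)" for f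
      using 1[of f] 2[of f] by argo
  qed
qed


text \<open>All later closure and continuity arguments are sequential. Membership in the carrier is
  built in, so that it need not be tracked separately.\<close>

definition nlim :: "(nat \<Rightarrow> 'v) \<Rightarrow> 'v \<Rightarrow> bool"
  where "nlim f l \<longleftrightarrow> (\<forall>k. f k \<in> carrier V) \<and> l \<in> carrier V \<and> (\<lambda>k. nrm (f k \<ominus> l)) \<longlonglongrightarrow> 0"

lemma nlim_closed: "nlim f l \<Longrightarrow> f k \<in> carrier V" "nlim f l \<Longrightarrow> l \<in> carrier V"
  by (simp_all add: nlim_def)

lemma nlimI:
  assumes "\<And>k. f k \<in> carrier V" "l \<in> carrier V" "\<And>k. nrm (f k \<ominus> l) \<le> g k" "g \<longlonglongrightarrow> 0"
  shows "nlim f l"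
  unfolding nlim_def using assms
  by (auto intro!: tendsto_sandwich[OF _ _ tendsto_const assms(4)] always_eventually nrm_nonneg)

lemma nlim_unique:
  assumes "nlim f l" "nlim f m"
  shows "l = m"
proof (rule eq_if_nrm_less)
  show l: "l \<in> carrier V" and m: "m \<in> carrier V" using assms by (simp_all add: nlim_def)
  fix e :: real assume e: "0 < e"
  have "(\<lambda>k. nrm (f k \<ominus> l) + nrm (f k \<ominus> m)) \<longlonglongrightarrow> 0 + 0"
    using assms by (intro tendsto_add) (simp_all add: nlim_def)
  then have "\<forall>\<^sub>F k in sequentially. nrm (f k \<ominus> l) + nrm (f k \<ominus> m) < e"
    using e by (simp add: order_tendstoD(2))
  then obtain k where "nrm (f k \<ominus> l) + nrm (f k \<ominus> m) < e"
    using eventually_happens'[OF sequentially_bot] by blast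
  moreover have "f k \<in> carrier V" using assms by (simp add: nlim_def)
  ultimately show "nrm (l \<ominus> m) < e"
    using nrm_minus_triangle[of l "f k" m] nrm_minus_commute[of l "f k"] l m by simp
qed

lemma nlim_const: "l \<in> carrier V \<Longrightarrow> nlim (\<lambda>k. l) l"
  by (simp add: nlim_def minus_self)

lemma nlim_add:
  assumes "nlim f l" "nlim g m"
  shows "nlim (\<lambda>k. f k \<oplus> g k) (l \<oplus> m)"
proof (rule nlimI)
  note c = nlim_closed[OF assms(1)] nlim_closed[OF assms(2)]
  show "f k \<oplus> g k \<in> carrier V" "l \<oplus> m \<in> carrier V" for k using c by simp_all
  show "nrm ((f k \<oplus> g k) \<ominus> (l \<oplus> m)) \<le> nrm (f k \<ominus> l) + nrm (g k \<ominus> m)" for k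
    using c by (simp add: minus_add_distrib nrm_triangle)
  show "(\<lambda>k. nrm (f k \<ominus> l) + nrm (g k \<ominus> m)) \<longlonglongrightarrow> 0"
    using assms tendsto_add[of "\<lambda>k. nrm (f k \<ominus> l)" 0 sequentially "\<lambda>k. nrm (g k \<ominus> m)" 0]
    by (simp add: nlim_def)
qed

lemma nlim_smult:
  assumes "nlim f l"
  shows "nlim (\<lambda>k. c \<odot> f k) (c \<odot> l)"
proof (rule nlimI)
  note c = nlim_closed[OF assms(1)]
  show "c \<odot> f k \<in> carrier V" "c \<odot> l \<in> carrier V" for k using c by simp_all
  show "nrm ((c \<odot> f k) \<ominus> (c \<odot> l)) \<le> cmod c * nrm (f k \<ominus> l)" for k
    using c by (simp add: smult_minus_right[symmetric] nrm_smult)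
  show "(\<lambda>k. cmod c * nrm (f k \<ominus> l)) \<longlonglongrightarrow> 0"
    using assms by (simp add: nlim_def tendsto_mult_right_zero)
qed

lemma nlim_minus:
  assumes "nlim f l" "nlim g m"
  shows "nlim (\<lambda>k. f k \<ominus> g k) (l \<ominus> m)"
  using nlim_add[OF assms(1) nlim_smult[OF assms(2), of "-1"]] nlim_closed[OF assms(1)]
    nlim_closed[OF assms(2)] by (simp add: M.minus_eq minus_as_smult)

lemma nlim_ignore_initial:
  assumes "nlim f l" and "\<And>n. r n \<ge> (n::nat)"
  shows "nlim (\<lambda>n. f (r n)) l"
proof -
  have "filterlim r at_top sequentially"
    using assms(2) by (intro filterlim_at_top_mono[OF filterlim_ident always_eventually]) auto
  then show ?thesis
    using assms(1) filterlim_compose[of "\<lambda>k. nrm (f k \<ominus> l)" "nhds 0" sequentially r sequentially]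
    by (simp add: nlim_def)
qed

lemma nlim_Suc: "nlim f l \<Longrightarrow> nlim (\<lambda>n. f (Suc n)) l"
  by (rule nlim_ignore_initial) simp_all

lemma nlim_nrm:
  assumes "nlim f l"
  shows "(\<lambda>k. nrm (f k)) \<longlonglongrightarrow> nrm l"
proof -
  note c = nlim_closed[OF assms(1)]
  have "norm (nrm (f k) - nrm l) \<le> nrm (f k \<ominus> l)" for k
    using nrm_le_minus[of "f k" l] nrm_le_minus[of l "f k"] c nrm_minus_commute[of l "f k"] by auto
  then have "(\<lambda>k. nrm (f k) - nrm l) \<longlonglongrightarrow> 0"
    using assms Lim_null_comparison[of "\<lambda>k. nrm (f k) - nrm l" "\<lambda>k. nrm (f k \<ominus> l)" sequentially]
    by (simp add: nlim_def)
  then show ?thesis by (simp add: LIM_zero_cancel)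
qed

lemma nlim_nrm_le: "\<lbrakk>nlim f l; \<And>k. nrm (f k) \<le> c\<rbrakk> \<Longrightarrow> nrm l \<le> c"
  using nlim_nrm Lim_bounded by blast

lemma nlim_in_closed: "\<lbrakk>nlim f l; closedin (norm_topology V nrm) S; \<And>k. f k \<in> S\<rbrakk> \<Longrightarrow> l \<in> S"
proof -
  assume a: "nlim f l" "closedin (norm_topology V nrm) S" "\<And>k. f k \<in> S"
  note c = nlim_closed[OF a(1)]
  have "\<exists>y\<in>S. nrm (l \<ominus> y) < e" if "0 < e" for e
  proof -
    have "\<forall>\<^sub>F k in sequentially. nrm (f k \<ominus> l) < e"
      using a(1) that order_tendstoD(2)[of "\<lambda>k. nrm (f k \<ominus> l)" 0 sequentially e] unfolding nlim_def
      by linarith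
    then obtain k where "nrm (f k \<ominus> l) < e"
      using eventually_happens'[OF sequentially_bot] by blast
    then have "nrm (l \<ominus> f k) < e" using nrm_minus_commute[of l "f k"] c by simp
    then show ?thesis using a(3) by blast
  qed
  then show ?thesis using a(2) c by (auto simp: closedin_iff)
qed

lemma approx_nlim:
  assumes "x \<in> carrier V" "S \<subseteq> carrier V" "\<And>e. 0 < e \<Longrightarrow> \<exists>y\<in>S. nrm (x \<ominus> y) < e"
  obtains f where "nlim f x" "\<And>k. f k \<in> S"
proof -
  have "\<exists>y\<in>S. nrm (x \<ominus> y) < inverse (Suc k)" for k
    using assms(3) by simp
  then obtain f where f: "f k \<in> S" "nrm (x \<ominus> f k) < inverse (Suc k)" for k by metis
  have "nlim f x"
  proof (rule nlimI)
    show "nrm (f k \<ominus> x) \<le> inverse (Suc k)" for k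
      using f[of k] assms nrm_minus_commute[of x "f k"] by (auto simp: subset_iff)
  qed (use f assms LIMSEQ_inverse_real_of_nat in auto)
  then show ?thesis using f that by blast
qed

lemma closedinI:
  assumes "S \<subseteq> carrier V" "\<And>f l. \<lbrakk>nlim f l; \<And>k. f k \<in> S\<rbrakk> \<Longrightarrow> l \<in> S"
  shows "closedin (norm_topology V nrm) S"
  unfolding closedin_iff
proof (intro conjI ballI impI)
  fix x assume x: "x \<in> carrier V" "\<forall>e>0. \<exists>y\<in>S. nrm (x \<ominus> y) < e"
  then obtain f where "nlim f x" "\<And>k. f k \<in> S"
    using approx_nlim[of x S] assms(1) by blast
  then show "x \<in> S" by (rule assms(2))
qed (rule assms(1))

lemma nlim_exists:
  assumes "norm_complete V nrm" "\<And>k. f k \<in> carrier V"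
    and "\<And>e. 0 < e \<Longrightarrow> \<exists>N. \<forall>m\<ge>N. \<forall>k\<ge>N. nrm (f m \<ominus> f k) < e"
  obtains l where "nlim f l"
proof -
  have "\<exists>l\<in>carrier V. (\<lambda>k. nrm (f k \<ominus> l)) \<longlonglongrightarrow> 0"
    using assms(1)[unfolded norm_complete_iff, THEN spec[of _ f]] assms(2,3) by simp
  then show thesis using that assms(2) by (auto simp: nlim_def)
qed

lemma nlim_Cauchy:
  assumes "nlim f l" "0 < e"
  shows "\<exists>N. \<forall>m\<ge>N. \<forall>k\<ge>N. nrm (f m \<ominus> f k) < e"
proof -
  note c = nlim_closed[OF assms(1)]
  have "\<forall>\<^sub>F k in sequentially. nrm (f k \<ominus> l) < e/2"
    using assms order_tendstoD(2)[of "\<lambda>k. nrm (f k \<ominus> l)" 0 sequentially "e/2"] unfolding nlim_def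
    by linarith
  then obtain N where N: "\<And>k. k \<ge> N \<Longrightarrow> nrm (f k \<ominus> l) < e/2"
    by (auto simp: eventually_sequentially)
  have "nrm (f m \<ominus> f k) < e" if "m \<ge> N" "k \<ge> N" for m k
    using N[of m] N[of k] that nrm_minus_triangle[of "f m" l "f k"] nrm_minus_commute[of l "f k"] c
    by simp
  then show ?thesis by blast
qed

end

section \<open>Square roots in C*-algebras\<close>

sublocale cstar_algebra \<subseteq> normed_space A "cnorm A"
  by unfold_locales
    (auto intro: cnorm_nonneg cnorm_triangle simp: cnorm_eq_zero cnorm_smult)

context cstar_algebra
begin

declare mult_closed [simp] star_closed [simp] star_star [simp]

lemma mult_zero_left [simp]: "x \<in> carrier A \<Longrightarrow> \<zero> \<otimes> x = \<zero>"
  using mult_smult_left[of \<zero> x 0] by simp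

lemma mult_zero_right [simp]: "x \<in> carrier A \<Longrightarrow> x \<otimes> \<zero> = \<zero>"
  using mult_smult_right[of x \<zero> 0] by simp

lemma mult_a_inv_left: "\<lbrakk>x \<in> carrier A; y \<in> carrier A\<rbrakk> \<Longrightarrow> \<ominus> x \<otimes> y = \<ominus> (x \<otimes> y)"
  by (simp add: minus_as_smult mult_smult_left)

lemma mult_a_inv_right: "\<lbrakk>x \<in> carrier A; y \<in> carrier A\<rbrakk> \<Longrightarrow> x \<otimes> \<ominus> y = \<ominus> (x \<otimes> y)"
  by (simp add: minus_as_smult mult_smult_right)

lemma mult_minus_left: "\<lbrakk>x \<in> carrier A; y \<in> carrier A; z \<in> carrier A\<rbrakk>
    \<Longrightarrow> (x \<ominus> y) \<otimes> z = x \<otimes> z \<ominus> y \<otimes> z"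
  by (simp add: M.minus_eq mult_add_left mult_a_inv_left)

lemma mult_minus_right: "\<lbrakk>x \<in> carrier A; y \<in> carrier A; z \<in> carrier A\<rbrakk>
    \<Longrightarrow> z \<otimes> (x \<ominus> y) = z \<otimes> x \<ominus> z \<otimes> y"
  by (simp add: M.minus_eq mult_add_right mult_a_inv_right)

lemma star_zero [simp]: "star A \<zero> = \<zero>"
  using star_smult[of \<zero> 0] by simp

lemma star_a_inv: "x \<in> carrier A \<Longrightarrow> star A (\<ominus> x) = \<ominus> (star A x)"
  by (simp add: minus_as_smult star_smult)

lemma star_minus: "\<lbrakk>x \<in> carrier A; y \<in> carrier A\<rbrakk> \<Longrightarrow> star A (x \<ominus> y) = star A x \<ominus> star A y"
  by (simp add: M.minus_eq star_add star_a_inv)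

lemma cnorm_star: "x \<in> carrier A \<Longrightarrow> cnorm A (star A x) = cnorm A x"
proof -
  have le: "cnorm A y \<le> cnorm A (star A y)" if y: "y \<in> carrier A" for y
  proof (cases "cnorm A y = 0")
    case False
    then have "0 < cnorm A y" using cnorm_nonneg[OF y] by simp
    moreover have "cnorm A y * cnorm A y \<le> cnorm A (star A y) * cnorm A y"
      using cstar_identity[OF y] cnorm_mult[of "star A y" y] y by (simp add: power2_eq_square)
    ultimately show ?thesis by simp
  qed (use y cnorm_nonneg in auto)
  show "x \<in> carrier A \<Longrightarrow> cnorm A (star A x) = cnorm A x"
    using le[of x] le[of "star A x"] by simp
qed

lemma cstar_identity': "x \<in> carrier A \<Longrightarrow> cnorm A (x \<otimes> star A x) = (cnorm A x)\<^sup>2"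
  using cstar_identity[of "star A x"] by (simp add: cnorm_star)

lemma cnorm_square: "\<lbrakk>x \<in> carrier A; star A x = x\<rbrakk> \<Longrightarrow> cnorm A (x \<otimes> x) = (cnorm A x)\<^sup>2"
  using cstar_identity[of x] by simp

lemma star_mult_self_eq_zero: "\<lbrakk>x \<in> carrier A; star A x \<otimes> x = \<zero>\<rbrakk> \<Longrightarrow> x = \<zero>"
  using cstar_identity[of x] by (simp add: cnorm_eq_zero[symmetric])

lemma nlim_mult:
  assumes "nlim f l" "nlim g m"
  shows "nlim (\<lambda>k. f k \<otimes> g k) (l \<otimes> m)"
proof (rule nlimI)
  note c = nlim_closed[OF assms(1)] nlim_closed[OF assms(2)]
  show "f k \<otimes> g k \<in> carrier A" "l \<otimes> m \<in> carrier A" for k using c by simp_all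
  show "cnorm A (f k \<otimes> g k \<ominus> l \<otimes> m) \<le>
      cnorm A (f k \<ominus> l) * cnorm A (g k) + cnorm A l * cnorm A (g k \<ominus> m)" for k
  proof -
    have "f k \<otimes> g k \<ominus> l \<otimes> m = (f k \<ominus> l) \<otimes> g k \<oplus> l \<otimes> (g k \<ominus> m)"
      using c minus_split[of "f k \<otimes> g k" "l \<otimes> g k" "l \<otimes> m"]
      by (simp add: mult_minus_left mult_minus_right)
    then show ?thesis
      using cnorm_triangle[of "(f k \<ominus> l) \<otimes> g k" "l \<otimes> (g k \<ominus> m)"]
        cnorm_mult[of "f k \<ominus> l" "g k"] cnorm_mult[of l "g k \<ominus> m"] c by simp
  qed
  have "(\<lambda>k. cnorm A (f k \<ominus> l) * cnorm A (g k) + cnorm A l * cnorm A (g k \<ominus> m))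
      \<longlonglongrightarrow> 0 * cnorm A m + cnorm A l * 0"
    using assms by (intro tendsto_intros nlim_nrm[OF assms(2)]) (simp_all add: nlim_def)
  then show "(\<lambda>k. cnorm A (f k \<ominus> l) * cnorm A (g k) + cnorm A l * cnorm A (g k \<ominus> m)) \<longlonglongrightarrow> 0"
    by simp
qed

lemma nlim_star:
  assumes "nlim f l"
  shows "nlim (\<lambda>k. star A (f k)) (star A l)"
  using assms by (simp add: nlim_def star_minus[symmetric] cnorm_star)

text \<open>
  The fixed point of $y \mapsto (x + y^2)/2$ is $1 - \sqrt{1 - x}$, written without a unit. Since the
  coefficients of this power series are nonnegative, the iterates are dominated by their values at
  the scalar $1$, which gives convergence up to the boundary of the unit ball.
\<close>

lemma sqrt_exists:
  assumes x: "x \<in> carrier A" "star A x = x" "cnorm A x \<le> 1"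
  obtains y where "y \<in> carrier A" "star A y = y" "cnorm A y \<le> 1" "y \<oplus> y = x \<oplus> y \<otimes> y"
    "\<And>z. \<lbrakk>z \<in> carrier A; z \<otimes> x = x \<otimes> z\<rbrakk> \<Longrightarrow> z \<otimes> y = y \<otimes> z"
proof -
  define Y where "Y = rec_nat \<zero> (\<lambda>_ y. (1/2) \<odot> (x \<oplus> y \<otimes> y))"
  have Y0: "Y 0 = \<zero>" and YS: "Y (Suc n) = (1/2) \<odot> (x \<oplus> Y n \<otimes> Y n)" for n
    by (simp_all add: Y_def)
  define t :: "nat \<Rightarrow> real" where "t = rec_nat 0 (\<lambda>_ s. (1 + s\<^sup>2) / 2)"
  have t0: "t 0 = 0" and tS: "t (Suc n) = (1 + (t n)\<^sup>2) / 2" for n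
    by (simp_all add: t_def)
  have t01: "0 \<le> t n \<and> t n \<le> 1" for n
    by (induction n) (auto simp: t0 tS power_le_one)
  have tinc: "t n \<le> t (Suc n)" for n
    using zero_le_power2[of "t n - 1"] by (simp add: tS power2_eq_square algebra_simps)
  have "convergent t"
    using t01 tinc by (intro Bseq_monoseq_convergent BseqI'[of _ 1] incseq_imp_monoseq incseq_SucI) auto
  then have tC: "Cauchy t" by (simp add: Cauchy_convergent_iff)
  have Yc [simp]: "Y n \<in> carrier A" for n
    by (induction n) (simp_all add: Y0 YS x)
  have Ystar: "star A (Y n) = Y n" for n
    by (induction n) (simp_all add: Y0 YS x star_smult star_add star_mult)
  have Yn: "cnorm A (Y n) \<le> t n" for n
  proof (induction n)
    case (Suc n)
    have "cnorm A (x \<oplus> Y n \<otimes> Y n) \<le> 1 + cnorm A (Y n) * cnorm A (Y n)"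
      using cnorm_triangle[of x "Y n \<otimes> Y n"] cnorm_mult[of "Y n" "Y n"] x by simp
    also have "\<dots> \<le> 1 + (t n)\<^sup>2"
      using Suc t01[of n] cnorm_nonneg[of "Y n"] by (simp add: power2_eq_square mult_mono)
    finally show ?case by (simp add: YS tS cnorm_smult x)
  qed (simp add: Y0 t0)
  have Ycomm: "z \<otimes> Y n = Y n \<otimes> z" if z: "z \<in> carrier A" "z \<otimes> x = x \<otimes> z" for z n
  proof (induction n)
    case (Suc n)
    then have "z \<otimes> (Y n \<otimes> Y n) = Y n \<otimes> Y n \<otimes> z"
      using z by (metis Yc mult_assoc)
    then show ?case
      using z x by (simp add: YS mult_smult_left mult_smult_right mult_add_left mult_add_right)
  qed (simp add: Y0 z)
  \<comment> \<open>\<open>Ycomm\<close> is used twice: with z = x, and then with z = Y m, which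
    therefore commutes with x.\<close>
  have Ymn: "Y m \<otimes> Y n = Y n \<otimes> Y m" for m n
    by (metis Ycomm Yc x(1))
  have step: "cnorm A (Y (Suc n) \<ominus> Y n) \<le> t (Suc n) - t n" for n
  proof (induction n)
    case 0
    then show ?case using Yn[of "Suc 0"] by (simp add: Y0 t0 M.minus_eq minus_as_smult[of \<zero>])
  next
    case (Suc n)
    let ?a = "Y (Suc n)" and ?b = "Y n"
    \<comment> \<open>Commuting iterates give a^2 - b^2 = (a - b)(a + b), the same factorisation as
      for the scalars t, so the bound by scalar differences passes from n to n + 1.\<close>
    have 1: "(?a \<ominus> ?b) \<otimes> (?a \<oplus> ?b) = ?a \<otimes> ?a \<ominus> ?b \<otimes> ?b"
      using minus_split[of "?a \<otimes> ?a" "?a \<otimes> ?b" "?b \<otimes> ?b"] Ymn[of "Suc n" n]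
        minus_add_distrib[of "?a \<otimes> ?a" "?b \<otimes> ?a" "?a \<otimes> ?b" "?b \<otimes> ?b"]
      by (simp add: mult_minus_left mult_add_right)
    have "Y (Suc (Suc n)) \<ominus> Y (Suc n) = (1/2) \<odot> ((x \<oplus> ?a \<otimes> ?a) \<ominus> (x \<oplus> ?b \<otimes> ?b))"
      using x by (simp add: smult_minus_right YS[symmetric])
    also have "\<dots> = (1/2) \<odot> ((?a \<ominus> ?b) \<otimes> (?a \<oplus> ?b))"
      using x by (simp add: minus_add_distrib minus_self 1)
    finally have "cnorm A (Y (Suc (Suc n)) \<ominus> Y (Suc n)) \<le> 1/2 * (cnorm A (?a \<ominus> ?b) * cnorm A (?a \<oplus> ?b))"
      using cnorm_mult[of "?a \<ominus> ?b" "?a \<oplus> ?b"] by (simp add: cnorm_smult)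
    also have "\<dots> \<le> 1/2 * ((t (Suc n) - t n) * (t (Suc n) + t n))"
      using Suc cnorm_triangle[of ?a ?b] Yn[of "Suc n"] Yn[of n] tinc[of n]
      by (intro mult_left_mono mult_mono) (auto intro: cnorm_nonneg)
    also have "\<dots> = t (Suc (Suc n)) - t (Suc n)"
      by (simp only: tS[of "Suc n"] tS[of n]) (simp add: power2_eq_square field_simps)
    finally show ?case .
  qed
  have dist: "cnorm A (Y (n + k) \<ominus> Y n) \<le> t (n + k) - t n" for n k
  proof (induction k)
    case (Suc k)
    then show ?case
      using nrm_minus_triangle[of "Y (Suc (n + k))" "Y (n + k)" "Y n"] step[of "n + k"] by simp
  qed (simp add: minus_self)
  have dist': "cnorm A (Y m \<ominus> Y n) \<le> \<bar>t m - t n\<bar>" for m n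
  proof (cases "n \<le> m")
    case True
    then show ?thesis using dist[of n "m - n"] by simp
  next
    case False
    then show ?thesis using dist[of m "n - m"] nrm_minus_commute[of "Y m" "Y n"] by simp
  qed
  have "\<exists>N. \<forall>m\<ge>N. \<forall>k\<ge>N. cnorm A (Y m \<ominus> Y k) < e" if "0 < e" for e
    using CauchyD[OF tC that] dist' unfolding real_norm_def by (meson order_le_less_trans)
  then obtain y where lim: "nlim Y y"
    using nlim_exists[OF complete, of Y] Yc by blast
  then have y: "y \<in> carrier A" by (rule nlim_closed)
  show thesis
  proof (rule that[OF y])
    show "star A y = y"
      using nlim_unique[OF nlim_star[OF lim]] lim Ystar by simp
    show "cnorm A y \<le> 1"
      using Yn t01 by (intro nlim_nrm_le[OF lim]) (meson order_trans)
    have "nlim (\<lambda>n. Y (Suc n)) ((1/2) \<odot> (x \<oplus> y \<otimes> y))"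
      unfolding YS by (intro nlim_smult nlim_add nlim_const nlim_mult lim x)
    then have "y = (1/2) \<odot> (x \<oplus> y \<otimes> y)"
      using nlim_unique nlim_Suc[OF lim] by blast
    then have "y \<oplus> y = (1/2) \<odot> (x \<oplus> y \<otimes> y) \<oplus> (1/2) \<odot> (x \<oplus> y \<otimes> y)" by simp
    also have "\<dots> = x \<oplus> y \<otimes> y"
      using x y by (simp add: smult_add_left[symmetric])
    finally show "y \<oplus> y = x \<oplus> y \<otimes> y" .
    show "z \<otimes> y = y \<otimes> z" if z: "z \<in> carrier A" "z \<otimes> x = x \<otimes> z" for z
      using nlim_unique[OF nlim_mult[OF nlim_const[OF z(1)] lim]]
        nlim_mult[OF lim nlim_const[OF z(1)]] Ycomm[OF z] by simp
  qed
qed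

end

text \<open>Opens the ideal theory of HOL-Algebra, in terms of which
  \<open>closed_ideal_generated\<close> and \<open>cstar_quot\<close> are defined.\<close>

sublocale unital_cstar_algebra \<subseteq> U: ring A
proof (rule ringI)
  show "abelian_group A" by (rule M.abelian_group_axioms)
  show "Group.monoid A"
    by (rule monoidI) (simp_all add: one_closed mult_assoc mult_one_left mult_one_right)
qed (simp_all add: mult_add_left mult_add_right)

context normed_space
begin

lemma smult_a_inv: "x \<in> carrier V \<Longrightarrow> c \<odot> (\<ominus> x) = \<ominus> (c \<odot> x)"
  by (simp add: smult_r_minus)

lemma add_minus_cancel_left: "\<lbrakk>x \<in> carrier V; y \<in> carrier V\<rbrakk> \<Longrightarrow> y \<oplus> (x \<ominus> y) = x"
  using add_minus_cancel[of x y] M.a_comm[of y "x \<ominus> y"] by simp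

end

section \<open>Norm estimates in unital algebras from real parts of isometries\<close>

context unital_cstar_algebra
begin

declare one_closed [simp]

text \<open>Rewrites polynomials in noncommuting elements to sums of signed monomials associated to
  the right, where opposite summands cancel.\<close>

lemmas cstar_ring_simps = M.minus_eq mult_add_left mult_add_right mult_a_inv_left mult_a_inv_right
  mult_assoc M.a_ac M.minus_add M.minus_minus M.r_neg M.l_neg M.r_neg1 M.r_neg2 mult_one_left
  mult_one_right mult_smult_left mult_smult_right smult_smult smult_add_right smult_a_inv smult_neg

lemma star_one [simp]: "star A \<one> = \<one>"
proof -
  have "star A (star A \<one> \<otimes> \<one>) = star A \<one> \<otimes> star A (star A \<one>)"
    by (simp only: star_mult star_closed one_closed)
  then show ?thesis by simp
qed

text \<open>Only an inequality, because the zero algebra counts as unital.\<close>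

lemma cnorm_one_le: "cnorm A \<one> \<le> 1"
proof (cases "cnorm A \<one> = 0")
  case False
  have "cnorm A \<one> * cnorm A \<one> = cnorm A \<one>"
    using cstar_identity[of \<one>] by (simp add: power2_eq_square)
  then show ?thesis using False by simp
qed simp

text \<open>Under the hypotheses $p + ir$ is an isometry, and $p$ is its real part.\<close>

lemma cnorm_le_1_of_sum_squares:
  assumes p: "p \<in> carrier A" "star A p = p" and r: "r \<in> carrier A" "star A r = r"
    and comm: "p \<otimes> r = r \<otimes> p" and sum: "p \<otimes> p \<oplus> r \<otimes> r = \<one>"
  shows "cnorm A p \<le> 1"
proof -
  define u where "u = p \<oplus> \<i> \<odot> r"
  have u: "u \<in> carrier A" by (simp add: u_def p r)
  have su: "star A u = p \<ominus> \<i> \<odot> r"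
    by (simp add: u_def p r star_add star_smult smult_neg M.minus_eq)
  have "star A u \<otimes> u = p \<otimes> p \<oplus> r \<otimes> r"
    unfolding su unfolding u_def using p r
    by (simp add: cstar_ring_simps comm)
  then have "(cnorm A u)\<^sup>2 \<le> 1"
    using cstar_identity[OF u] cnorm_one_le by (simp add: sum)
  then have "cnorm A u \<le> 1" using power2_le_imp_le[of "cnorm A u" 1] by simp
  moreover have "2 \<odot> p = star A u \<oplus> u"
    unfolding su unfolding u_def using p r smult_add_left[of p 1 1]
    by (simp add: M.minus_eq M.add.m_ac M.r_neg1 M.r_neg)
  then have "2 * cnorm A p \<le> cnorm A (star A u) + cnorm A u"
    using cnorm_triangle[of "star A u" u] u p cnorm_smult[of p 2] by simp
  ultimately show ?thesis by (simp add: cnorm_star u)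
qed

text \<open>Reads the unit-free equation 2y = x + y^2 of \<open>sqrt_exists\<close> as the statement
  that 1 - y is a square root of 1 - x.\<close>

lemma one_minus_square:
  assumes "y \<in> carrier A" "y \<oplus> y = x \<oplus> y \<otimes> y" "x \<in> carrier A"
  shows "(\<one> \<ominus> y) \<otimes> (\<one> \<ominus> y) = \<one> \<ominus> x"
proof -
  have "(\<one> \<ominus> y) \<otimes> (\<one> \<ominus> y) = \<one> \<oplus> (y \<otimes> y \<ominus> (y \<oplus> y))"
    using assms(1) by (simp add: cstar_ring_simps)
  also have "y \<otimes> y \<ominus> (y \<oplus> y) = \<ominus> x"
    unfolding assms(2) using assms(1,3) by (simp add: cstar_ring_simps)
  finally show ?thesis by (simp add: M.minus_eq)
qed

lemma commutes_one_minus: "\<lbrakk>x \<in> carrier A; z \<in> carrier A; z \<otimes> x = x \<otimes> z\<rbrakk>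
    \<Longrightarrow> z \<otimes> (\<one> \<ominus> x) = (\<one> \<ominus> x) \<otimes> z"
  by (simp add: mult_minus_left mult_minus_right mult_one_left mult_one_right)

text \<open>The square root b of 1 - h^2 commutes with h, so b + ih is an isometry with real part b.
  Thus |b| <= 1, and 1 - h^2 = b^2. This replaces the spectral bound.\<close>

lemma cnorm_one_minus_square:
  assumes h: "h \<in> carrier A" "star A h = h" "cnorm A h \<le> 1"
  shows "cnorm A (\<one> \<ominus> h \<otimes> h) \<le> 1"
proof -
  have "cnorm A (h \<otimes> h) \<le> 1" using h cnorm_nonneg[of h] by (simp add: cnorm_square power_le_one)
  moreover have "star A (h \<otimes> h) = h \<otimes> h" using h by (simp add: star_mult)
  ultimately obtain y where y: "y \<in> carrier A" "star A y = y" "y \<oplus> y = h \<otimes> h \<oplus> y \<otimes> y"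
    "\<And>z. \<lbrakk>z \<in> carrier A; z \<otimes> (h \<otimes> h) = h \<otimes> h \<otimes> z\<rbrakk> \<Longrightarrow> z \<otimes> y = y \<otimes> z"
    using sqrt_exists[of "h \<otimes> h"] mult_closed[OF h(1) h(1)] by blast
  define b where "b = \<one> \<ominus> y"
  have b: "b \<in> carrier A" "star A b = b" by (simp_all add: b_def y star_minus)
  have bb: "b \<otimes> b = \<one> \<ominus> h \<otimes> h"
    unfolding b_def using one_minus_square[OF y(1,3)] h by simp
  have "h \<otimes> y = y \<otimes> h" using h y(4)[of h] by (simp add: mult_assoc)
  then have "b \<otimes> h = h \<otimes> b" unfolding b_def using commutes_one_minus y(1) h(1) by simp
  then have "cnorm A b \<le> 1"
    using b h by (intro cnorm_le_1_of_sum_squares[of b h]) (simp_all add: bb add_minus_cancel)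
  then show ?thesis
    using cnorm_square[OF b] cnorm_nonneg[OF b(1)] by (simp add: bb power_le_one)
qed

end

section \<open>Homomorphisms and their automatic contractivity\<close>

lemma star_homD:
  assumes "h \<in> star_hom A B"
  shows "x \<in> carrier A \<Longrightarrow> h x \<in> carrier B"
    and "\<lbrakk>x \<in> carrier A; y \<in> carrier A\<rbrakk> \<Longrightarrow> h (x \<oplus>\<^bsub>A\<^esub> y) = h x \<oplus>\<^bsub>B\<^esub> h y"
    and "x \<in> carrier A \<Longrightarrow> h (c \<odot>\<^bsub>A\<^esub> x) = c \<odot>\<^bsub>B\<^esub> h x"
    and "\<lbrakk>x \<in> carrier A; y \<in> carrier A\<rbrakk> \<Longrightarrow> h (x \<otimes>\<^bsub>A\<^esub> y) = h x \<otimes>\<^bsub>B\<^esub> h y"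
    and "x \<in> carrier A \<Longrightarrow> h (star A x) = star B (h x)"
  using assms by (auto simp: star_hom_def linear_map_def)

lemma star_homI:
  assumes "\<And>x. x \<in> carrier A \<Longrightarrow> h x \<in> carrier B"
    and "\<And>x y. \<lbrakk>x \<in> carrier A; y \<in> carrier A\<rbrakk> \<Longrightarrow> h (x \<oplus>\<^bsub>A\<^esub> y) = h x \<oplus>\<^bsub>B\<^esub> h y"
    and "\<And>c x. x \<in> carrier A \<Longrightarrow> h (c \<odot>\<^bsub>A\<^esub> x) = c \<odot>\<^bsub>B\<^esub> h x"
    and "\<And>x y. \<lbrakk>x \<in> carrier A; y \<in> carrier A\<rbrakk> \<Longrightarrow> h (x \<otimes>\<^bsub>A\<^esub> y) = h x \<otimes>\<^bsub>B\<^esub> h y"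
    and "\<And>x. x \<in> carrier A \<Longrightarrow> h (star A x) = star B (h x)"
  shows "h \<in> star_hom A B"
  using assms by (auto simp: star_hom_def linear_map_def)

lemma star_hom_compose:
  assumes "g \<in> star_hom A B" "h \<in> star_hom B C"
  shows "(\<lambda>x. h (g x)) \<in> star_hom A C"
  by (rule star_homI) (simp_all add: star_homD[OF assms(1)] star_homD[OF assms(2)])

lemma linear_mapD:
  assumes "linear_map V W f"
  shows "x \<in> carrier V \<Longrightarrow> f x \<in> carrier W"
    and "\<lbrakk>x \<in> carrier V; y \<in> carrier V\<rbrakk> \<Longrightarrow> f (x \<oplus>\<^bsub>V\<^esub> y) = f x \<oplus>\<^bsub>W\<^esub> f y"
    and "x \<in> carrier V \<Longrightarrow> f (c \<odot>\<^bsub>V\<^esub> x) = c \<odot>\<^bsub>W\<^esub> f x"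
  using assms by (auto simp: linear_map_def)

lemma linear_map_minus:
  assumes f: "linear_map V W f" and "normed_space V n" "normed_space W n'"
    and x: "x \<in> carrier V" "y \<in> carrier V"
  shows "f (x \<ominus>\<^bsub>V\<^esub> y) = f x \<ominus>\<^bsub>W\<^esub> f y" and "f \<zero>\<^bsub>V\<^esub> = \<zero>\<^bsub>W\<^esub>"
proof -
  interpret V: normed_space V n by fact
  interpret W: normed_space W n' by fact
  show "f (x \<ominus>\<^bsub>V\<^esub> y) = f x \<ominus>\<^bsub>W\<^esub> f y"
    using x by (simp add: V.M.minus_eq W.M.minus_eq V.minus_as_smult W.minus_as_smult linear_mapD[OF f])
  have "f (0 \<odot>\<^bsub>V\<^esub> \<zero>\<^bsub>V\<^esub>) = 0 \<odot>\<^bsub>W\<^esub> f \<zero>\<^bsub>V\<^esub>" by (simp only: linear_mapD[OF f] V.M.zero_closed)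
  then show "f \<zero>\<^bsub>V\<^esub> = \<zero>\<^bsub>W\<^esub>" by (simp add: linear_mapD[OF f])
qed

lemma star_hom_linear: "h \<in> star_hom A B \<Longrightarrow> linear_map A B h"
  by (simp add: star_hom_def)

text \<open>The element y with 2y = x^2 + y^2 exists in C even without a unit and is carried over by
  h. Only in B is b = 1 - h y formed: it commutes with h x and b^2 = 1 - (h x)^2, so h x is the real
  part of the isometry h x + ib.\<close>

lemma star_hom_contractive_self_adjoint:
  assumes C: "cstar_algebra C" and B: "unital_cstar_algebra B" and h: "h \<in> star_hom C B"
    and x: "x \<in> carrier C" "star C x = x" "cnorm C x \<le> 1"
  shows "cnorm B (h x) \<le> 1"
proof -
  interpret C: cstar_algebra C by fact
  interpret B: unital_cstar_algebra B by fact
  note h = star_homD[OF h]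
  have "cnorm C (x \<otimes>\<^bsub>C\<^esub> x) \<le> 1"
    using x C.cnorm_nonneg[of x] by (simp add: C.cnorm_square power_le_one)
  moreover have "star C (x \<otimes>\<^bsub>C\<^esub> x) = x \<otimes>\<^bsub>C\<^esub> x" using x by (simp add: C.star_mult)
  ultimately obtain y where y: "y \<in> carrier C" "star C y = y" "y \<oplus>\<^bsub>C\<^esub> y = x \<otimes>\<^bsub>C\<^esub> x \<oplus>\<^bsub>C\<^esub> y \<otimes>\<^bsub>C\<^esub> y"
    "\<And>z. \<lbrakk>z \<in> carrier C; z \<otimes>\<^bsub>C\<^esub> (x \<otimes>\<^bsub>C\<^esub> x) = x \<otimes>\<^bsub>C\<^esub> x \<otimes>\<^bsub>C\<^esub> z\<rbrakk> \<Longrightarrow> z \<otimes>\<^bsub>C\<^esub> y = y \<otimes>\<^bsub>C\<^esub> z"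
    using C.sqrt_exists[of "x \<otimes>\<^bsub>C\<^esub> x"] C.mult_closed[OF x(1) x(1)] by blast
  have xy: "x \<otimes>\<^bsub>C\<^esub> y = y \<otimes>\<^bsub>C\<^esub> x" using x y(4)[of x] by (simp add: C.mult_assoc)
  define b where "b = \<one>\<^bsub>B\<^esub> \<ominus>\<^bsub>B\<^esub> h y"
  have b: "b \<in> carrier B" "star B b = b"
    using y(1,2) h(5)[of y] by (simp_all add: b_def h B.star_minus)
  have "h (y \<oplus>\<^bsub>C\<^esub> y) = h (x \<otimes>\<^bsub>C\<^esub> x \<oplus>\<^bsub>C\<^esub> y \<otimes>\<^bsub>C\<^esub> y)" by (simp only: y(3))
  then have "h y \<oplus>\<^bsub>B\<^esub> h y = h x \<otimes>\<^bsub>B\<^esub> h x \<oplus>\<^bsub>B\<^esub> h y \<otimes>\<^bsub>B\<^esub> h y"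
    by (simp only: h(2,4) x(1) y(1) C.mult_closed)
  then have bb: "b \<otimes>\<^bsub>B\<^esub> b = \<one>\<^bsub>B\<^esub> \<ominus>\<^bsub>B\<^esub> h x \<otimes>\<^bsub>B\<^esub> h x"
    unfolding b_def
    by (rule B.one_minus_square[OF h(1)[OF y(1)] _ B.mult_closed[OF h(1)[OF x(1)] h(1)[OF x(1)]]])
  have "h (x \<otimes>\<^bsub>C\<^esub> y) = h (y \<otimes>\<^bsub>C\<^esub> x)" by (simp only: xy)
  then have "h x \<otimes>\<^bsub>B\<^esub> h y = h y \<otimes>\<^bsub>B\<^esub> h x" by (simp only: h(4) x(1) y(1))
  then have "h x \<otimes>\<^bsub>B\<^esub> b = b \<otimes>\<^bsub>B\<^esub> h x"
    unfolding b_def by (rule B.commutes_one_minus[OF h(1)[OF y(1)] h(1)[OF x(1)]])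
  then show ?thesis
    using b x h(5)[of x]
    by (intro B.cnorm_le_1_of_sum_squares[of "h x" b])
      (simp_all add: bb h B.add_minus_cancel_left)
qed

text \<open>By the C*-identity on both sides it is enough to treat the self-adjoint element x^* x,
  divided by |x|^2; hence the separate case of norm 0.\<close>

lemma star_hom_contractive:
  assumes C: "cstar_algebra C" and B: "unital_cstar_algebra B" and h: "h \<in> star_hom C B"
    and x: "x \<in> carrier C"
  shows "cnorm B (h x) \<le> cnorm C x"
proof -
  interpret C: cstar_algebra C by fact
  interpret B: unital_cstar_algebra B by fact
  note hD = star_homD[OF h]
  let ?w = "star C x \<otimes>\<^bsub>C\<^esub> x"
  show ?thesis
  proof (cases "cnorm C x = 0")
    case True
    then have "x = \<zero>\<^bsub>C\<^esub>" using x C.cnorm_eq_zero by blast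
    then show ?thesis
      using linear_map_minus(2)[OF star_hom_linear[OF h] C.normed_space_axioms B.normed_space_axioms x x]
      by simp
  next
    case False
    then have p: "0 < cnorm C x" using C.cnorm_nonneg[OF x] by simp
    let ?c = "complex_of_real (inverse ((cnorm C x)\<^sup>2))"
    have "cnorm B (h (?c \<odot>\<^bsub>C\<^esub> ?w)) \<le> 1"
    proof (rule star_hom_contractive_self_adjoint[OF C B h])
      show "star C (?c \<odot>\<^bsub>C\<^esub> ?w) = ?c \<odot>\<^bsub>C\<^esub> ?w" using x by (simp add: C.star_smult C.star_mult)
      show "cnorm C (?c \<odot>\<^bsub>C\<^esub> ?w) \<le> 1"
        using x p by (simp add: C.cnorm_smult C.cstar_identity norm_inverse norm_power)
    qed (use x in simp)
    moreover have "cnorm B (h (?c \<odot>\<^bsub>C\<^esub> ?w)) = inverse ((cnorm C x)\<^sup>2) * (cnorm B (h x))\<^sup>2"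
      using x by (simp add: hD B.cnorm_smult B.cstar_identity norm_inverse norm_power)
    ultimately have "inverse ((cnorm C x)\<^sup>2) * (cnorm B (h x))\<^sup>2 \<le> 1" by linarith
    then have "(cnorm B (h x))\<^sup>2 \<le> (cnorm C x)\<^sup>2"
      using p mult_left_mono[of "inverse ((cnorm C x)\<^sup>2) * (cnorm B (h x))\<^sup>2" 1 "(cnorm C x)\<^sup>2"]
      by (simp only: mult.assoc[symmetric]) simp
    then show ?thesis using p by (rule power2_le_imp_le[OF _ less_imp_le])
  qed
qed

section \<open>Positivity\<close>

text \<open>Squares of self-adjoint elements, unlike the b^* b of \<open>cpositive\<close>: for
  these, square roots and norm criteria are available from \<open>sqrt_exists\<close>. That every
  b^* b is such a square is the hard theorem \<open>pos_star_mult_self\<close>.\<close>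

definition (in cstar_algebra) pos :: "'a \<Rightarrow> bool"
  where "pos x \<longleftrightarrow> (\<exists>s\<in>carrier A. star A s = s \<and> x = s \<otimes> s)"

lemma (in cstar_algebra) pos_square: "\<lbrakk>s \<in> carrier A; star A s = s\<rbrakk> \<Longrightarrow> pos (s \<otimes> s)"
  by (auto simp: pos_def)

lemma (in cstar_algebra) pos_closed: "pos x \<Longrightarrow> x \<in> carrier A"
  and pos_star: "pos x \<Longrightarrow> star A x = x"
  by (auto simp: pos_def star_mult)

lemma (in cstar_algebra) pos_zero: "pos \<zero>"
  using pos_square[of \<zero>] by simp

lemma (in cstar_algebra) pos_scale:
  assumes "pos x" "0 \<le> c"
  shows "pos (complex_of_real c \<odot> x)"
proof -
  obtain s where s: "s \<in> carrier A" "star A s = s" "x = s \<otimes> s" using assms(1) by (auto simp: pos_def)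
  have "complex_of_real c \<odot> x = (complex_of_real (sqrt c) \<odot> s) \<otimes> (complex_of_real (sqrt c) \<odot> s)"
    using s assms(2)
    by (simp add: mult_smult_left mult_smult_right smult_smult of_real_mult[symmetric] del: of_real_mult)
  then show ?thesis
    using s by (simp only:) (intro pos_square, simp_all add: star_smult)
qed

lemma (in cstar_algebra) cnorm_rescale_le_1:
  assumes "x \<in> carrier A" "0 < t" "cnorm A x \<le> t"
  shows "cnorm A (complex_of_real (inverse t) \<odot> x) \<le> 1"
proof -
  have "cnorm A (complex_of_real (inverse t) \<odot> x) = inverse t * cnorm A x"
    using assms by (simp add: cnorm_smult norm_inverse)
  also have "\<dots> \<le> inverse t * t" using assms by (intro mult_left_mono) auto
  finally show ?thesis using assms(2) by simp
qed

context unital_cstar_algebra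
begin

text \<open>Apply \<open>sqrt_exists\<close> to 1 - x and put s = 1 - y. The bound on 1 - s is
  recorded because it makes s positive in turn, by \<open>pos_if_near_one\<close>.\<close>

lemma pos_sqrt_unit_ball:
  assumes "x \<in> carrier A" "star A x = x" "cnorm A (\<one> \<ominus> x) \<le> 1"
  obtains s where "s \<in> carrier A" "star A s = s" "s \<otimes> s = x" "cnorm A (\<one> \<ominus> s) \<le> 1"
    "\<And>z. \<lbrakk>z \<in> carrier A; z \<otimes> x = x \<otimes> z\<rbrakk> \<Longrightarrow> z \<otimes> s = s \<otimes> z"
proof -
  have 1: "\<one> \<ominus> x \<in> carrier A" "star A (\<one> \<ominus> x) = \<one> \<ominus> x" using assms by (simp_all add: star_minus)
  obtain y where y: "y \<in> carrier A" "star A y = y" "cnorm A y \<le> 1" "y \<oplus> y = \<one> \<ominus> x \<oplus> y \<otimes> y"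
    and comm: "\<And>z. \<lbrakk>z \<in> carrier A; z \<otimes> (\<one> \<ominus> x) = (\<one> \<ominus> x) \<otimes> z\<rbrakk> \<Longrightarrow> z \<otimes> y = y \<otimes> z"
    using sqrt_exists[OF 1 assms(3)] by blast
  have one_one: "\<one> \<ominus> (\<one> \<ominus> z) = z" if "z \<in> carrier A" for z
    using that by (simp add: cstar_ring_simps)
  show thesis
  proof (rule that[of "\<one> \<ominus> y"])
    show "(\<one> \<ominus> y) \<otimes> (\<one> \<ominus> y) = x"
      using one_minus_square[OF y(1,4) 1(1)] one_one[OF assms(1)] by simp
    show "z \<otimes> (\<one> \<ominus> y) = (\<one> \<ominus> y) \<otimes> z" if z: "z \<in> carrier A" "z \<otimes> x = x \<otimes> z" for z
      by (rule commutes_one_minus[OF y(1) z(1) comm[OF z(1) commutes_one_minus[OF assms(1) z]]])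
  qed (use y(1-3) in \<open>simp_all add: star_minus one_one\<close>)
qed

lemma cnorm_one_minus_pos: "\<lbrakk>pos x; cnorm A x \<le> 1\<rbrakk> \<Longrightarrow> cnorm A (\<one> \<ominus> x) \<le> 1"
proof -
  assume "pos x" and le: "cnorm A x \<le> 1"
  then obtain s where s: "s \<in> carrier A" "star A s = s" "x = s \<otimes> s" by (auto simp: pos_def)
  have "cnorm A s \<le> 1"
    using le cnorm_square[OF s(1,2)] power2_le_imp_le[of "cnorm A s" 1] s(3) by simp
  then show ?thesis using cnorm_one_minus_square[OF s(1,2)] s(3) by simp
qed

lemma pos_if_near_one: "\<lbrakk>x \<in> carrier A; star A x = x; cnorm A (\<one> \<ominus> x) \<le> 1\<rbrakk> \<Longrightarrow> pos x"
  by (metis pos_sqrt_unit_ball pos_def)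

text \<open>Together with \<open>cnorm_near_pos\<close> this characterises positivity by norms
  alone, so that closure under sums (\<open>pos_add\<close>) becomes a triangle inequality.\<close>

lemma pos_if_near:
  assumes "x \<in> carrier A" "star A x = x" "0 < t" "cnorm A (complex_of_real t \<odot> \<one> \<ominus> x) \<le> t"
  shows "pos x"
proof -
  let ?r = "complex_of_real (inverse t)"
  have "\<one> \<ominus> ?r \<odot> x = ?r \<odot> (complex_of_real t \<odot> \<one> \<ominus> x)"
    using assms(1,3) by (simp add: smult_minus_right smult_smult)
  then have "cnorm A (\<one> \<ominus> ?r \<odot> x) = inverse t * cnorm A (complex_of_real t \<odot> \<one> \<ominus> x)"
    using assms(1,3) by (simp add: cnorm_smult norm_inverse)
  also have "\<dots> \<le> inverse t * t" using assms(3,4) by (intro mult_left_mono) auto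
  finally have "pos (?r \<odot> x)"
    using assms(1,2,3) by (intro pos_if_near_one) (simp_all add: star_smult)
  then have "pos (complex_of_real t \<odot> (?r \<odot> x))"
    using assms(3) by (rule pos_scale[OF _ less_imp_le])
  then show ?thesis using assms(1,3) by (simp add: smult_smult)
qed

lemma cnorm_near_pos:
  assumes "pos x" "0 < t" "cnorm A x \<le> t"
  shows "cnorm A (complex_of_real t \<odot> \<one> \<ominus> x) \<le> t"
proof -
  let ?r = "complex_of_real (inverse t)"
  have x: "x \<in> carrier A" using assms(1) by (rule pos_closed)
  have "cnorm A (?r \<odot> x) \<le> 1"
    using x assms(2,3) by (rule cnorm_rescale_le_1)
  moreover have "pos (?r \<odot> x)" using assms(1,2) by (intro pos_scale) simp_all
  ultimately have "cnorm A (\<one> \<ominus> ?r \<odot> x) \<le> 1" by (rule cnorm_one_minus_pos[rotated])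
  moreover have "complex_of_real t \<odot> \<one> \<ominus> x = complex_of_real t \<odot> (\<one> \<ominus> ?r \<odot> x)"
    using x assms(2) by (simp add: smult_minus_right smult_smult)
  ultimately show ?thesis
    using x assms(2) by (simp add: cnorm_smult)
qed

lemma pos_sqrt:
  assumes "pos x"
  obtains s where "pos s" "s \<otimes> s = x"
    "\<And>z. \<lbrakk>z \<in> carrier A; z \<otimes> x = x \<otimes> z\<rbrakk> \<Longrightarrow> z \<otimes> s = s \<otimes> z"
proof -
  \<comment> \<open>The summand 1 keeps t positive when x is 0.\<close>
  define t where "t = cnorm A x + 1"
  define r where "r = complex_of_real (inverse t)"
  have x: "x \<in> carrier A" "star A x = x" using assms by (auto intro: pos_closed pos_star)
  have t: "0 < t" using cnorm_nonneg[OF x(1)] by (simp add: t_def)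
  have "cnorm A (r \<odot> x) \<le> 1"
    unfolding r_def using x(1) t by (rule cnorm_rescale_le_1) (simp add: t_def)
  moreover have "pos (r \<odot> x)" unfolding r_def using assms t by (intro pos_scale) simp_all
  ultimately have le: "cnorm A (\<one> \<ominus> r \<odot> x) \<le> 1" by (rule cnorm_one_minus_pos[rotated])
  have rx: "r \<odot> x \<in> carrier A" "star A (r \<odot> x) = r \<odot> x" using x by (simp_all add: star_smult r_def)
  obtain s where s: "s \<in> carrier A" "star A s = s" "s \<otimes> s = r \<odot> x" "cnorm A (\<one> \<ominus> s) \<le> 1"
    and comm: "\<And>z. \<lbrakk>z \<in> carrier A; z \<otimes> (r \<odot> x) = (r \<odot> x) \<otimes> z\<rbrakk> \<Longrightarrow> z \<otimes> s = s \<otimes> z"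
    using pos_sqrt_unit_ball[OF rx le] by blast
  let ?q = "complex_of_real (sqrt t)"
  show thesis
  proof (rule that[of "?q \<odot> s"])
    show "pos (?q \<odot> s)" using s t by (intro pos_scale pos_if_near_one) simp_all
    have "(?q \<odot> s) \<otimes> (?q \<odot> s) = (?q * ?q) \<odot> (s \<otimes> s)"
      using s(1) by (simp add: mult_smult_left mult_smult_right smult_smult)
    also have "?q * ?q = complex_of_real t" using t by (simp add: of_real_mult[symmetric] del: of_real_mult)
    also have "\<dots> \<odot> (s \<otimes> s) = x" using x t by (simp add: s(3) smult_smult r_def)
    finally show "(?q \<odot> s) \<otimes> (?q \<odot> s) = x" .
    show "z \<otimes> (?q \<odot> s) = (?q \<odot> s) \<otimes> z" if z: "z \<in> carrier A" "z \<otimes> x = x \<otimes> z" for z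
    proof -
      have "z \<otimes> s = s \<otimes> z" using z x by (intro comm) (simp_all add: mult_smult_left mult_smult_right)
      then show ?thesis using z s(1) by (simp add: mult_smult_left mult_smult_right)
    qed
  qed
qed

lemma pos_add:
  assumes "pos x" "pos y"
  shows "pos (x \<oplus> y)"
proof -
  have x: "x \<in> carrier A" "star A x = x" and y: "y \<in> carrier A" "star A y = y"
    using assms by (auto intro: pos_closed pos_star)
  obtain s t where p: "0 < s" "0 < t" and le: "cnorm A x \<le> s" "cnorm A y \<le> t"
    using cnorm_nonneg[OF x(1)] cnorm_nonneg[OF y(1)] zero_less_one
    by (metis less_add_one less_imp_le order_le_less_trans)
  have "complex_of_real (s + t) \<odot> \<one> \<ominus> (x \<oplus> y) =
      (complex_of_real s \<odot> \<one> \<ominus> x) \<oplus> (complex_of_real t \<odot> \<one> \<ominus> y)"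
    using x(1) y(1) by (simp only: of_real_add smult_add_left one_closed minus_add_distrib smult_closed')
  then have "cnorm A (complex_of_real (s + t) \<odot> \<one> \<ominus> (x \<oplus> y)) \<le> s + t"
    using cnorm_triangle[of "complex_of_real s \<odot> \<one> \<ominus> x" "complex_of_real t \<odot> \<one> \<ominus> y"]
      cnorm_near_pos[OF assms(1) p(1) le(1)] cnorm_near_pos[OF assms(2) p(2) le(2)] x(1) y(1) by simp
  then show ?thesis
    using x y p by (intro pos_if_near[of _ "s + t"]) (simp_all add: star_add)
qed

text \<open>The distance of t - y from t is |y| <= t, so \<open>pos_if_near\<close> applies; t = 0
  forces y = 0.\<close>

lemma pos_norm_minus:
  assumes "y \<in> carrier A" "star A y = y" "cnorm A y \<le> t"
  shows "pos (complex_of_real t \<odot> \<one> \<ominus> y)"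
proof (cases "t = 0")
  case True
  then have "y = \<zero>" using assms cnorm_nonneg[of y] cnorm_eq_zero[of y] by simp
  then show ?thesis using True pos_zero by (simp add: minus_self)
next
  case False
  then have t: "0 < t" using assms cnorm_nonneg[of y] by linarith
  have "complex_of_real t \<odot> \<one> \<ominus> (complex_of_real t \<odot> \<one> \<ominus> y) = y"
    using assms(1) by (simp add: cstar_ring_simps)
  then show ?thesis
    using t assms by (intro pos_if_near[of _ t]) (simp_all add: star_minus star_smult)
qed

text \<open>The square roots p of h and r of 1 - h commute and p^2 + r^2 = 1, so p is the real part
  of the isometry p + ir.\<close>

lemma cnorm_le_1_if_pos:
  assumes h: "pos h" "pos (\<one> \<ominus> h)"
  shows "cnorm A h \<le> 1"
proof -
  have hc: "h \<in> carrier A" using h(1) by (rule pos_closed)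
  obtain p where p: "pos p" "p \<otimes> p = h"
    and pc: "\<And>z. \<lbrakk>z \<in> carrier A; z \<otimes> h = h \<otimes> z\<rbrakk> \<Longrightarrow> z \<otimes> p = p \<otimes> z"
    using pos_sqrt[OF h(1)] by blast
  obtain r where r: "pos r" "r \<otimes> r = \<one> \<ominus> h"
    and rc: "\<And>z. \<lbrakk>z \<in> carrier A; z \<otimes> (\<one> \<ominus> h) = (\<one> \<ominus> h) \<otimes> z\<rbrakk> \<Longrightarrow> z \<otimes> r = r \<otimes> z"
    using pos_sqrt[OF h(2)] by blast
  have pC: "p \<in> carrier A" using p(1) by (rule pos_closed)
  have "h \<otimes> p = p \<otimes> h" using hc by (intro pc) simp_all
  then have "p \<otimes> r = r \<otimes> p" by (intro rc[OF pC] commutes_one_minus[OF hc pC]) simp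
  then have "cnorm A p \<le> 1"
    using p r by (intro cnorm_le_1_of_sum_squares[of p r])
      (auto simp: add_minus_cancel_left hc intro: pos_closed pos_star)
  then show ?thesis
    using cnorm_square[OF pC pos_star[OF p(1)]] cnorm_nonneg[OF pC] by (simp add: p(2) power_le_one)
qed

text \<open>For t = |k| + e the order relations h <= k <= t put h/t between 0 and 1, hence |h| <= t.
  The e keeps t positive even for k = 0.\<close>

lemma pos_cnorm_mono:
  assumes "pos h" "pos (k \<ominus> h)" "k \<in> carrier A"
  shows "cnorm A h \<le> cnorm A k"
proof (rule field_le_epsilon)
  fix e :: real assume e: "0 < e"
  define t where "t = cnorm A k + e"
  have t: "0 < t" "cnorm A k \<le> t" using cnorm_nonneg[OF assms(3)] e by (simp_all add: t_def)
  have h: "h \<in> carrier A" using assms(1) by (rule pos_closed)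
  have "star A ((k \<ominus> h) \<oplus> h) = (k \<ominus> h) \<oplus> h"
    using star_add[of "k \<ominus> h" h] pos_star[OF assms(1)] pos_star[OF assms(2)] h assms(3) by simp
  then have "star A k = k" using h assms(3) by (simp only: add_minus_cancel)
  then have "pos (complex_of_real t \<odot> \<one> \<ominus> k)" using pos_norm_minus assms(3) t by blast
  from pos_add[OF this assms(2)] have "pos (complex_of_real t \<odot> \<one> \<ominus> h)"
    using h assms(3) by (simp add: minus_split[symmetric])
  then have "pos (complex_of_real (inverse t) \<odot> (complex_of_real t \<odot> \<one> \<ominus> h))"
    using t by (intro pos_scale) simp_all
  then have "pos (\<one> \<ominus> complex_of_real (inverse t) \<odot> h)"
    using h t by (simp add: smult_minus_right smult_smult)
  moreover have "pos (complex_of_real (inverse t) \<odot> h)" using assms(1) t by (intro pos_scale) simp_all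
  ultimately have "cnorm A (complex_of_real (inverse t) \<odot> h) \<le> 1" by (rule cnorm_le_1_if_pos[rotated])
  moreover have "cnorm A h = t * cnorm A (complex_of_real (inverse t) \<odot> h)"
    using h t by (simp add: cnorm_smult norm_inverse)
  ultimately have "cnorm A h \<le> t * 1" using t by (simp only: mult_left_mono less_imp_le)
  then show "cnorm A h \<le> cnorm A k + e" by (simp add: t_def)
qed

lemma pos_antisym: "\<lbrakk>pos x; pos (\<ominus> x)\<rbrakk> \<Longrightarrow> x = \<zero>"
  using pos_cnorm_mono[of x \<zero>] pos_closed[of x] cnorm_nonneg[of x] cnorm_eq_zero[of x]
  by (simp add: M.minus_eq)

text \<open>With w = c + k the positive element |w| - w equals (|w| - c) - k, so k <= |w| - c, and
  norms are monotone. A nonzero k excludes the zero algebra, where the unit has norm 0.\<close>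

lemma cnorm_add_pos:
  assumes "pos k" "k \<noteq> \<zero>" "0 < c"
  shows "c + cnorm A k \<le> cnorm A (complex_of_real c \<odot> \<one> \<oplus> k)"
proof -
  have k: "k \<in> carrier A" "star A k = k" using assms(1) by (auto intro: pos_closed pos_star)
  have "cnorm A \<one> \<noteq> 0"
  proof
    assume "cnorm A \<one> = 0"
    then have "\<one> = \<zero>" using cnorm_eq_zero by blast
    then show False using mult_one_left[OF k(1)] k(1) assms(2) by simp
  qed
  moreover have "cnorm A \<one> * cnorm A \<one> = cnorm A \<one>"
    using cstar_identity[of \<one>] by (simp add: power2_eq_square mult_one_left)
  ultimately have one: "cnorm A \<one> = 1" by simp
  let ?w = "complex_of_real c \<odot> \<one> \<oplus> k"
  have w: "?w \<in> carrier A" "star A ?w = ?w" using k by (simp_all add: star_add star_smult)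
  have "pos \<one>" using pos_square[of \<one>] by (simp add: mult_one_left)
  then have pc: "pos (complex_of_real c \<odot> \<one>)" using assms(3) by (intro pos_scale) simp_all
  have "?w \<ominus> complex_of_real c \<odot> \<one> = k" using k(1) by (simp add: cstar_ring_simps)
  then have "cnorm A (complex_of_real c \<odot> \<one>) \<le> cnorm A ?w"
    using pc assms(1) w(1) by (intro pos_cnorm_mono) simp_all
  then have cw: "c \<le> cnorm A ?w" using assms(3) by (simp add: cnorm_smult one)
  have "complex_of_real (cnorm A ?w) \<odot> \<one> \<ominus> ?w = complex_of_real (cnorm A ?w - c) \<odot> \<one> \<ominus> k"
    using k(1) by (simp add: of_real_diff diff_conv_add_uminus smult_add_left cstar_ring_simps
        del: add_uminus_conv_diff)
  then have "cnorm A k \<le> cnorm A (complex_of_real (cnorm A ?w - c) \<odot> \<one>)"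
    using pos_norm_minus[OF w order_refl] assms(1) by (intro pos_cnorm_mono) simp_all
  also have "\<dots> = cnorm A ?w - c" using cw by (simp only: cnorm_smult one_closed one norm_of_real) simp
  finally show ?thesis by simp
qed

end

section \<open>Positivity of b^* b and uniqueness of positive square roots\<close>

context unital_cstar_algebra
begin

text \<open>
  If $c^*c = -k$ with $k \ge 0$ then $cc^* \ge 0$, since $c^*c + cc^*$ is a sum of squares of
  self-adjoint elements. So for $\|c\| \le 1$ the element $c(1+k) = (1 - cc^*)c$ is no longer than $c$,
  while $(1+k)k(1+k)$ is strictly longer than $k$ unless $k = 0$.
\<close>

lemma neg_star_mult_self_aux:
  assumes c: "c \<in> carrier A" "cnorm A c \<le> 1" and k: "pos k" and ck: "star A c \<otimes> c = \<ominus> k"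
  shows "k = \<zero>"
proof (rule ccontr)
  assume nz: "k \<noteq> \<zero>"
  have kc: "k \<in> carrier A" "star A k = k" using k by (auto intro: pos_closed pos_star)
  define \<tau> where "\<tau> = cnorm A k"
  define p where "p = c \<otimes> star A c"
  \<comment> \<open>Up to sign, a and b are twice the real and imaginary parts of c, whence a^2 +
    b^2 = 2(c c^* + c^* c).\<close>
  define a where "a = c \<oplus> star A c"
  define b where "b = \<i> \<odot> (c \<ominus> star A c)"
  have pc: "p \<in> carrier A" using c by (simp add: p_def)
  have a: "a \<in> carrier A" "star A a = a" using c by (simp_all add: a_def star_add M.a_comm)
  have b: "b \<in> carrier A" using c by (simp add: b_def)
  have "star A b = (- \<i>) \<odot> (star A c \<ominus> c)" using c by (simp add: b_def star_smult star_minus)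
  also have "\<dots> = b" using c by (simp add: b_def cstar_ring_simps)
  finally have bs: "star A b = b" .
  have "a \<otimes> a \<oplus> b \<otimes> b = (p \<oplus> star A c \<otimes> c) \<oplus> (p \<oplus> star A c \<otimes> c)"
  proof -
    let ?x = "c \<otimes> c" and ?y = "star A c \<otimes> star A c" and ?q = "p \<oplus> star A c \<otimes> c"
    have "a \<otimes> a = (?x \<oplus> ?y) \<oplus> ?q" using c by (simp add: a_def p_def cstar_ring_simps)
    moreover have "b \<otimes> b = (- 1) \<odot> ((c \<ominus> star A c) \<otimes> (c \<ominus> star A c))"
      using c by (simp add: b_def mult_smult_left mult_smult_right smult_smult)
    moreover have "(c \<ominus> star A c) \<otimes> (c \<ominus> star A c) = (?x \<oplus> ?y) \<ominus> ?q"
      using c by (simp add: p_def cstar_ring_simps)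
    ultimately have "a \<otimes> a \<oplus> b \<otimes> b = ((?x \<oplus> ?y) \<oplus> ?q) \<ominus> ((?x \<oplus> ?y) \<ominus> ?q)"
      using c pc by (simp add: minus_as_smult[symmetric] M.minus_eq[of "(?x \<oplus> ?y) \<oplus> ?q"])
    also have "\<dots> = ((?x \<oplus> ?y) \<ominus> (?x \<oplus> ?y)) \<oplus> (?q \<ominus> \<ominus> ?q)"
      using c pc minus_add_distrib[of "?x \<oplus> ?y" "?x \<oplus> ?y" ?q "\<ominus> ?q"]
      by (simp only: M.minus_eq[of "?x \<oplus> ?y" ?q] mult_closed star_closed M.a_closed M.a_inv_closed)
    also have "?q \<ominus> \<ominus> ?q = ?q \<oplus> ?q" using c pc by (simp add: M.minus_eq)
    finally show ?thesis using c pc by (simp add: minus_self)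
  qed
  then have "a \<otimes> a \<oplus> b \<otimes> b \<oplus> (k \<oplus> k) = p \<oplus> p"
    using kc pc by (simp add: ck cstar_ring_simps)
  moreover have "pos (a \<otimes> a \<oplus> b \<otimes> b \<oplus> (k \<oplus> k))"
    using a b bs k by (intro pos_add pos_square)
  ultimately have "pos (complex_of_real (1/2) \<odot> (p \<oplus> p))"
    using pos_scale[of "p \<oplus> p" "1/2"] by simp
  then have p: "pos p" using pc smult_add_left[of p "1/2" "1/2"] by (simp add: smult_add_right)
  have "cnorm A p \<le> 1"
    using cstar_identity'[OF c(1)] c(2) cnorm_nonneg[OF c(1)] by (simp add: p_def power_le_one)
  then have p1: "cnorm A (\<one> \<ominus> p) \<le> 1" using p by (simp add: cnorm_one_minus_pos)
  define c' where "c' = c \<otimes> (\<one> \<oplus> k)"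
  have c': "c' \<in> carrier A" using c kc by (simp add: c'_def)
  have "c \<otimes> k = \<ominus> (c \<otimes> (star A c \<otimes> c))" using c kc by (simp add: ck mult_a_inv_right)
  then have "c' = (\<one> \<ominus> p) \<otimes> c"
    using c kc by (simp add: c'_def p_def mult_add_right mult_add_left mult_a_inv_left mult_one_left
        mult_one_right mult_assoc M.minus_eq)
  then have "cnorm A c' \<le> cnorm A (\<one> \<ominus> p) * cnorm A c" using cnorm_mult c pc by simp
  also have "\<dots> \<le> 1 * cnorm A c" using p1 cnorm_nonneg[OF c(1)] by (rule mult_right_mono)
  finally have c'le: "(cnorm A c')\<^sup>2 \<le> (cnorm A c)\<^sup>2" using cnorm_nonneg[OF c'] by (simp add: power_mono)
  have cn: "(cnorm A c)\<^sup>2 = \<tau>" using cstar_identity[OF c(1)] kc by (simp add: ck nrm_a_inv \<tau>_def)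
  define k' where "k' = (\<one> \<oplus> k) \<otimes> k \<otimes> (\<one> \<oplus> k)"
  have k'c: "k' \<in> carrier A" using kc by (simp add: k'_def)
  have "star A c' \<otimes> c' = (\<one> \<oplus> k) \<otimes> (star A c \<otimes> c) \<otimes> (\<one> \<oplus> k)"
    using c kc by (simp add: c'_def star_mult star_add mult_assoc)
  also have "\<dots> = \<ominus> k'" using kc by (simp add: ck k'_def mult_a_inv_left mult_a_inv_right)
  finally have k'le: "cnorm A k' \<le> \<tau>"
    using cstar_identity[OF c'] c'le cn k'c by (simp add: nrm_a_inv)
  \<comment> \<open>k' expands to k + 2k^2 + k^3, and k^3 is the square of the self-adjoint element
    sk. Monotonicity of the norm leaves |k + 2k^2| <= \<tau>.\<close>
  obtain s where s: "s \<in> carrier A" "star A s = s" "k = s \<otimes> s" using k by (auto simp: pos_def)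
  let ?m = "k \<oplus> (k \<otimes> k \<oplus> k \<otimes> k)"
  have "k' = (s \<otimes> k) \<otimes> (s \<otimes> k) \<oplus> ?m"
    using s by (simp add: k'_def cstar_ring_simps)
  then have "k' \<ominus> ?m = (s \<otimes> k) \<otimes> (s \<otimes> k)"
    using s(1) kc by (simp add: M.minus_eq M.a_assoc M.r_neg)
  moreover have "star A (s \<otimes> k) = s \<otimes> k" using s by (simp add: star_mult mult_assoc)
  ultimately have "pos (k' \<ominus> ?m)" using s(1) kc pos_square[of "s \<otimes> k"] by simp
  moreover have "pos ?m" using k kc by (intro pos_add pos_square)
  ultimately have m: "cnorm A ?m \<le> \<tau>" using pos_cnorm_mono[of ?m k'] k'c k'le by simp
  \<comment> \<open>Completing the square: 2(1/4 + k)^2 = 1/8 + k + 2k^2. As |1/4 + k| >= 1/4 +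
    \<tau> by \<open>cnorm_add_pos\<close>, this gives 1/8 + \<tau> + 2 \<tau>^2 <= 1/8 +
    \<tau>.\<close>
  let ?w = "complex_of_real (1/4) \<odot> \<one> \<oplus> k"
  have w: "?w \<in> carrier A" "star A ?w = ?w" using kc by (simp_all add: star_add star_smult)
  have half: "(1/4) \<odot> k \<oplus> (1/4) \<odot> k = (1/2) \<odot> k" using kc smult_add_left[of k "1/4" "1/4"] by simp
  have "?w \<otimes> ?w = (1/16) \<odot> \<one> \<oplus> (((1/4) \<odot> k \<oplus> (1/4) \<odot> k) \<oplus> k \<otimes> k)"
    using kc by (simp add: cstar_ring_simps)
  then have "2 \<odot> (?w \<otimes> ?w) = (1/8) \<odot> \<one> \<oplus> ?m"
    using kc smult_add_left[of "k \<otimes> k" 1 1] by (simp add: half smult_add_right smult_smult)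
  then have "2 * cnorm A (?w \<otimes> ?w) \<le> cnorm A ((1/8) \<odot> \<one>) + cnorm A ?m"
    using cnorm_triangle[of "(1/8) \<odot> \<one>" ?m] cnorm_smult[of "?w \<otimes> ?w" 2] w kc by simp
  also have "\<dots> \<le> 1/8 + \<tau>" using m cnorm_one_le by (simp add: cnorm_smult)
  finally have "2 * (cnorm A ?w)\<^sup>2 \<le> 1/8 + \<tau>" using cnorm_square[OF w] by simp
  moreover have "(1/4 + \<tau>)\<^sup>2 \<le> (cnorm A ?w)\<^sup>2"
    unfolding \<tau>_def using cnorm_nonneg[OF kc(1)] by (intro power_mono cnorm_add_pos[OF k nz]) auto
  ultimately have "\<tau>\<^sup>2 \<le> 0" by (simp add: power2_eq_square algebra_simps)
  then show False using nz cnorm_eq_zero[OF kc(1)] by (simp add: \<tau>_def)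
qed

lemma neg_star_mult_self:
  assumes c: "c \<in> carrier A" and k: "pos k" and ck: "star A c \<otimes> c = \<ominus> k"
  shows "c = \<zero>"
proof -
  define t where "t = cnorm A c + 1"
  have t: "0 < t" "cnorm A c \<le> t" using cnorm_nonneg[OF c] by (simp_all add: t_def)
  let ?r = "complex_of_real (inverse t)"
  have kc: "k \<in> carrier A" using k by (rule pos_closed)
  have "pos (complex_of_real (inverse t * inverse t) \<odot> k)" using t by (intro pos_scale[OF k]) simp
  moreover have "star A (?r \<odot> c) \<otimes> (?r \<odot> c) = \<ominus> (complex_of_real (inverse t * inverse t) \<odot> k)"
    using c kc by (simp add: star_smult mult_smult_left mult_smult_right smult_smult ck smult_a_inv)
  ultimately have "complex_of_real (inverse t * inverse t) \<odot> k = \<zero>"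
    using cnorm_rescale_le_1[OF c t] c by (intro neg_star_mult_self_aux[of "?r \<odot> c"]) simp_all
  then have "cnorm A (complex_of_real (inverse t * inverse t) \<odot> k) = 0" by simp
  then have "cnorm A k = 0" using t kc by (simp only: cnorm_smult) simp
  then have "k = \<zero>" using kc cnorm_eq_zero by blast
  then have "star A c \<otimes> c = \<zero>" using ck minus_as_smult[of \<zero>] by simp
  then show ?thesis using c by (rule star_mult_self_eq_zero[rotated])
qed

text \<open>
  With $h = b^*b$, $a = |h|$ and $e = a^{1/2}$ the element $c = b(a - h)$ has $c^*c = -(e(a-h))^2$.
\<close>

lemma pos_star_mult_self:
  assumes b: "b \<in> carrier A"
  shows "pos (star A b \<otimes> b)"
proof -
  define h where "h = star A b \<otimes> b"
  have h: "h \<in> carrier A" "star A h = h" using b by (simp_all add: h_def star_mult)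
  obtain a where a: "pos a" "a \<otimes> a = h \<otimes> h"
    and ac: "\<And>z. \<lbrakk>z \<in> carrier A; z \<otimes> (h \<otimes> h) = h \<otimes> h \<otimes> z\<rbrakk> \<Longrightarrow> z \<otimes> a = a \<otimes> z"
    using pos_sqrt[OF pos_square[OF h]] by blast
  have aC: "a \<in> carrier A" "star A a = a" using a(1) by (auto intro: pos_closed pos_star)
  have ha: "h \<otimes> a = a \<otimes> h" using h by (intro ac) (simp_all add: mult_assoc)
  obtain e where e: "pos e" "e \<otimes> e = a"
    and ec: "\<And>z. \<lbrakk>z \<in> carrier A; z \<otimes> a = a \<otimes> z\<rbrakk> \<Longrightarrow> z \<otimes> e = e \<otimes> z"
    using pos_sqrt[OF a(1)] by blast
  have eC: "e \<in> carrier A" "star A e = e" using e(1) by (auto intro: pos_closed pos_star)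
  have he: "h \<otimes> e = e \<otimes> h" using h(1) ha by (rule ec)
  have hez: "h \<otimes> (e \<otimes> z) = e \<otimes> (h \<otimes> z)" if "z \<in> carrier A" for z
    using that h(1) eC(1) he by (metis mult_assoc)
  have hh: "h \<otimes> h = e \<otimes> (e \<otimes> (e \<otimes> e))"
    using a(2) e(2) eC(1) by (metis mult_assoc mult_closed)
  have hhz: "h \<otimes> (h \<otimes> z) = e \<otimes> (e \<otimes> (e \<otimes> (e \<otimes> z)))" if "z \<in> carrier A" for z
  proof -
    have "h \<otimes> (h \<otimes> z) = e \<otimes> (e \<otimes> (e \<otimes> e)) \<otimes> z" using that h(1) hh by (metis mult_assoc)
    then show ?thesis using that eC(1) by (simp add: mult_assoc)
  qed
  define d where "d = a \<ominus> h"
  have d: "d \<in> carrier A" "star A d = d" using aC h by (simp_all add: d_def star_minus)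
  define f where "f = e \<otimes> d"
  have dee: "d = e \<otimes> e \<ominus> h" by (simp add: d_def e(2))
  have "d \<otimes> e = e \<otimes> d" using eC h(1) he by (simp add: dee mult_minus_left mult_minus_right mult_assoc)
  then have f: "f \<in> carrier A" "star A f = f" using d eC by (simp_all add: f_def star_mult)
  have "d \<otimes> h \<otimes> d = \<ominus> (f \<otimes> f)"
    unfolding f_def dee using eC(1) h(1) by (simp add: cstar_ring_simps he hez hh hhz)
  then have "star A (b \<otimes> d) \<otimes> (b \<otimes> d) = \<ominus> (f \<otimes> f)"
    using b d by (simp add: star_mult mult_assoc h_def)
  then have "b \<otimes> d = \<zero>" using b d f by (intro neg_star_mult_self[OF _ pos_square[OF f]]) simp_all
  then have "\<ominus> (f \<otimes> f) = \<zero>" using \<open>star A (b \<otimes> d) \<otimes> (b \<otimes> d) = \<ominus> (f \<otimes> f)\<close> by simp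
  then have "cnorm A (f \<otimes> f) = 0" using nrm_a_inv[of "f \<otimes> f"] f by simp
  then have "f = \<zero>" using cnorm_square[OF f] cnorm_eq_zero[OF f(1)] by simp
  then have "e \<otimes> f = \<zero>" using eC by simp
  then have ad: "a \<otimes> d = \<zero>" using eC d(1) e(2) by (simp add: f_def mult_assoc[symmetric])
  \<comment> \<open>Since h^2 = a^2 and a, h commute, (a - h)^2 = 2a(a - h), and the right side has
    just been seen to vanish.\<close>
  have "d \<otimes> d = a \<otimes> d \<oplus> a \<otimes> d"
    unfolding dee e(2)[symmetric] using eC(1) h(1) by (simp add: cstar_ring_simps he hez hh hhz)
  then have "d \<otimes> d = \<zero>" by (simp add: ad)
  then have "d = \<zero>" using d star_mult_self_eq_zero[of d] by simp
  then have "a = h" using aC h by (simp add: d_def minus_eq_zero_iff)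
  then show ?thesis using a(1) by (simp add: h_def)
qed

lemma cpositive_imp_pos: "cpositive A x \<Longrightarrow> pos x"
  by (auto simp: cpositive_def pos_star_mult_self)

lemma pos_conjugate:
  assumes "pos h" "c \<in> carrier A"
  shows "pos (star A c \<otimes> h \<otimes> c)"
proof -
  obtain s where s: "s \<in> carrier A" "star A s = s" "h = s \<otimes> s" using assms(1) by (auto simp: pos_def)
  have "star A c \<otimes> h \<otimes> c = star A (s \<otimes> c) \<otimes> (s \<otimes> c)"
    using s assms(2) by (simp add: star_mult mult_assoc)
  then show ?thesis using pos_star_mult_self[of "s \<otimes> c"] s assms(2) by simp
qed

text \<open>As s and t commute, (s + t)(s - t) = 0. For d = s - t the positive elements dsd and dtd
  therefore have sum 0, so both vanish; so does their difference d^3, and then d, because it is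
  self-adjoint.\<close>

lemma pos_sqrt_unique:
  assumes s: "pos s" and t: "pos t" and st: "s \<otimes> t = t \<otimes> s" and sq: "s \<otimes> s = t \<otimes> t"
  shows "s = t"
proof -
  have sC: "s \<in> carrier A" "star A s = s" and tC: "t \<in> carrier A" "star A t = t"
    using s t by (auto intro: pos_closed pos_star)
  define d where "d = s \<ominus> t"
  have d: "d \<in> carrier A" "star A d = d" using sC tC by (simp_all add: d_def star_minus)
  have sd: "star A d \<otimes> s \<otimes> d = d \<otimes> s \<otimes> d" "star A d \<otimes> t \<otimes> d = d \<otimes> t \<otimes> d" by (simp_all add: d)
  have "d \<otimes> s \<otimes> d \<oplus> d \<otimes> t \<otimes> d = d \<otimes> ((s \<oplus> t) \<otimes> d)"
    using sC(1) tC(1) d(1) by (simp add: mult_assoc mult_add_left mult_add_right)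
  also have "(s \<oplus> t) \<otimes> d = (t \<otimes> s \<ominus> t \<otimes> s) \<oplus> (s \<otimes> s \<ominus> t \<otimes> t)"
    unfolding d_def using sC(1) tC(1) by (simp add: cstar_ring_simps st sq)
  also have "\<dots> = \<zero>" using sC(1) tC(1) by (simp add: sq minus_self)
  finally have sum: "d \<otimes> s \<otimes> d \<oplus> d \<otimes> t \<otimes> d = \<zero>" using d by simp
  have ps: "pos (d \<otimes> s \<otimes> d)" "pos (d \<otimes> t \<otimes> d)"
    using pos_conjugate[OF s d(1)] pos_conjugate[OF t d(1)] by (simp_all add: sd)
  have "d \<otimes> t \<otimes> d = \<ominus> (d \<otimes> s \<otimes> d)"
    using M.minus_equality[of "d \<otimes> t \<otimes> d" "d \<otimes> s \<otimes> d"] sum sC(1) tC(1) d(1) by (simp add: M.a_comm)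
  then have z: "d \<otimes> s \<otimes> d = \<zero>" "d \<otimes> t \<otimes> d = \<zero>"
    using ps pos_antisym[of "d \<otimes> s \<otimes> d"] minus_as_smult[of \<zero>] by simp_all
  have "d \<otimes> d \<otimes> d = d \<otimes> s \<otimes> d \<ominus> d \<otimes> t \<otimes> d"
    by (subst (2) d_def) (use sC(1) tC(1) d(1) in \<open>simp add: mult_minus_left mult_minus_right\<close>)
  then have "(d \<otimes> d) \<otimes> (d \<otimes> d) = \<zero>" using d(1) by (simp add: z minus_self mult_assoc[symmetric])
  then have "d \<otimes> d = \<zero>" using star_mult_self_eq_zero[of "d \<otimes> d"] d by (simp add: star_mult)
  then have "d = \<zero>" using star_mult_self_eq_zero[of d] d by simp
  then show ?thesis using sC(1) tC(1) by (simp add: d_def minus_eq_zero_iff)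
qed

end

text \<open>
  With $h = a^*a$, $r = \|\pi(h)\|$ and $x = h - r$ the element $-\pi(x)$ is positive, hence equal to
  $\pi(|x|)$; injectivity gives $|x| = -x$, so $h \le r$.
\<close>

lemma star_hom_isometric:
  assumes A: "unital_cstar_algebra A" and B: "unital_cstar_algebra B" and h: "\<pi> \<in> star_hom A B"
    and one: "\<pi> \<one>\<^bsub>A\<^esub> = \<one>\<^bsub>B\<^esub>" and inj: "inj_on \<pi> (carrier A)" and a: "a \<in> carrier A"
  shows "cnorm B (\<pi> a) = cnorm A a"
proof -
  interpret A: unital_cstar_algebra A by fact
  interpret B: unital_cstar_algebra B by fact
  note hD = star_homD[OF h]
  define h where "h = star A a \<otimes>\<^bsub>A\<^esub> a"
  have hC: "h \<in> carrier A" "star A h = h" using a by (simp_all add: h_def A.star_mult)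
  define r where "r = cnorm B (\<pi> h)"
  let ?r = "complex_of_real r \<odot>\<^bsub>A\<^esub> \<one>\<^bsub>A\<^esub>"
  \<comment> \<open>The sign is opposite to the one in the explanation above: x is r - h, so \<pi> x
    itself is positive and the goal is |x| = x.\<close>
  define x where "x = ?r \<ominus>\<^bsub>A\<^esub> h"
  have x: "x \<in> carrier A" "star A x = x" using hC by (simp_all add: x_def A.star_minus A.star_smult)
  have "\<pi> x = complex_of_real r \<odot>\<^bsub>B\<^esub> \<one>\<^bsub>B\<^esub> \<ominus>\<^bsub>B\<^esub> \<pi> h"
    using linear_map_minus(1)[OF star_hom_linear[OF h] A.normed_space_axioms B.normed_space_axioms] hC
    by (simp add: x_def hD one)
  then have px: "B.pos (\<pi> x)"
    using B.pos_norm_minus[of "\<pi> h" r] hD(1)[OF hC(1)] hD(5)[OF hC(1)] hC(2) by (simp add: r_def)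
  obtain w where w: "A.pos w" "w \<otimes>\<^bsub>A\<^esub> w = x \<otimes>\<^bsub>A\<^esub> x"
    and wc: "\<And>z. \<lbrakk>z \<in> carrier A; z \<otimes>\<^bsub>A\<^esub> (x \<otimes>\<^bsub>A\<^esub> x) = x \<otimes>\<^bsub>A\<^esub> x \<otimes>\<^bsub>A\<^esub> z\<rbrakk> \<Longrightarrow> z \<otimes>\<^bsub>A\<^esub> w = w \<otimes>\<^bsub>A\<^esub> z"
    using A.pos_sqrt[OF A.pos_square[OF x]] by blast
  have wC: "w \<in> carrier A" using w(1) by (rule A.pos_closed)
  have xw: "x \<otimes>\<^bsub>A\<^esub> w = w \<otimes>\<^bsub>A\<^esub> x" using x by (intro wc) (simp_all add: A.mult_assoc)
  obtain s where s: "s \<in> carrier A" "star A s = s" "w = s \<otimes>\<^bsub>A\<^esub> s" using w(1) by (auto simp: A.pos_def)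
  have pw: "B.pos (\<pi> w)"
    unfolding s(3) hD(4)[OF s(1) s(1)] using s hD(1)[OF s(1)] hD(5)[OF s(1)] by (intro B.pos_square) simp_all
  have "\<pi> w = \<pi> x"
  proof (rule B.pos_sqrt_unique[OF pw px])
    show "\<pi> w \<otimes>\<^bsub>B\<^esub> \<pi> x = \<pi> x \<otimes>\<^bsub>B\<^esub> \<pi> w" using hD(4)[OF wC x(1)] hD(4)[OF x(1) wC] xw by simp
    show "\<pi> w \<otimes>\<^bsub>B\<^esub> \<pi> w = \<pi> x \<otimes>\<^bsub>B\<^esub> \<pi> x" using hD(4)[OF wC wC] hD(4)[OF x(1) x(1)] w(2) by simp
  qed
  then have "w = x" using inj wC x(1) by (simp add: inj_on_eq_iff)
  then have "A.pos (?r \<ominus>\<^bsub>A\<^esub> h)" using w(1) by (simp add: x_def)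
  moreover have "A.pos h" unfolding h_def using a by (rule A.pos_star_mult_self)
  ultimately have "cnorm A h \<le> cnorm A ?r" by (intro A.pos_cnorm_mono) simp_all
  also have "\<dots> \<le> r"
  proof -
    have "0 \<le> r" unfolding r_def using hC hD by (intro B.cnorm_nonneg) simp
    then show ?thesis using A.cnorm_one_le by (simp add: A.cnorm_smult mult_left_le)
  qed
  also have "r = (cnorm B (\<pi> a))\<^sup>2" using a by (simp add: r_def h_def hD B.cstar_identity)
  finally have "(cnorm A a)\<^sup>2 \<le> (cnorm B (\<pi> a))\<^sup>2" using a by (simp add: h_def A.cstar_identity)
  then have "cnorm A a \<le> cnorm B (\<pi> a)"
    by (rule power2_le_imp_le) (use a hD in \<open>simp add: B.cnorm_nonneg\<close>)
  moreover have "cnorm B (\<pi> a) \<le> cnorm A a"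
    by (rule star_hom_contractive[OF A.cstar_algebra_axioms B h a])
  ultimately show ?thesis by simp
qed

section \<open>Closed spans\<close>

text \<open>The inner intersection of \<open>closed_span\<close>, isolated so that members of a
  closed span become limits of members of the linear span.\<close>

definition lin_span :: "(complex, 'v, 'z) module_scheme \<Rightarrow> 'v set \<Rightarrow> 'v set"
  where "lin_span V G = \<Inter>{W. submodule W complex_field V \<and> G \<subseteq> W}"

context Module.module
begin

lemma submoduleD:
  assumes "submodule W R M"
  shows "W \<subseteq> carrier M" "\<zero>\<^bsub>M\<^esub> \<in> W" "\<lbrakk>x \<in> W; y \<in> W\<rbrakk> \<Longrightarrow> x \<oplus>\<^bsub>M\<^esub> y \<in> W"
    "\<lbrakk>c \<in> carrier R; x \<in> W\<rbrakk> \<Longrightarrow> c \<odot>\<^bsub>M\<^esub> x \<in> W" "\<lbrakk>x \<in> W; y \<in> W\<rbrakk> \<Longrightarrow> x \<ominus>\<^bsub>M\<^esub> y \<in> W"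
proof -
  note E = submoduleE[OF assms]
  show "W \<subseteq> carrier M" "\<lbrakk>x \<in> W; y \<in> W\<rbrakk> \<Longrightarrow> x \<oplus>\<^bsub>M\<^esub> y \<in> W" "\<lbrakk>c \<in> carrier R; x \<in> W\<rbrakk> \<Longrightarrow> c \<odot>\<^bsub>M\<^esub> x \<in> W"
    using E by auto
  show "\<lbrakk>x \<in> W; y \<in> W\<rbrakk> \<Longrightarrow> x \<ominus>\<^bsub>M\<^esub> y \<in> W"
    using E by (simp add: M.minus_eq)
  obtain x where x: "x \<in> W" using E(2) by auto
  then have "x \<oplus>\<^bsub>M\<^esub> \<ominus>\<^bsub>M\<^esub> x \<in> W" using E by simp
  then show "\<zero>\<^bsub>M\<^esub> \<in> W" using x E(1) by (auto simp: M.r_neg)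
qed

lemma submodule_Inter:
  assumes "F \<noteq> {}" "\<And>W. W \<in> F \<Longrightarrow> submodule W R M"
  shows "submodule (\<Inter>F) R M"
proof (rule submoduleI)
  note D = submoduleD[OF assms(2)] and E = submoduleE[OF assms(2)]
  show "\<Inter>F \<subseteq> carrier M" using assms D(1) by blast
  show "\<zero>\<^bsub>M\<^esub> \<in> \<Inter>F" using D(2) by blast
  show "\<ominus>\<^bsub>M\<^esub> a \<in> \<Inter>F" if "a \<in> \<Inter>F" for a using that E(3) by blast
  show "a \<oplus>\<^bsub>M\<^esub> b \<in> \<Inter>F" if "a \<in> \<Inter>F" "b \<in> \<Inter>F" for a b using that D(3) by blast
  show "c \<odot>\<^bsub>M\<^esub> b \<in> \<Inter>F" if "c \<in> carrier R" "b \<in> \<Inter>F" for c b using that D(4) by blast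
qed

end

context normed_space
begin

lemma submoduleI':
  assumes "W \<subseteq> carrier V" "\<zero> \<in> W" "\<And>x y. \<lbrakk>x \<in> W; y \<in> W\<rbrakk> \<Longrightarrow> x \<oplus> y \<in> W" "\<And>c x. x \<in> W \<Longrightarrow> c \<odot> x \<in> W"
  shows "submodule W complex_field V"
proof (rule submoduleI)
  show "\<ominus> a \<in> W" if "a \<in> W" for a
    using that assms(4)[OF that, of "-1"] assms(1) by (auto simp: minus_as_smult)
qed (use assms in auto)

lemma lin_span_submodule: "G \<subseteq> carrier V \<Longrightarrow> submodule (lin_span V G) complex_field V"
  unfolding lin_span_def using carrier_is_submodule by (intro submodule_Inter) auto

lemma lin_span_superset: "G \<subseteq> lin_span V G"
  by (auto simp: lin_span_def)

lemma lin_span_least: "\<lbrakk>submodule W complex_field V; G \<subseteq> W\<rbrakk> \<Longrightarrow> lin_span V G \<subseteq> W"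
  by (auto simp: lin_span_def)

lemma closure_submodule:
  assumes "submodule W complex_field V"
  shows "submodule (Abstract_Topology.closure_of (norm_topology V nrm) W) complex_field V"
    and "closedin (norm_topology V nrm) (Abstract_Topology.closure_of (norm_topology V nrm) W)"
proof -
  note D = submoduleD[OF assms]
  let ?C = "Abstract_Topology.closure_of (norm_topology V nrm) W"
  have iff: "x \<in> ?C \<longleftrightarrow> (\<exists>f. nlim f x \<and> (\<forall>k. f k \<in> W))" for x
  proof
    assume "x \<in> ?C"
    then have x: "x \<in> carrier V" and e: "\<And>e. 0 < e \<Longrightarrow> \<exists>y\<in>W. nrm (x \<ominus> y) < e"
      unfolding in_closure_iff[OF D(1)] by auto
    show "\<exists>f. nlim f x \<and> (\<forall>k. f k \<in> W)" by (rule approx_nlim[OF x D(1) e]) auto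
  next
    assume "\<exists>f. nlim f x \<and> (\<forall>k. f k \<in> W)"
    moreover have "W \<subseteq> ?C"
      using D(1) by (intro closure_of_subset) (simp add: norm_topology_def
          Metric_space.topspace_mtopology[OF metric_space])
    ultimately show "x \<in> ?C" using nlim_in_closed[of _ x ?C] by auto
  qed
  show "submodule ?C complex_field V"
  proof (rule submoduleI')
    show "?C \<subseteq> carrier V" using iff nlim_closed(2) by blast
    show "\<zero> \<in> ?C" unfolding iff using nlim_const[OF M.zero_closed] D(2) by blast
    show "x \<oplus> y \<in> ?C" if xy: "x \<in> ?C" "y \<in> ?C" for x y
    proof -
      obtain f g where "nlim f x" "\<And>k. f k \<in> W" "nlim g y" "\<And>k. g k \<in> W"
        using xy unfolding iff by blast
      then show ?thesis unfolding iff by (intro exI[of _ "\<lambda>k. f k \<oplus> g k"]) (simp add: nlim_add D(3))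
    qed
    show "c \<odot> x \<in> ?C" if x: "x \<in> ?C" for x c
    proof -
      obtain f where "nlim f x" "\<And>k. f k \<in> W" using x unfolding iff by blast
      then show ?thesis unfolding iff by (intro exI[of _ "\<lambda>k. c \<odot> f k"]) (simp add: nlim_smult D(4))
    qed
  qed
  show "closedin (norm_topology V nrm) ?C" by simp
qed

end

lemma closed_span_lin_span:
  "closed_span A G = Abstract_Topology.closure_of (cstar_topology A) (lin_span A G)"
  by (simp add: closed_span_def lin_span_def)

text \<open>The hypothesis is that of a normed space, so that the facts apply both to the Toeplitz
  algebra and to \<open>adjointables\<close>, where \<open>compacts\<close> lives.\<close>

lemma closed_span_facts:
  assumes "normed_space A (cnorm A)" and G: "G \<subseteq> carrier A"
  shows "submodule (closed_span A G) complex_field A" "closedin (cstar_topology A) (closed_span A G)"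
    "lin_span A G \<subseteq> closed_span A G" "G \<subseteq> closed_span A G"
    and "x \<in> closed_span A G \<Longrightarrow> \<exists>f. normed_space.nlim A (cnorm A) f x \<and> (\<forall>k. f k \<in> lin_span A G)"
    and "\<lbrakk>submodule W complex_field A; closedin (cstar_topology A) W; G \<subseteq> W\<rbrakk> \<Longrightarrow> closed_span A G \<subseteq> W"
proof -
  interpret normed_space A "cnorm A" by fact
  note S = lin_span_submodule[OF G]
  show "submodule (closed_span A G) complex_field A" "closedin (cstar_topology A) (closed_span A G)"
    unfolding closed_span_lin_span by (rule closure_submodule[OF S])+
  show sub: "lin_span A G \<subseteq> closed_span A G"
    unfolding closed_span_lin_span using submoduleD(1)[OF S]
    by (intro closure_of_subset) (simp add: norm_topology_def Metric_space.topspace_mtopology[OF metric_space])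
  then show "G \<subseteq> closed_span A G" using lin_span_superset by blast
  show "\<exists>f. nlim f x \<and> (\<forall>k. f k \<in> lin_span A G)" if "x \<in> closed_span A G"
  proof -
    have x: "x \<in> carrier A" and e: "\<And>e. 0 < e \<Longrightarrow> \<exists>y\<in>lin_span A G. cnorm A (x \<ominus>\<^bsub>A\<^esub> y) < e"
      using that unfolding closed_span_lin_span in_closure_iff[OF submoduleD(1)[OF S]] by auto
    show ?thesis by (rule approx_nlim[OF x submoduleD(1)[OF S] e]) auto
  qed
  show "closed_span A G \<subseteq> W"
    if "submodule W complex_field A" "closedin (cstar_topology A) W" "G \<subseteq> W"
    unfolding closed_span_lin_span using closure_of_minimal[OF lin_span_least[OF that(1,3)] that(2)] .
qed

section \<open>Hilbert modules over unital C*-algebras\<close>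

locale unital_hilbert_module = A: unital_cstar_algebra A + hilbert_module A X
  for A :: "'a cstar" and X :: "('a, 'm) hilbert_mod"
begin

declare raction_closed [simp] ip_closed [simp]

abbreviation hn :: "'m \<Rightarrow> real" where "hn \<equiv> hnorm A X"

lemma a_inv_eq_smult: "x \<in> carrier X \<Longrightarrow> \<ominus>\<^bsub>X\<^esub> x = (- 1) \<odot>\<^bsub>X\<^esub> x"
  using X.smult_l_minus[of 1 x] X.smult_one[of x] by simp

lemma ip_add_left: "\<lbrakk>x \<in> carrier X; y \<in> carrier X; z \<in> carrier X\<rbrakk>
    \<Longrightarrow> ip X (x \<oplus>\<^bsub>X\<^esub> y) z = ip X x z \<oplus>\<^bsub>A\<^esub> ip X y z"
  using ip_star[of z "x \<oplus>\<^bsub>X\<^esub> y"] ip_star[of z x] ip_star[of z y]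
  by (simp add: ip_add_right A.star_add)

lemma ip_smult_left: "\<lbrakk>x \<in> carrier X; y \<in> carrier X\<rbrakk> \<Longrightarrow> ip X (c \<odot>\<^bsub>X\<^esub> x) y = cnj c \<odot>\<^bsub>A\<^esub> ip X x y"
  using ip_star[of y "c \<odot>\<^bsub>X\<^esub> x"] ip_star[of y x] by (simp add: ip_smult_right A.star_smult)

lemma ip_raction_left: "\<lbrakk>x \<in> carrier X; y \<in> carrier X; a \<in> carrier A\<rbrakk>
    \<Longrightarrow> ip X (raction X x a) y = star A a \<otimes>\<^bsub>A\<^esub> ip X x y"
  using ip_star[of y "raction X x a"] ip_star[of y x] by (simp add: ip_raction_right A.star_mult)

lemma ip_minus_right: "\<lbrakk>x \<in> carrier X; y \<in> carrier X; z \<in> carrier X\<rbrakk>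
    \<Longrightarrow> ip X x (y \<ominus>\<^bsub>X\<^esub> z) = ip X x y \<ominus>\<^bsub>A\<^esub> ip X x z"
  by (simp add: X.M.minus_eq a_inv_eq_smult ip_add_right ip_smult_right A.M.minus_eq A.minus_as_smult)

lemma ip_minus_left: "\<lbrakk>x \<in> carrier X; y \<in> carrier X; z \<in> carrier X\<rbrakk>
    \<Longrightarrow> ip X (x \<ominus>\<^bsub>X\<^esub> y) z = ip X x z \<ominus>\<^bsub>A\<^esub> ip X y z"
  by (simp add: X.M.minus_eq a_inv_eq_smult ip_add_left ip_smult_left A.M.minus_eq A.minus_as_smult)

lemma ip_zero [simp]: "x \<in> carrier X \<Longrightarrow> ip X x \<zero>\<^bsub>X\<^esub> = \<zero>\<^bsub>A\<^esub>" "x \<in> carrier X \<Longrightarrow> ip X \<zero>\<^bsub>X\<^esub> x = \<zero>\<^bsub>A\<^esub>"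
  using ip_smult_right[of x "\<zero>\<^bsub>X\<^esub>" 0] ip_smult_left[of "\<zero>\<^bsub>X\<^esub>" x 0] X.smult_l_null[of "\<zero>\<^bsub>X\<^esub>"] by simp_all

lemma ip_pos: "x \<in> carrier X \<Longrightarrow> A.pos (ip X x x)"
  by (simp add: A.cpositive_imp_pos ip_positive)

lemma hn_nonneg [simp]: "x \<in> carrier X \<Longrightarrow> 0 \<le> hn x"
  by (simp add: hnorm_def A.cnorm_nonneg)

lemma hn_square: "x \<in> carrier X \<Longrightarrow> (hn x)\<^sup>2 = cnorm A (ip X x x)"
  by (simp add: hnorm_def A.cnorm_nonneg)

lemma hn_eq_zero: "x \<in> carrier X \<Longrightarrow> hn x = 0 \<longleftrightarrow> x = \<zero>\<^bsub>X\<^esub>"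
  using ip_definite[of x] by (auto simp: hnorm_def A.cnorm_eq_zero)

lemma ip_eqI:
  assumes "x \<in> carrier X" "y \<in> carrier X" "\<And>z. z \<in> carrier X \<Longrightarrow> ip X x z = ip X y z"
  shows "x = y"
proof -
  have "ip X (x \<ominus>\<^bsub>X\<^esub> y) (x \<ominus>\<^bsub>X\<^esub> y) = \<zero>\<^bsub>A\<^esub>"
    using assms by (simp add: ip_minus_left A.minus_self)
  then show ?thesis using assms ip_definite[of "x \<ominus>\<^bsub>X\<^esub> y"] by (simp add: X.minus_eq_zero_iff)
qed

text \<open>Let c = <y,x> and z = x - yc/|y|^2. Since <y,y> <= |y|^2 in A, the element c^* c/|y|^2 -
  c^* <y,y> c/|y|^4 is positive; adding it to the positive <z,z> yields c^* c/|y|^2 <= <x,x>, and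
  norms are monotone on positive elements.\<close>

lemma Cauchy_Schwarz:
  assumes x: "x \<in> carrier X" and y: "y \<in> carrier X"
  shows "cnorm A (ip X x y) \<le> hn x * hn y"
proof (cases "y = \<zero>\<^bsub>X\<^esub>")
  case True
  then show ?thesis using x hn_eq_zero[of y] y by simp
next
  case False
  define Y where "Y = (hn y)\<^sup>2"
  have Y: "0 < Y" using False y hn_eq_zero[OF y] by (simp add: Y_def)
  define t where "t = complex_of_real (inverse Y)"
  have tr: "cnj t = t" and tY: "t * complex_of_real Y = 1" using Y by (simp_all add: t_def)
  define c where "c = ip X y x"
  have c: "c \<in> carrier A" using x y by (simp add: c_def)
  have sc: "ip X x y = star A c" using ip_star[OF y x] by (simp add: c_def)
  let ?cc = "star A c \<otimes>\<^bsub>A\<^esub> c" and ?w = "star A c \<otimes>\<^bsub>A\<^esub> ip X y y \<otimes>\<^bsub>A\<^esub> c"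
  define z where "z = x \<ominus>\<^bsub>X\<^esub> t \<odot>\<^bsub>X\<^esub> raction X y c"
  have z: "z \<in> carrier X" using x y c by (simp add: z_def)
  have "ip X z z = (ip X x x \<ominus>\<^bsub>A\<^esub> t \<odot>\<^bsub>A\<^esub> ?cc) \<ominus>\<^bsub>A\<^esub> (t \<odot>\<^bsub>A\<^esub> ?cc \<ominus>\<^bsub>A\<^esub> (t * t) \<odot>\<^bsub>A\<^esub> ?w)"
    using x y c tr by (simp add: z_def ip_minus_left ip_minus_right ip_smult_left ip_smult_right
      ip_raction_left ip_raction_right A.smult_smult sc A.mult_assoc A.smult_minus_right A.mult_minus_left
      A.mult_smult_left c_def[symmetric])
  then have "A.pos ((ip X x x \<ominus>\<^bsub>A\<^esub> t \<odot>\<^bsub>A\<^esub> ?cc) \<ominus>\<^bsub>A\<^esub> (t \<odot>\<^bsub>A\<^esub> ?cc \<ominus>\<^bsub>A\<^esub> (t * t) \<odot>\<^bsub>A\<^esub> ?w))"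
    using ip_pos[OF z] by simp
  moreover have "A.pos (t \<odot>\<^bsub>A\<^esub> ?cc \<ominus>\<^bsub>A\<^esub> (t * t) \<odot>\<^bsub>A\<^esub> ?w)"
  proof -
    have "A.pos (complex_of_real Y \<odot>\<^bsub>A\<^esub> \<one>\<^bsub>A\<^esub> \<ominus>\<^bsub>A\<^esub> ip X y y)"
      using y ip_star[OF y y] hn_square[OF y] by (intro A.pos_norm_minus) (simp_all add: Y_def)
    from A.pos_conjugate[OF this c]
    have "A.pos (complex_of_real Y \<odot>\<^bsub>A\<^esub> ?cc \<ominus>\<^bsub>A\<^esub> ?w)"
      using y c by (simp add: A.mult_minus_left A.mult_minus_right A.mult_smult_left A.mult_smult_right
          A.mult_one_right)
    then have "A.pos (complex_of_real (inverse Y * inverse Y) \<odot>\<^bsub>A\<^esub> (complex_of_real Y \<odot>\<^bsub>A\<^esub> ?cc \<ominus>\<^bsub>A\<^esub> ?w))"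
      by (rule A.pos_scale) (use Y in simp)
    moreover have "complex_of_real (inverse Y * inverse Y) * complex_of_real Y = t"
      using Y by (simp add: t_def)
    ultimately show ?thesis
      using y c by (simp only: A.smult_minus_right A.smult_smult A.mult_closed A.star_closed
          A.smult_closed' ip_closed) (simp add: t_def)
  qed
  ultimately have "A.pos (((ip X x x \<ominus>\<^bsub>A\<^esub> t \<odot>\<^bsub>A\<^esub> ?cc) \<ominus>\<^bsub>A\<^esub> (t \<odot>\<^bsub>A\<^esub> ?cc \<ominus>\<^bsub>A\<^esub> (t * t) \<odot>\<^bsub>A\<^esub> ?w))
      \<oplus>\<^bsub>A\<^esub> (t \<odot>\<^bsub>A\<^esub> ?cc \<ominus>\<^bsub>A\<^esub> (t * t) \<odot>\<^bsub>A\<^esub> ?w))"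
    by (rule A.pos_add)
  then have "A.pos (ip X x x \<ominus>\<^bsub>A\<^esub> t \<odot>\<^bsub>A\<^esub> ?cc)" using x y c by (simp add: A.add_minus_cancel)
  moreover have "A.pos (t \<odot>\<^bsub>A\<^esub> ?cc)"
    unfolding t_def using Y c by (intro A.pos_scale A.pos_star_mult_self) simp_all
  ultimately have "cnorm A (t \<odot>\<^bsub>A\<^esub> ?cc) \<le> cnorm A (ip X x x)"
    using x by (intro A.pos_cnorm_mono) simp_all
  moreover have "cnorm A (t \<odot>\<^bsub>A\<^esub> ?cc) = inverse Y * (cnorm A c)\<^sup>2"
    using c Y by (simp add: A.cnorm_smult A.cstar_identity t_def norm_inverse)
  ultimately have "inverse Y * (cnorm A c)\<^sup>2 \<le> (hn x)\<^sup>2" using x by (simp add: hn_square)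
  then have "Y * (inverse Y * (cnorm A c)\<^sup>2) \<le> Y * (hn x)\<^sup>2"
    by (rule mult_left_mono) (use Y in simp)
  moreover have "Y * (inverse Y * (cnorm A c)\<^sup>2) = (cnorm A c)\<^sup>2" using Y by simp
  moreover have "Y * (hn x)\<^sup>2 = (hn x * hn y)\<^sup>2" by (simp add: Y_def power_mult_distrib)
  ultimately have "(cnorm A c)\<^sup>2 \<le> (hn x * hn y)\<^sup>2" by simp
  then have "cnorm A c \<le> hn x * hn y" by (rule power2_le_imp_le) (use x y in simp)
  then show ?thesis using c by (simp add: sc A.cnorm_star)
qed

lemma hn_triangle:
  assumes x: "x \<in> carrier X" and y: "y \<in> carrier X"
  shows "hn (x \<oplus>\<^bsub>X\<^esub> y) \<le> hn x + hn y"
proof (rule power2_le_imp_le)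
  have "(hn (x \<oplus>\<^bsub>X\<^esub> y))\<^sup>2 = cnorm A ((ip X x x \<oplus>\<^bsub>A\<^esub> ip X x y) \<oplus>\<^bsub>A\<^esub> (ip X y x \<oplus>\<^bsub>A\<^esub> ip X y y))"
    using x y by (simp add: hn_square ip_add_left ip_add_right A.M.a_ac)
  also have "\<dots> \<le> (cnorm A (ip X x x) + cnorm A (ip X x y)) + (cnorm A (ip X y x) + cnorm A (ip X y y))"
    using A.cnorm_triangle[of "ip X x x \<oplus>\<^bsub>A\<^esub> ip X x y" "ip X y x \<oplus>\<^bsub>A\<^esub> ip X y y"]
      A.cnorm_triangle[of "ip X x x" "ip X x y"] A.cnorm_triangle[of "ip X y x" "ip X y y"] x y by simp
  also have "\<dots> \<le> ((hn x)\<^sup>2 + hn x * hn y) + (hn y * hn x + (hn y)\<^sup>2)"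
    using Cauchy_Schwarz[OF x y] Cauchy_Schwarz[OF y x] x y by (simp only: hn_square)
  also have "\<dots> = (hn x + hn y)\<^sup>2" by (simp add: power2_sum mult.commute)
  finally show "(hn (x \<oplus>\<^bsub>X\<^esub> y))\<^sup>2 \<le> (hn x + hn y)\<^sup>2" .
qed (use x y in simp)

lemma hn_smult: "x \<in> carrier X \<Longrightarrow> hn (c \<odot>\<^bsub>X\<^esub> x) = cmod c * hn x"
proof -
  assume x: "x \<in> carrier X"
  have "ip X (c \<odot>\<^bsub>X\<^esub> x) (c \<odot>\<^bsub>X\<^esub> x) = (cnj c * c) \<odot>\<^bsub>A\<^esub> ip X x x"
    using x by (simp add: ip_smult_left ip_smult_right A.smult_smult mult.commute)
  then have "cnorm A (ip X (c \<odot>\<^bsub>X\<^esub> x) (c \<odot>\<^bsub>X\<^esub> x)) = (cmod c)\<^sup>2 * cnorm A (ip X x x)"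
    using x by (simp add: A.cnorm_smult norm_mult power2_eq_square)
  then show ?thesis by (simp add: hnorm_def real_sqrt_mult)
qed

lemma hn_raction:
  assumes "x \<in> carrier X" "a \<in> carrier A"
  shows "hn (raction X x a) \<le> hn x * cnorm A a"
proof (rule power2_le_imp_le)
  have "(hn (raction X x a))\<^sup>2 = cnorm A (star A a \<otimes>\<^bsub>A\<^esub> (ip X x x \<otimes>\<^bsub>A\<^esub> a))"
    using assms by (simp add: hn_square ip_raction_left ip_raction_right A.mult_assoc)
  also have "\<dots> \<le> cnorm A a * (cnorm A (ip X x x) * cnorm A a)"
    using A.cnorm_mult[of "star A a" "ip X x x \<otimes>\<^bsub>A\<^esub> a"] A.cnorm_mult[of "ip X x x" a] assms
      mult_left_mono[OF A.cnorm_mult[of "ip X x x" a] A.cnorm_nonneg[of a]]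
    by (simp add: A.cnorm_star)
  also have "\<dots> = (hn x * cnorm A a)\<^sup>2"
    using assms by (simp add: hn_square[symmetric] power2_eq_square)
  finally show "(hn (raction X x a))\<^sup>2 \<le> (hn x * cnorm A a)\<^sup>2" .
qed (use assms A.cnorm_nonneg in simp)

sublocale X: normed_space X hn
  by unfold_locales (auto intro: hn_triangle simp: hn_eq_zero hn_smult)

end

section \<open>Adjointable operators and the operator norm\<close>

context unital_hilbert_module
begin

lemma adjointables_simps [simp]:
  "\<zero>\<^bsub>adjointables A X\<^esub> = (\<lambda>x\<in>carrier X. \<zero>\<^bsub>X\<^esub>)"
  "F \<oplus>\<^bsub>adjointables A X\<^esub> G = (\<lambda>x\<in>carrier X. F x \<oplus>\<^bsub>X\<^esub> G x)"
  "c \<odot>\<^bsub>adjointables A X\<^esub> F = (\<lambda>x\<in>carrier X. c \<odot>\<^bsub>X\<^esub> F x)"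
  "F \<otimes>\<^bsub>adjointables A X\<^esub> G = compose (carrier X) F G"
  by (simp_all add: adjointables_def)

lemma adjointable_iff: "F \<in> carrier (adjointables A X) \<longleftrightarrow>
    F \<in> carrier X \<rightarrow>\<^sub>E carrier X \<and> (\<exists>G\<in>carrier X \<rightarrow>\<^sub>E carrier X. is_adjoint X F G)"
  by (simp add: adjointables_def)

lemma adjointable_closed [simp]: "\<lbrakk>F \<in> carrier (adjointables A X); x \<in> carrier X\<rbrakk> \<Longrightarrow> F x \<in> carrier X"
  by (auto simp: adjointable_iff)

lemma adjointable_eqI: "\<lbrakk>F \<in> carrier (adjointables A X); G \<in> carrier (adjointables A X);
    \<And>x. x \<in> carrier X \<Longrightarrow> F x = G x\<rbrakk> \<Longrightarrow> F = G"
  unfolding adjointable_iff by (blast intro: PiE_ext)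

lemma is_adjointD: "\<lbrakk>is_adjoint X F G; x \<in> carrier X; y \<in> carrier X\<rbrakk> \<Longrightarrow> ip X (F x) y = ip X x (G y)"
  by (simp add: is_adjoint_def)

lemma is_adjoint_sym:
  assumes "is_adjoint X F G" "\<And>x. x \<in> carrier X \<Longrightarrow> F x \<in> carrier X" "\<And>x. x \<in> carrier X \<Longrightarrow> G x \<in> carrier X"
  shows "is_adjoint X G F"
  unfolding is_adjoint_def
proof (intro ballI)
  fix x y assume "x \<in> carrier X" "y \<in> carrier X"
  then show "ip X (G x) y = ip X x (F y)"
    using ip_star[of y "G x"] ip_star[of "F y" x] is_adjointD[OF assms(1), of y x] assms(2,3) by simp
qed

lemma adjointableI:
  assumes "F \<in> carrier X \<rightarrow>\<^sub>E carrier X" "\<And>x. x \<in> carrier X \<Longrightarrow> G x \<in> carrier X"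
    "\<And>x y. \<lbrakk>x \<in> carrier X; y \<in> carrier X\<rbrakk> \<Longrightarrow> ip X (F x) y = ip X x (G y)"
  shows "F \<in> carrier (adjointables A X)"
  unfolding adjointable_iff using assms
  by (auto simp: is_adjoint_def intro!: bexI[of _ "restrict G (carrier X)"])

lemma star_adjointable:
  assumes F: "F \<in> carrier (adjointables A X)"
  shows "star (adjointables A X) F \<in> carrier (adjointables A X)"
    and "\<lbrakk>x \<in> carrier X; y \<in> carrier X\<rbrakk> \<Longrightarrow> ip X (F x) y = ip X x (star (adjointables A X) F y)"
proof -
  obtain G where G: "G \<in> carrier X \<rightarrow>\<^sub>E carrier X" "is_adjoint X F G" using F by (auto simp: adjointable_iff)
  have "star (adjointables A X) F = (THE G. G \<in> carrier X \<rightarrow>\<^sub>E carrier X \<and> is_adjoint X F G)"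
    by (simp add: adjointables_def)
  also have "\<dots> = G"
  proof (rule the_equality)
    fix H assume H: "H \<in> carrier X \<rightarrow>\<^sub>E carrier X \<and> is_adjoint X F H"
    show "H = G"
    proof (rule PiE_ext)
      fix y assume y: "y \<in> carrier X"
      have mem: "H y \<in> carrier X" "G y \<in> carrier X" using H G y by auto
      show "H y = G y"
      proof (rule ip_eqI[OF mem])
        fix z assume z: "z \<in> carrier X"
        have "ip X z (H y) = ip X z (G y)"
          using is_adjointD[of F H z y] is_adjointD[OF G(2) z y] H y z by simp
        then show "ip X (H y) z = ip X (G y) z" using ip_star[OF z mem(1)] ip_star[OF z mem(2)] by simp
      qed
    qed (use H G in auto)
  qed (use G in auto)
  finally have eq: "star (adjointables A X) F = G" .
  have FX: "F x \<in> carrier X" if "x \<in> carrier X" for x using F that by simp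
  have GX: "G x \<in> carrier X" if "x \<in> carrier X" for x using G that by auto
  show "star (adjointables A X) F \<in> carrier (adjointables A X)"
    unfolding eq using is_adjointD[OF is_adjoint_sym[OF G(2) FX GX]]
    by (intro adjointableI[OF G(1) FX]) auto
  show "\<lbrakk>x \<in> carrier X; y \<in> carrier X\<rbrakk> \<Longrightarrow> ip X (F x) y = ip X x (star (adjointables A X) F y)"
    unfolding eq using G(2) by (rule is_adjointD)
qed

lemma adjointable_star_eqI:
  assumes F: "F \<in> carrier (adjointables A X)" and G: "G \<in> carrier (adjointables A X)"
    and adj: "\<And>x y. \<lbrakk>x \<in> carrier X; y \<in> carrier X\<rbrakk> \<Longrightarrow> ip X (F x) y = ip X x (G y)"
  shows "star (adjointables A X) F = G"
proof (rule adjointable_eqI[OF star_adjointable(1)[OF F] G])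
  fix y assume y: "y \<in> carrier X"
  let ?H = "star (adjointables A X) F"
  have mem: "?H y \<in> carrier X" "G y \<in> carrier X" using star_adjointable(1)[OF F] G y by simp_all
  show "?H y = G y"
  proof (rule ip_eqI[OF mem])
    fix z assume z: "z \<in> carrier X"
    have "ip X z (?H y) = ip X z (G y)"
      using star_adjointable(2)[OF F z y] adj[OF z y] by simp
    then show "ip X (?H y) z = ip X (G y) z" using ip_star[OF z mem(1)] ip_star[OF z mem(2)] by simp
  qed
qed

text \<open>An element of \<open>adjointables\<close> is by definition any map with an adjoint;
  additivity is forced by testing against the form.\<close>

lemma adjointable_add:
  assumes F: "F \<in> carrier (adjointables A X)" and "x \<in> carrier X" "y \<in> carrier X"
  shows "F (x \<oplus>\<^bsub>X\<^esub> y) = F x \<oplus>\<^bsub>X\<^esub> F y"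
  using assms star_adjointable[OF F] by (intro ip_eqI) (simp_all add: ip_add_left)

lemma adjointable_smult:
  assumes F: "F \<in> carrier (adjointables A X)" and "x \<in> carrier X"
  shows "F (c \<odot>\<^bsub>X\<^esub> x) = c \<odot>\<^bsub>X\<^esub> F x"
  using assms star_adjointable[OF F] by (intro ip_eqI) (simp_all add: ip_smult_left)

lemma adjointables_closed:
  shows "(\<lambda>x\<in>carrier X. \<zero>\<^bsub>X\<^esub>) \<in> carrier (adjointables A X)"
    and "\<lbrakk>F \<in> carrier (adjointables A X); G \<in> carrier (adjointables A X)\<rbrakk>
      \<Longrightarrow> (\<lambda>x\<in>carrier X. F x \<oplus>\<^bsub>X\<^esub> G x) \<in> carrier (adjointables A X)"
    and "F \<in> carrier (adjointables A X) \<Longrightarrow> (\<lambda>x\<in>carrier X. c \<odot>\<^bsub>X\<^esub> F x) \<in> carrier (adjointables A X)"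
    and "\<lbrakk>F \<in> carrier (adjointables A X); G \<in> carrier (adjointables A X)\<rbrakk>
      \<Longrightarrow> compose (carrier X) F G \<in> carrier (adjointables A X)"
proof -
  let ?s = "star (adjointables A X)"
  show "(\<lambda>x\<in>carrier X. \<zero>\<^bsub>X\<^esub>) \<in> carrier (adjointables A X)"
    by (rule adjointableI[where G = "\<lambda>x. \<zero>\<^bsub>X\<^esub>"]) auto
  show "(\<lambda>x\<in>carrier X. F x \<oplus>\<^bsub>X\<^esub> G x) \<in> carrier (adjointables A X)"
    if "F \<in> carrier (adjointables A X)" "G \<in> carrier (adjointables A X)"
    using that star_adjointable[of F] star_adjointable[of G]
    by (intro adjointableI[where G = "\<lambda>x. ?s F x \<oplus>\<^bsub>X\<^esub> ?s G x"]) (auto simp: ip_add_left ip_add_right)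
  show "(\<lambda>x\<in>carrier X. c \<odot>\<^bsub>X\<^esub> F x) \<in> carrier (adjointables A X)" if "F \<in> carrier (adjointables A X)"
    using that star_adjointable[of F]
    by (intro adjointableI[where G = "\<lambda>x. cnj c \<odot>\<^bsub>X\<^esub> ?s F x"]) (auto simp: ip_smult_left ip_smult_right)
  show "compose (carrier X) F G \<in> carrier (adjointables A X)"
    if "F \<in> carrier (adjointables A X)" "G \<in> carrier (adjointables A X)"
    using that star_adjointable[of F] star_adjointable[of G]
    by (intro adjointableI[where G = "\<lambda>x. ?s G (?s F x)"]) (auto simp: compose_def)
qed

lemma module_adjointables: "Module.module complex_field (adjointables A X)"
proof (rule moduleI[OF cring_complex_field])
  note c = adjointables_closed
  show "abelian_group (adjointables A X)"
  proof (rule abelian_groupI)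
    fix F assume F: "F \<in> carrier (adjointables A X)"
    show "\<exists>G\<in>carrier (adjointables A X). G \<oplus>\<^bsub>adjointables A X\<^esub> F = \<zero>\<^bsub>adjointables A X\<^esub>"
    proof (intro bexI)
      show "(\<lambda>x\<in>carrier X. (- 1) \<odot>\<^bsub>X\<^esub> F x) \<in> carrier (adjointables A X)" by (rule c(3)[OF F])
      show "(\<lambda>x\<in>carrier X. (- 1) \<odot>\<^bsub>X\<^esub> F x) \<oplus>\<^bsub>adjointables A X\<^esub> F = \<zero>\<^bsub>adjointables A X\<^esub>"
        using F by (auto simp: X.minus_as_smult[symmetric] X.M.l_neg intro!: restrict_ext)
    qed
    show "\<zero>\<^bsub>adjointables A X\<^esub> \<oplus>\<^bsub>adjointables A X\<^esub> F = F"
      unfolding adjointables_simps by (rule adjointable_eqI[OF c(2)[OF c(1) F] F]) (use F in simp)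
  qed (use c in \<open>auto simp: X.M.a_ac intro!: restrict_ext\<close>)
qed (use adjointables_closed in \<open>auto simp: X.smult_add_left X.smult_add_right X.smult_smult
    intro!: restrict_ext adjointable_eqI\<close>)

text \<open>
  The uniform boundedness principle, by Sokal's argument: if $F$ is unbounded there are unit vectors
  $u_n$ with $\|\langle u_n, y\rangle\| \le 4^{-n}\|F^*y\|$ for all $y$, while a suitable
  $y = \sum \pm 3^{-n}u_n$ has $\|\langle u_n, y\rangle\| \ge 3^{-n}/2$.
\<close>

lemma adjointable_bounded:
  assumes F: "F \<in> carrier (adjointables A X)"
  obtains B where "0 \<le> B" "\<And>x. x \<in> carrier X \<Longrightarrow> hn (F x) \<le> B * hn x"
proof -
  let ?G = "star (adjointables A X) F"
  have "\<exists>B\<ge>0. \<forall>x\<in>carrier X. hn (F x) \<le> B * hn x"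
  proof (rule ccontr)
    assume "\<not> ?thesis"
    then have "\<forall>n::nat. \<exists>x\<in>carrier X. \<not> hn (F x) \<le> 4 ^ n * hn x"
      by (metis zero_le_numeral zero_le_power)
    then obtain x where x: "\<And>n. x n \<in> carrier X" "\<And>n::nat. 4 ^ n * hn (x n) < hn (F (x n))"
      by (metis not_le)
    define s where "s n = hn (F (x n))" for n
    have s: "0 < s n" for n
      unfolding s_def by (rule order_le_less_trans[OF _ x(2)[of n]]) (simp add: x)
    define u where "u n = complex_of_real (inverse (s n)) \<odot>\<^bsub>X\<^esub> F (x n)" for n
    have u [simp]: "u n \<in> carrier X" for n using x F by (simp add: u_def)
    have hu: "hn (u n) = 1" for n
      using s[of n] x F by (simp add: u_def X.nrm_smult norm_inverse s_def[symmetric])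
    have ub: "cnorm A (ip X (u n) y) * 4 ^ n \<le> hn (?G y)" if y: "y \<in> carrier X" for n y
    proof -
      have G: "?G y \<in> carrier X" using star_adjointable(1)[OF F] y by simp
      have "cnorm A (ip X (u n) y) = inverse (s n) * cnorm A (ip X (x n) (?G y))"
        using s[of n] x F y G star_adjointable(2)[OF F x(1) y]
        by (simp add: u_def ip_smult_left A.cnorm_smult norm_inverse)
      also have "\<dots> \<le> inverse (s n) * (hn (x n) * hn (?G y))"
        using s[of n] Cauchy_Schwarz[OF x(1) G] by (intro mult_left_mono) auto
      finally have "cnorm A (ip X (u n) y) * 4 ^ n \<le> inverse (s n) * (hn (x n) * hn (?G y)) * 4 ^ n"
        by (rule mult_right_mono) simp
      also have "\<dots> = (4 ^ n * hn (x n)) * (inverse (s n) * hn (?G y))" by (simp add: mult_ac)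
      also have "\<dots> \<le> s n * (inverse (s n) * hn (?G y))"
        using x(2)[of n] s[of n] G by (intro mult_right_mono) (auto simp: s_def)
      also have "\<dots> = hn (?G y)" using s[of n] by simp
      finally show ?thesis .
    qed
    define r :: "nat \<Rightarrow> real" where "r n = (1/3) ^ n" for n
    have r: "0 < r n" "r (Suc n) = r n / 3" for n by (simp_all add: r_def)
    define P where "P n y = y \<oplus>\<^bsub>X\<^esub> complex_of_real (r n) \<odot>\<^bsub>X\<^esub> u n" for n y
    define N where "N n y = y \<ominus>\<^bsub>X\<^esub> complex_of_real (r n) \<odot>\<^bsub>X\<^esub> u n" for n y
    define Y where "Y = rec_nat \<zero>\<^bsub>X\<^esub> (\<lambda>n y. if r n \<le> cnorm A (ip X (u n) (P n y)) then P n y else N n y)"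
    have YS: "Y (Suc n) = (if r n \<le> cnorm A (ip X (u n) (P n (Y n))) then P n (Y n) else N n (Y n))" for n
      by (simp add: Y_def)
    have Yc [simp]: "Y n \<in> carrier X" for n
      by (induction n) (simp_all add: YS P_def N_def, simp add: Y_def)
    \<comment> \<open>The pairings of u n with the two candidates P and N differ by 2 r_n <u_n,
      u_n>, of norm 2 r_n, so at least one of them has norm r_n or more.\<close>
    have big: "r n \<le> cnorm A (ip X (u n) (Y (Suc n)))" for n
    proof (cases "r n \<le> cnorm A (ip X (u n) (P n (Y n)))")
      case False
      let ?p = "ip X (u n) (P n (Y n))" and ?m = "ip X (u n) (N n (Y n))"
      let ?i = "complex_of_real (r n) \<odot>\<^bsub>A\<^esub> ip X (u n) (u n)"
      have pm: "?p \<in> carrier A" "?m \<in> carrier A" by (simp_all add: P_def N_def)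
      have "?p = ?m \<oplus>\<^bsub>A\<^esub> (?i \<oplus>\<^bsub>A\<^esub> ?i)"
        by (simp add: P_def N_def ip_add_right ip_minus_right ip_smult_right A.cstar_ring_simps)
      then have "?i \<oplus>\<^bsub>A\<^esub> ?i = ?p \<ominus>\<^bsub>A\<^esub> ?m" using pm by (simp add: A.cstar_ring_simps)
      moreover have "cnorm A (?i \<oplus>\<^bsub>A\<^esub> ?i) = 2 * r n"
        using hu[of n] hn_square[of "u n"] r(1)[of n]
          A.smult_add_left[of "ip X (u n) (u n)" "complex_of_real (r n)" "complex_of_real (r n)", symmetric]
        by (simp add: A.cnorm_smult flip: mult_2)
      ultimately have "2 * r n \<le> cnorm A ?p + cnorm A ?m" using A.nrm_minus_le[OF pm] by simp
      then show ?thesis using False by (simp add: YS)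
    qed (simp add: YS)
    have step: "hn (Y (Suc n) \<ominus>\<^bsub>X\<^esub> Y n) \<le> r n" for n
    proof -
      let ?ru = "complex_of_real (r n) \<odot>\<^bsub>X\<^esub> u n"
      have "hn ?ru = r n" using r(1)[of n] by (simp add: X.nrm_smult hu)
      moreover have "P n (Y n) \<ominus>\<^bsub>X\<^esub> Y n = ?ru"
        by (simp add: P_def X.M.minus_eq X.M.a_ac X.M.r_neg1 X.M.r_neg2 X.M.r_neg)
      moreover have "N n (Y n) \<ominus>\<^bsub>X\<^esub> Y n = \<ominus>\<^bsub>X\<^esub> ?ru"
        by (simp add: N_def X.M.minus_eq X.M.a_ac X.M.r_neg1 X.M.r_neg2 X.M.r_neg)
      ultimately show ?thesis by (simp add: YS X.nrm_a_inv)
    qed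
    \<comment> \<open>All steps after the n-th together move Y by at most the sum of 3^(-j) over j >
      n, which is r_n/2. Hence half of the bound r_n in \<open>big\<close> survives in the limit
      y.\<close>
    have dist: "hn (Y (Suc n + k) \<ominus>\<^bsub>X\<^esub> Y (Suc n)) \<le> (r n - r (n + k)) / 2" for n k
    proof (induction k)
      case (Suc k)
      then show ?case
        using X.nrm_minus_triangle[of "Y (Suc (Suc (n + k)))" "Y (Suc (n + k))" "Y (Suc n)"]
          step[of "Suc (n + k)"] r(2)[of "n + k"] by simp
    qed (simp add: X.minus_self)
    have dist': "hn (Y m \<ominus>\<^bsub>X\<^esub> Y (Suc n)) \<le> r n / 2" if "Suc n \<le> m" for n m
      using dist[of n "m - Suc n"] that r(1)[of "n + (m - Suc n)"] by simp
    have "\<exists>N. \<forall>m\<ge>N. \<forall>k\<ge>N. hn (Y m \<ominus>\<^bsub>X\<^esub> Y k) < e" if e: "0 < e" for e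
    proof -
      obtain n where n: "r n < e" using real_arch_pow_inv[OF e, of "1/3"] by (auto simp: r_def)
      have "hn (Y m \<ominus>\<^bsub>X\<^esub> Y k) < e" if "m \<ge> Suc n" "k \<ge> Suc n" for m k
        using X.nrm_minus_triangle[of "Y m" "Y (Suc n)" "Y k"] X.nrm_minus_commute[of "Y k" "Y (Suc n)"]
          dist'[OF that(1)] dist'[OF that(2)] n by simp
      then show ?thesis by blast
    qed
    then obtain y where lim: "X.nlim Y y"
      using X.nlim_exists[OF complete, of Y] Yc by blast
    then have y: "y \<in> carrier X" by (rule X.nlim_closed)
    have low: "r n / 2 \<le> cnorm A (ip X (u n) y)" for n
    proof -
      have "X.nlim (\<lambda>k. Y (k + Suc n) \<ominus>\<^bsub>X\<^esub> Y (Suc n)) (y \<ominus>\<^bsub>X\<^esub> Y (Suc n))"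
        by (intro X.nlim_minus X.nlim_const X.nlim_ignore_initial[OF lim]) simp_all
      then have "hn (y \<ominus>\<^bsub>X\<^esub> Y (Suc n)) \<le> r n / 2"
        by (rule X.nlim_nrm_le) (rule dist', simp)
      moreover have "cnorm A (ip X (u n) (y \<ominus>\<^bsub>X\<^esub> Y (Suc n))) \<le> hn (y \<ominus>\<^bsub>X\<^esub> Y (Suc n))"
        using Cauchy_Schwarz[of "u n" "y \<ominus>\<^bsub>X\<^esub> Y (Suc n)"] y by (simp add: hu)
      moreover have "cnorm A (ip X (u n) (Y (Suc n)))
          \<le> cnorm A (ip X (u n) (y \<ominus>\<^bsub>X\<^esub> Y (Suc n))) + cnorm A (ip X (u n) y)"
        using A.nrm_le_minus[of "ip X (u n) (Y (Suc n))" "ip X (u n) y"] y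
          A.nrm_minus_commute[of "ip X (u n) (Y (Suc n))" "ip X (u n) y"]
        by (simp add: ip_minus_right)
      ultimately show ?thesis using big[of n] by linarith
    qed
    \<comment> \<open>\<open>low\<close> and \<open>ub\<close> together give (4/3)^n/2 <= |F^* y|
      for every n, which fails for large n.\<close>
    obtain n where n: "2 * hn (?G y) < (4/3) ^ n" using real_arch_pow[of "4/3" "2 * hn (?G y)"] by auto
    have "r n / 2 * 4 ^ n \<le> hn (?G y)"
      by (rule order_trans[OF mult_right_mono[OF low[of n]] ub[OF y, of n]]) simp
    then show False using n by (simp add: r_def power_divide field_simps)
  qed
  then show thesis using that by blast
qed

abbreviation opnorm :: "('m \<Rightarrow> 'm) \<Rightarrow> real" where "opnorm \<equiv> cnorm (adjointables A X)"

lemma opnorm_le: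
  assumes "0 \<le> B" "\<And>x. x \<in> carrier X \<Longrightarrow> hn (F x) \<le> B * hn x"
  shows "opnorm F \<le> B"
proof -
  have "hn (F x) \<le> B" if "x \<in> carrier X" "hn x \<le> 1" for x
    using assms(2)[OF that(1)] mult_left_mono[OF that(2) assms(1)] by simp
  moreover have "\<zero>\<^bsub>X\<^esub> \<in> {x \<in> carrier X. hn x \<le> 1}" by simp
  ultimately show ?thesis unfolding adjointables_def by (auto intro!: cSUP_least)
qed

text \<open>A real supremum carries information only for a set that is bounded above;
  \<open>adjointable_bounded\<close> supplies this.\<close>

lemma opnorm_bound:
  assumes F: "F \<in> carrier (adjointables A X)" and x: "x \<in> carrier X"
  shows "hn (F x) \<le> opnorm F * hn x"
proof (cases "hn x = 0")
  case True
  then have "x = 0 \<odot>\<^bsub>X\<^esub> x" using hn_eq_zero[OF x] x by simp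
  then have "F x = 0 \<odot>\<^bsub>X\<^esub> F x" using adjointable_smult[OF F x, of 0] by simp
  then show ?thesis using F x True by simp
next
  case False
  then have p: "0 < hn x" using hn_nonneg[OF x] by linarith
  obtain B where B: "0 \<le> B" "\<And>x. x \<in> carrier X \<Longrightarrow> hn (F x) \<le> B * hn x"
    using adjointable_bounded[OF F] by blast
  have bdd: "bdd_above ((\<lambda>x. hn (F x)) ` {x \<in> carrier X. hn x \<le> 1})"
  proof (rule bdd_aboveI2)
    fix x assume "x \<in> {x \<in> carrier X. hn x \<le> 1}"
    then show "hn (F x) \<le> B" using B(2)[of x] mult_left_mono[of "hn x" 1 B] B(1) by simp
  qed
  let ?r = "complex_of_real (inverse (hn x))"
  have "hn (F (?r \<odot>\<^bsub>X\<^esub> x)) \<le> opnorm F"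
    unfolding adjointables_def using x p
    by (auto intro!: cSUP_upper[OF _ bdd] simp: X.nrm_smult norm_inverse)
  then have "inverse (hn x) * hn (F x) \<le> opnorm F"
    using F x p by (simp add: adjointable_smult X.nrm_smult norm_inverse)
  then have "hn x * (inverse (hn x) * hn (F x)) \<le> hn x * opnorm F" using p by (intro mult_left_mono) auto
  moreover have "hn x * (inverse (hn x) * hn (F x)) = hn (F x)" using p by simp
  ultimately show ?thesis by (simp only: mult.commute)
qed

lemma opnorm_nonneg: "F \<in> carrier (adjointables A X) \<Longrightarrow> 0 \<le> opnorm F"
proof (cases "\<exists>x\<in>carrier X. hn x \<noteq> 0")
  case True
  assume F: "F \<in> carrier (adjointables A X)"
  obtain x where x: "x \<in> carrier X" "0 < hn x" using True hn_nonneg by fastforce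
  have "0 \<le> opnorm F * hn x" using opnorm_bound[OF F x(1)] hn_nonneg F x by (meson adjointable_closed order_trans)
  then show ?thesis using x(2) by (simp add: zero_le_mult_iff)
next
  case False
  assume F: "F \<in> carrier (adjointables A X)"
  have "(\<lambda>x. hn (F x)) ` {x \<in> carrier X. hn x \<le> 1} = {0}"
    using False F by (auto intro!: image_eqI[of _ _ "\<zero>\<^bsub>X\<^esub>"])
  then show ?thesis by (simp add: adjointables_def)
qed

sublocale L: normed_space "adjointables A X" opnorm
proof -
  interpret Lm: Module.module complex_field "adjointables A X" by (rule module_adjointables)
  note c = adjointables_closed
  show "normed_space (adjointables A X) opnorm"
  proof
    fix F assume F: "F \<in> carrier (adjointables A X)"
    show "0 \<le> opnorm F" by (rule opnorm_nonneg[OF F])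
    show "(opnorm F = 0) = (F = \<zero>\<^bsub>adjointables A X\<^esub>)"
    proof
      assume z: "opnorm F = 0"
      have "F x = \<zero>\<^bsub>X\<^esub>" if "x \<in> carrier X" for x
      proof -
        have "hn (F x) \<le> 0" using opnorm_bound[OF F that] z by simp
        then have "hn (F x) = 0" using hn_nonneg[of "F x"] F that by (intro antisym) auto
        then show ?thesis using hn_eq_zero[of "F x"] F that by simp
      qed
      then show "F = \<zero>\<^bsub>adjointables A X\<^esub>" using F c(1) by (intro adjointable_eqI) auto
    next
      assume "F = \<zero>\<^bsub>adjointables A X\<^esub>"
      then have "opnorm F \<le> 0" by (intro opnorm_le) simp_all
      then show "opnorm F = 0" using opnorm_nonneg[OF F] by linarith
    qed
    have smult_le: "opnorm (b \<odot>\<^bsub>adjointables A X\<^esub> H) \<le> cmod b * opnorm H"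
      if "H \<in> carrier (adjointables A X)" for b H
      using that opnorm_bound opnorm_nonneg
      by (intro opnorm_le) (auto simp: X.nrm_smult mult.assoc intro!: mult_left_mono)
    show "opnorm (b \<odot>\<^bsub>adjointables A X\<^esub> F) = cmod b * opnorm F" for b
    proof (cases "b = 0")
      case True
      then have "opnorm (b \<odot>\<^bsub>adjointables A X\<^esub> F) \<le> 0" using smult_le[OF F, of 0] by simp
      then show ?thesis using True opnorm_nonneg[of "b \<odot>\<^bsub>adjointables A X\<^esub> F"] c(3)[OF F, of b] by simp
    next
      case False
      let ?bF = "b \<odot>\<^bsub>adjointables A X\<^esub> F"
      have "inverse b \<odot>\<^bsub>adjointables A X\<^esub> ?bF = F"
        using Lm.smult_assoc1[of "inverse b" b F] Lm.smult_one[OF F] F False by (simp del: adjointables_simps)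
      then have "opnorm F \<le> cmod (inverse b) * opnorm ?bF"
        using smult_le[of ?bF "inverse b"] c(3)[OF F, of b] by simp
      then have "cmod b * opnorm F \<le> cmod b * (cmod (inverse b) * opnorm ?bF)"
        by (rule mult_left_mono) simp
      also have "\<dots> = opnorm ?bF" using False by (simp add: norm_inverse del: adjointables_simps)
      finally have "cmod b * opnorm F \<le> opnorm ?bF" .
      then show ?thesis using smult_le[OF F, of b] by linarith
    qed
    show "opnorm (F \<oplus>\<^bsub>adjointables A X\<^esub> G) \<le> opnorm F + opnorm G" if G: "G \<in> carrier (adjointables A X)" for G
    proof (rule opnorm_le)
      show "hn ((F \<oplus>\<^bsub>adjointables A X\<^esub> G) x) \<le> (opnorm F + opnorm G) * hn x" if x: "x \<in> carrier X" for x
        using hn_triangle[of "F x" "G x"] opnorm_bound[OF F x] opnorm_bound[OF G x] F G x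
        by (simp add: distrib_right)
    qed (use opnorm_nonneg F G in simp)
  qed
qed

lemma adjointables_minus: "\<lbrakk>F \<in> carrier (adjointables A X); G \<in> carrier (adjointables A X); x \<in> carrier X\<rbrakk>
    \<Longrightarrow> (F \<ominus>\<^bsub>adjointables A X\<^esub> G) x = F x \<ominus>\<^bsub>X\<^esub> G x"
  by (simp add: L.M.minus_eq L.minus_as_smult X.M.minus_eq X.minus_as_smult)

lemma rank_one_adjointable:
  assumes "x \<in> carrier X" "y \<in> carrier X"
  shows "rank_one X x y \<in> carrier (adjointables A X)"
    and "star (adjointables A X) (rank_one X x y) = rank_one X y x"
proof -
  have mem: "rank_one X x y \<in> carrier (adjointables A X)" if "x \<in> carrier X" "y \<in> carrier X" for x y
    using that unfolding rank_one_def
    by (intro adjointableI[where G = "\<lambda>z. raction X y (ip X x z)"])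
      (auto simp: ip_raction_left ip_raction_right ip_star)
  then show "rank_one X x y \<in> carrier (adjointables A X)" using assms by blast
  show "star (adjointables A X) (rank_one X x y) = rank_one X y x"
    using assms mem by (intro adjointable_star_eqI)
      (auto simp: rank_one_def ip_raction_left ip_raction_right ip_star)
qed

end

section \<open>Quotients by closed ideals\<close>

text \<open>Geometric steps have tails of size 2 * 2^(-n). This is the form in which Cauchy
  sequences are lifted through a quotient map.\<close>

lemma (in normed_space) fast_Cauchy_nlim:
  assumes "norm_complete V nrm" and f: "\<And>k. f k \<in> carrier V"
    and step: "\<And>k. nrm (f (Suc k) \<ominus> f k) \<le> (1/2) ^ k"
  obtains l where "nlim f l"
proof -
  have d: "nrm (f (n + k) \<ominus> f n) \<le> 2 * ((1/2) ^ n - (1/2) ^ (n + k))" for n k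
  proof (induction k)
    case (Suc k)
    then show ?case
      using nrm_minus_triangle[of "f (Suc (n + k))" "f (n + k)" "f n"] step[of "n + k"] f by simp
  qed (simp add: minus_self f)
  have d': "nrm (f m \<ominus> f n) \<le> 2 * (1/2) ^ n" if "n \<le> m" for m n
    using order_trans[OF d[of n "m - n"], of "2 * (1/2) ^ n"] that by simp
  show thesis
  proof (rule nlim_exists[OF assms(1) f])
    fix e :: real assume e: "0 < e"
    obtain n where n: "(1/2) ^ n < e / 4" using real_arch_pow_inv[of "e/4" "1/2"] e by auto
    have "nrm (f m \<ominus> f k) < e" if "m \<ge> n" "k \<ge> n" for m k
      using nrm_minus_triangle[of "f m" "f n" "f k"] nrm_minus_commute[of "f k" "f n"]
        d'[OF that(1)] d'[OF that(2)] n f by simp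
    then show "\<exists>N. \<forall>m\<ge>N. \<forall>k\<ge>N. nrm (f m \<ominus> f k) < e" by blast
  qed (rule that)
qed

section \<open>Approximate units and the quotient norm\<close>

locale closed_ideal = unital_cstar_algebra A + ideal I A
  for A :: "'a cstar" (structure) and I +
  assumes closed: "closedin (cstar_topology A) I"
begin

lemma I_zero [simp]: "\<zero> \<in> I" and I_add: "\<lbrakk>x \<in> I; y \<in> I\<rbrakk> \<Longrightarrow> x \<oplus> y \<in> I"
  by (simp_all add: a_closed additive_subgroup.zero_closed[OF additive_subgroup_axioms])

lemma I_limit:
  assumes "x \<in> carrier A" "\<And>e. 0 < e \<Longrightarrow> \<exists>w\<in>I. cnorm A (x \<ominus> w) < e"
  shows "x \<in> I"
  using closed assms unfolding closedin_iff by blast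

text \<open>A ring ideal is a priori only an additive subgroup; scalars act as left multiplication
  by multiples of the unit.\<close>

lemma I_smult: "x \<in> I \<Longrightarrow> c \<odot> x \<in> I"
  using I_l_closed[of x "c \<odot> \<one>"] by (simp add: mult_smult_left mult_one_left)

text \<open>
  With $P = 1 - y^2$ a contraction, the Cesaro means $v$ of its powers satisfy
  $\|y^2 v\| = \|1 - P^n\|/n \le 2/n$.
\<close>

lemma approximate_unit:
  assumes y: "y \<in> I" "star A y = y" and e: "0 < e"
  obtains v where "v \<in> carrier A" "star A v = v" "cnorm A v \<le> 1" "\<one> \<ominus> v \<in> I" "cnorm A (y \<otimes> v) < e"
proof -
  define t where "t = cnorm A y + 1"
  have t: "0 < t" "cnorm A y \<le> t" using cnorm_nonneg[of y] y by (simp_all add: t_def)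
  define z where "z = complex_of_real (inverse t) \<odot> y"
  have z: "z \<in> I" "z \<in> carrier A" "star A z = z" using y by (simp_all add: z_def I_smult star_smult)
  have yz: "y = complex_of_real t \<odot> z" using y t by (simp add: z_def smult_smult)
  have "cnorm A z \<le> 1" unfolding z_def using t y by (intro cnorm_rescale_le_1) simp_all
  define h where "h = z \<otimes> z"
  have h: "h \<in> I" "h \<in> carrier A" "star A h = h" using z by (simp_all add: h_def I_l_closed star_mult)
  have "cnorm A h \<le> 1"
    using \<open>cnorm A z \<le> 1\<close> cnorm_square[OF z(2,3)] cnorm_nonneg[OF z(2)] by (simp add: h_def power_le_one)
  define P where "P = \<one> \<ominus> h"
  have P: "P \<in> carrier A" "star A P = P" using h by (simp_all add: P_def star_minus)
  have P1: "cnorm A P \<le> 1"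
    unfolding P_def using \<open>cnorm A h \<le> 1\<close> pos_square[OF z(2,3)] by (intro cnorm_one_minus_pos) (simp_all add: h_def)
  \<comment> \<open>W n is 1 + P + ... + P^(n-1) and R n is P^n, so that h W n = (1 - P) W n
    telescopes to 1 - R n.\<close>
  define W where "W = rec_nat \<zero> (\<lambda>_ w. \<one> \<oplus> P \<otimes> w)"
  define R where "R = rec_nat \<one> (\<lambda>_ w. P \<otimes> w)"
  have W0: "W 0 = \<zero>" and WS: "W (Suc n) = \<one> \<oplus> P \<otimes> W n" for n by (simp_all add: W_def)
  have R0: "R 0 = \<one>" and RS: "R (Suc n) = P \<otimes> R n" for n by (simp_all add: R_def)
  have Wc [simp]: "W n \<in> carrier A" for n by (induction n) (simp_all add: W0 WS P)
  have Rc [simp]: "R n \<in> carrier A" for n by (induction n) (simp_all add: R0 RS P)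
  have comm: "P \<otimes> W n = W n \<otimes> P" for n
  proof (induction n)
    case (Suc n)
    then show ?case
      using P(1) by (simp add: WS mult_add_left mult_add_right mult_one_left mult_one_right mult_assoc
          flip: Suc)
  qed (simp add: W0 P)
  have Ws: "star A (W n) = W n" for n
    by (induction n) (use P in \<open>simp_all add: W0 WS star_add star_mult comm\<close>)
  have Wn: "cnorm A (W n) \<le> real n" for n
  proof (induction n)
    case (Suc n)
    have "cnorm A (W (Suc n)) \<le> cnorm A \<one> + cnorm A P * cnorm A (W n)"
      using cnorm_triangle[of \<one> "P \<otimes> W n"] cnorm_mult[of P "W n"] P by (simp add: WS)
    also have "\<dots> \<le> 1 + 1 * real n"
      using Suc P1 cnorm_one_le by (intro add_mono mult_mono) (simp_all add: cnorm_nonneg)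
    finally show ?case by simp
  qed (simp add: W0)
  have Rn: "cnorm A (R n) \<le> 1" for n
  proof (induction n)
    case (Suc n)
    have "cnorm A (R (Suc n)) \<le> cnorm A P * cnorm A (R n)" using cnorm_mult[of P "R n"] P by (simp add: RS)
    also have "\<dots> \<le> 1 * 1" using Suc P1 by (intro mult_mono) (simp_all add: cnorm_nonneg)
    finally show ?case by simp
  qed (simp add: R0 cnorm_one_le)
  have hP: "h = \<one> \<ominus> P" using h by (simp add: P_def cstar_ring_simps)
  have hW: "h \<otimes> W n = \<one> \<ominus> R n" for n
  proof (induction n)
    case (Suc n)
    have "h \<otimes> P = P \<otimes> h" using h by (simp add: P_def cstar_ring_simps)
    then have "h \<otimes> W (Suc n) = h \<oplus> P \<otimes> (h \<otimes> W n)"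
      using h P by (simp add: WS mult_add_right mult_one_right mult_assoc[symmetric])
    also have "\<dots> = (\<one> \<ominus> P) \<oplus> (P \<ominus> R (Suc n))"
      using P by (simp add: Suc RS mult_minus_right mult_one_right hP[symmetric])
    finally show ?case using P by (simp add: minus_split[symmetric])
  qed (use h in \<open>simp add: W0 R0 minus_self\<close>)
  \<comment> \<open>Modulo I the element P is 1, so the n summands of W n add up to n.\<close>
  have WI: "of_nat n \<odot> \<one> \<ominus> W n \<in> I" for n
  proof (induction n)
    case (Suc n)
    have "of_nat (Suc n) \<odot> \<one> \<ominus> W (Suc n) = (\<one> \<oplus> of_nat n \<odot> \<one>) \<ominus> (\<one> \<oplus> P \<otimes> W n)"
      by (simp add: WS smult_add_left)
    also have "\<dots> = of_nat n \<odot> \<one> \<ominus> P \<otimes> W n" using P by (simp add: minus_add_distrib minus_self)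
    also have "\<dots> = (of_nat n \<odot> \<one> \<ominus> W n) \<oplus> (W n \<ominus> P \<otimes> W n)" using P by (intro minus_split) simp_all
    also have "W n \<ominus> P \<otimes> W n = h \<otimes> W n" using P by (simp add: hP mult_minus_left mult_one_left)
    finally show ?case using Suc h by (simp add: I_add I_r_closed)
  qed (simp add: W0 M.minus_eq M.r_neg)
  \<comment> \<open>Ensures 2/n < (e/t)^2. Here 2/n bounds |hv|, hence |zv|^2, and t accounts for
    the rescaling of y to z.\<close>
  obtain n where n: "0 < n" "2 * (t/e)\<^sup>2 < real n"
    by (metis gr0I reals_Archimedean2 of_nat_0 not_less zero_le_power2 mult_nonneg_nonneg zero_le_numeral)
  define v where "v = complex_of_real (inverse (real n)) \<odot> W n"
  have v: "v \<in> carrier A" "star A v = v" by (simp_all add: v_def star_smult Ws)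
  have v1: "cnorm A v \<le> 1" unfolding v_def using Wn n by (intro cnorm_rescale_le_1) simp_all
  have "complex_of_real (inverse (real n)) \<odot> (of_nat n \<odot> \<one> \<ominus> W n) = \<one> \<ominus> v"
    using n by (simp add: smult_minus_right smult_smult v_def)
  then have vI: "\<one> \<ominus> v \<in> I" using I_smult[OF WI[of n]] by metis
  have "h \<otimes> v = complex_of_real (inverse (real n)) \<odot> (\<one> \<ominus> R n)"
    using h by (simp add: v_def mult_smult_right hW)
  then have "cnorm A (h \<otimes> v) = inverse (real n) * cnorm A (\<one> \<ominus> R n)"
    by (simp add: cnorm_smult norm_inverse)
  also have "\<dots> \<le> inverse (real n) * 2"
    using nrm_minus_le[of \<one> "R n"] Rn[of n] cnorm_one_le by (intro mult_left_mono) simp_all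
  finally have hv: "cnorm A (h \<otimes> v) \<le> inverse (real n) * 2" .
  have "(cnorm A (z \<otimes> v))\<^sup>2 = cnorm A (v \<otimes> (h \<otimes> v))"
    using cstar_identity[of "z \<otimes> v"] z v by (simp add: star_mult mult_assoc h_def)
  also have "\<dots> \<le> 1 * cnorm A (h \<otimes> v)"
    using cnorm_mult[of v "h \<otimes> v"] mult_right_mono[OF v1 cnorm_nonneg[of "h \<otimes> v"]] v h by simp
  finally have "(cnorm A (z \<otimes> v))\<^sup>2 \<le> inverse (real n) * 2" using hv by simp
  also have "\<dots> < (e / t)\<^sup>2"
    using n t e by (simp add: power_divide field_simps)
  finally have "cnorm A (z \<otimes> v) < e / t" by (rule power2_less_imp_less) (use t e in simp)
  then have "cnorm A (y \<otimes> v) < e"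
    using t z v by (simp add: yz mult_smult_left cnorm_smult field_simps)
  then show thesis using that v v1 vI by blast
qed

text \<open>Take v for y = x^* x, which lies in I. Then (1 - v)x^* lies in I and differs from x^* by
  the adjoint of xv, where |xv|^2 <= |yv| is arbitrarily small; I is closed.\<close>

lemma I_star:
  assumes x: "x \<in> I"
  shows "star A x \<in> I"
proof -
  have xc: "x \<in> carrier A" using x by simp
  let ?y = "star A x \<otimes> x"
  have y: "?y \<in> I" "star A ?y = ?y" using x by (simp_all add: I_l_closed star_mult)
  have "\<exists>w\<in>I. cnorm A (star A x \<ominus> w) < e" if e: "0 < e" for e
  proof -
    have "0 < e\<^sup>2" using e by simp
    then obtain v where v: "v \<in> carrier A" "star A v = v" "cnorm A v \<le> 1" "\<one> \<ominus> v \<in> I" "cnorm A (?y \<otimes> v) < e\<^sup>2"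
      using approximate_unit[OF y] by blast
    have "(cnorm A (x \<otimes> v))\<^sup>2 = cnorm A (v \<otimes> (?y \<otimes> v))"
      using cstar_identity[of "x \<otimes> v"] xc v by (simp add: star_mult mult_assoc)
    also have "\<dots> \<le> 1 * cnorm A (?y \<otimes> v)"
      using cnorm_mult[of v "?y \<otimes> v"] mult_right_mono[OF v(3) cnorm_nonneg[of "?y \<otimes> v"]] v xc by simp
    finally have "(cnorm A (x \<otimes> v))\<^sup>2 < e\<^sup>2" using v(5) by simp
    then have "cnorm A (x \<otimes> v) < e" by (rule power2_less_imp_less) (use e in simp)
    moreover have "star A x \<ominus> (\<one> \<ominus> v) \<otimes> star A x = star A (x \<otimes> v)"
      using xc v by (simp add: star_mult cstar_ring_simps)
    moreover have "(\<one> \<ominus> v) \<otimes> star A x \<in> I" using v(4) xc by (simp add: I_r_closed)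
    ultimately have "(\<one> \<ominus> v) \<otimes> star A x \<in> I \<and> cnorm A (star A x \<ominus> (\<one> \<ominus> v) \<otimes> star A x) < e"
      using cnorm_star[of "x \<otimes> v"] xc v(1) by simp
    then show ?thesis by blast
  qed
  then show ?thesis by (rule I_limit[OF star_closed[OF xc]])
qed

text \<open>A function of elements rather than of cosets, because the quotient is first built on
  representatives.\<close>

definition quot_norm :: "'a \<Rightarrow> real"
  where "quot_norm x = (INF i\<in>I. cnorm A (x \<oplus> i))"

lemma quot_norm_le: "\<lbrakk>x \<in> carrier A; i \<in> I\<rbrakk> \<Longrightarrow> quot_norm x \<le> cnorm A (x \<oplus> i)"
  unfolding quot_norm_def by (intro cINF_lower bdd_belowI2[of _ 0]) (simp_all add: cnorm_nonneg)

lemma quot_norm_greatest: "(\<And>i. i \<in> I \<Longrightarrow> a \<le> cnorm A (x \<oplus> i)) \<Longrightarrow> a \<le> quot_norm x"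
  unfolding quot_norm_def by (rule cINF_greatest) (use I_zero in blast)+

lemma quot_norm_nonneg: "x \<in> carrier A \<Longrightarrow> 0 \<le> quot_norm x"
  by (rule quot_norm_greatest) (simp add: cnorm_nonneg)

lemma quot_norm_le_cnorm: "x \<in> carrier A \<Longrightarrow> quot_norm x \<le> cnorm A x"
  using quot_norm_le[of x \<zero>] by simp

lemma quot_norm_approx:
  assumes "x \<in> carrier A" "quot_norm x < a"
  shows "\<exists>i\<in>I. cnorm A (x \<oplus> i) < a"
  using assms quot_norm_greatest[of a x] by (meson not_le)

lemma quot_norm_eq_zero: "x \<in> carrier A \<Longrightarrow> quot_norm x = 0 \<longleftrightarrow> x \<in> I"
proof
  assume x: "x \<in> carrier A" and z: "quot_norm x = 0"
  have "\<exists>y\<in>I. cnorm A (x \<ominus> y) < e" if e: "0 < e" for e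
  proof -
    obtain i where i: "i \<in> I" "cnorm A (x \<oplus> i) < e" using quot_norm_approx[OF x, of e] z e by auto
    then show ?thesis using x I_smult[of i "- 1"]
      by (intro bexI[of _ "(- 1) \<odot> i"]) (simp_all add: M.minus_eq minus_as_smult smult_smult)
  qed
  then show "x \<in> I" by (rule I_limit[OF x])
next
  assume x: "x \<in> carrier A" and i: "x \<in> I"
  have "x \<oplus> (- 1) \<odot> x = \<zero>" using x by (simp add: minus_as_smult[symmetric] M.r_neg)
  then have "quot_norm x \<le> 0" using quot_norm_le[OF x I_smult[OF i, of "- 1"]] by simp
  then show "quot_norm x = 0" using quot_norm_nonneg[OF x] by simp
qed

lemma quot_norm_triangle:
  assumes x: "x \<in> carrier A" and y: "y \<in> carrier A"
  shows "quot_norm (x \<oplus> y) \<le> quot_norm x + quot_norm y"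
proof -
  have "quot_norm (x \<oplus> y) \<le> cnorm A (x \<oplus> i) + cnorm A (y \<oplus> j)" if "i \<in> I" "j \<in> I" for i j
  proof -
    have "(x \<oplus> y) \<oplus> (i \<oplus> j) = (x \<oplus> i) \<oplus> (y \<oplus> j)" using that x y by (simp add: M.a_ac)
    then show ?thesis
      using quot_norm_le[of "x \<oplus> y" "i \<oplus> j"] cnorm_triangle[of "x \<oplus> i" "y \<oplus> j"] that x y
      by (simp add: I_add)
  qed
  then have "quot_norm (x \<oplus> y) - cnorm A (x \<oplus> i) \<le> quot_norm y" if "i \<in> I" for i
    using that by (intro quot_norm_greatest) (simp add: algebra_simps)
  then have "quot_norm (x \<oplus> y) - quot_norm y \<le> quot_norm x"
    by (intro quot_norm_greatest) (simp add: algebra_simps)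
  then show ?thesis by simp
qed

text \<open>Moves the infimum past the factor a. For a = 0 the bounds on the coset say only b <= 0,
  and the disjunction covers that case.\<close>

lemma quot_norm_scale_greatest:
  assumes "0 \<le> a" "x \<in> carrier A" "b \<le> 0 \<or> a \<noteq> 0" "\<And>i. i \<in> I \<Longrightarrow> b \<le> a * cnorm A (x \<oplus> i)"
  shows "b \<le> a * quot_norm x"
proof (cases "a = 0")
  case False
  then have "b / a \<le> quot_norm x" using assms by (intro quot_norm_greatest) (simp add: field_simps)
  then show ?thesis using False assms(1) by (simp add: field_simps)
qed (use assms in simp)

lemma quot_norm_smult:
  assumes x: "x \<in> carrier A"
  shows "quot_norm (c \<odot> x) = cmod c * quot_norm x"
proof -
  have le: "quot_norm (c \<odot> x) \<le> cmod c * quot_norm x" if "x \<in> carrier A" for c x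
  proof (rule quot_norm_scale_greatest[OF _ that])
    show "quot_norm (c \<odot> x) \<le> 0 \<or> cmod c \<noteq> 0" using that quot_norm_eq_zero[of \<zero>] by (cases "c = 0") auto
    show "quot_norm (c \<odot> x) \<le> cmod c * cnorm A (x \<oplus> i)" if i: "i \<in> I" for i
      using quot_norm_le[of "c \<odot> x" "c \<odot> i"] i \<open>x \<in> carrier A\<close> cnorm_smult[of "x \<oplus> i" c]
      by (simp add: I_smult smult_add_right)
  qed simp
  show ?thesis
  proof (cases "c = 0")
    case True
    then show ?thesis using x quot_norm_eq_zero[of \<zero>] by simp
  next
    case False
    have "quot_norm (inverse c \<odot> (c \<odot> x)) \<le> cmod (inverse c) * quot_norm (c \<odot> x)" using x by (intro le) simp
    then have "quot_norm x \<le> inverse (cmod c) * quot_norm (c \<odot> x)"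
      using x False by (simp add: smult_smult norm_inverse)
    then have "cmod c * quot_norm x \<le> quot_norm (c \<odot> x)" using False by (simp add: field_simps)
    then show ?thesis using le[OF x, of c] by linarith
  qed
qed

lemma quot_norm_mult:
  assumes x: "x \<in> carrier A" and y: "y \<in> carrier A"
  shows "quot_norm (x \<otimes> y) \<le> quot_norm x * quot_norm y"
proof -
  have le: "quot_norm (x \<otimes> y) \<le> cnorm A (x \<oplus> i) * cnorm A (y \<oplus> j)" if "i \<in> I" "j \<in> I" for i j
  proof -
    have "(x \<oplus> i) \<otimes> (y \<oplus> j) = x \<otimes> y \<oplus> (x \<otimes> j \<oplus> i \<otimes> (y \<oplus> j))"
      using that x y by (simp add: mult_add_left mult_add_right M.a_ac)
    moreover have "x \<otimes> j \<oplus> i \<otimes> (y \<oplus> j) \<in> I" using that x y by (intro I_add I_l_closed I_r_closed) simp_all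
    ultimately show ?thesis
      using quot_norm_le[of "x \<otimes> y" "x \<otimes> j \<oplus> i \<otimes> (y \<oplus> j)"] cnorm_mult[of "x \<oplus> i" "y \<oplus> j"] that x y by simp
  qed
  have le2: "quot_norm (x \<otimes> y) \<le> cnorm A (x \<oplus> i) * quot_norm y" if i: "i \<in> I" for i
  proof (rule quot_norm_scale_greatest[OF _ y _ le[OF i]])
    show "quot_norm (x \<otimes> y) \<le> 0 \<or> cnorm A (x \<oplus> i) \<noteq> 0" using le[OF i I_zero] by auto
  qed (use x i in \<open>simp_all add: cnorm_nonneg\<close>)
  have "quot_norm (x \<otimes> y) \<le> quot_norm y * quot_norm x"
  proof (rule quot_norm_scale_greatest[OF _ x])
    show "quot_norm (x \<otimes> y) \<le> 0 \<or> quot_norm y \<noteq> 0" using le2[OF I_zero] by auto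
    show "quot_norm (x \<otimes> y) \<le> quot_norm y * cnorm A (x \<oplus> i)" if "i \<in> I" for i
      using le2[OF that] by (simp add: mult.commute)
  qed (use y quot_norm_nonneg in simp)
  then show ?thesis by (simp add: mult.commute)
qed

lemma quot_norm_star_le: "x \<in> carrier A \<Longrightarrow> quot_norm (star A x) \<le> quot_norm x"
proof (rule quot_norm_greatest)
  fix i assume x: "x \<in> carrier A" and i: "i \<in> I"
  then show "quot_norm (star A x) \<le> cnorm A (x \<oplus> i)"
    using quot_norm_le[of "star A x" "star A i"] I_star[OF i] cnorm_star[of "x \<oplus> i"] by (simp add: star_add)
qed

lemma quot_norm_star: "x \<in> carrier A \<Longrightarrow> quot_norm (star A x) = quot_norm x"
  using quot_norm_star_le[of x] quot_norm_star_le[of "star A x"] by simp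

text \<open>The hard direction bounds the square of the quotient norm of x by |x^* x + y| for y in
  I. If y is self-adjoint, choose v with |yv| small: xv is congruent to x modulo I, and |xv|^2 <=
  |(x^* x + y)v| + |yv|.\<close>

lemma quot_norm_cstar_identity:
  assumes x: "x \<in> carrier A"
  shows "quot_norm (star A x \<otimes> x) = (quot_norm x)\<^sup>2"
proof (rule antisym)
  show "quot_norm (star A x \<otimes> x) \<le> (quot_norm x)\<^sup>2"
    using quot_norm_mult[of "star A x" x] x by (simp add: quot_norm_star power2_eq_square)
  let ?xx = "star A x \<otimes> x"
  have xx: "?xx \<in> carrier A" "star A ?xx = ?xx" using x by (simp_all add: star_mult)
  have sa: "(quot_norm x)\<^sup>2 \<le> cnorm A (?xx \<oplus> y)" if y: "y \<in> I" "star A y = y" for y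
  proof (rule field_le_epsilon)
    fix e :: real assume "0 < e"
    then obtain v where v: "v \<in> carrier A" "star A v = v" "cnorm A v \<le> 1" "\<one> \<ominus> v \<in> I" "cnorm A (y \<otimes> v) < e"
      using approximate_unit[OF y] by blast
    have "x \<oplus> (- 1) \<odot> (x \<otimes> (\<one> \<ominus> v)) = x \<otimes> v"
      using x v by (simp add: minus_as_smult[symmetric] cstar_ring_simps)
    then have "quot_norm x \<le> cnorm A (x \<otimes> v)"
      using quot_norm_le[of x "(- 1) \<odot> (x \<otimes> (\<one> \<ominus> v))"] x v(4) by (simp add: I_smult I_l_closed)
    then have "(quot_norm x)\<^sup>2 \<le> (cnorm A (x \<otimes> v))\<^sup>2" using quot_norm_nonneg[OF x] by (rule power_mono)
    also have "\<dots> = cnorm A (v \<otimes> (?xx \<otimes> v))"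
      using cstar_identity[of "x \<otimes> v"] x v by (simp add: star_mult mult_assoc)
    also have "\<dots> = cnorm A (v \<otimes> (((?xx \<oplus> y) \<otimes> v) \<ominus> y \<otimes> v))"
      using x v y by (simp add: mult_add_left M.minus_eq M.a_assoc M.r_neg)
    also have "\<dots> \<le> cnorm A v * cnorm A (((?xx \<oplus> y) \<otimes> v) \<ominus> y \<otimes> v)"
      using x v y by (intro cnorm_mult) simp_all
    also have "\<dots> \<le> 1 * cnorm A (((?xx \<oplus> y) \<otimes> v) \<ominus> y \<otimes> v)"
      using v(3) x v y by (intro mult_right_mono) (simp_all add: cnorm_nonneg)
    also have "\<dots> \<le> cnorm A ((?xx \<oplus> y) \<otimes> v) + cnorm A (y \<otimes> v)"
      using nrm_minus_le[of "(?xx \<oplus> y) \<otimes> v" "y \<otimes> v"] x v y by simp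
    also have "\<dots> \<le> cnorm A (?xx \<oplus> y) * 1 + e"
    proof (rule add_mono)
      have "cnorm A ((?xx \<oplus> y) \<otimes> v) \<le> cnorm A (?xx \<oplus> y) * cnorm A v"
        using x v y by (intro cnorm_mult) simp_all
      also have "\<dots> \<le> cnorm A (?xx \<oplus> y) * 1"
        using v(3) x y by (intro mult_left_mono) (simp_all add: cnorm_nonneg)
      finally show "cnorm A ((?xx \<oplus> y) \<otimes> v) \<le> cnorm A (?xx \<oplus> y) * 1" .
    qed (use v(5) in simp)
    finally show "(quot_norm x)\<^sup>2 \<le> cnorm A (?xx \<oplus> y) + e" by simp
  qed
  show "(quot_norm x)\<^sup>2 \<le> quot_norm ?xx"
  proof (rule quot_norm_greatest)
    fix y assume y: "y \<in> I"
    \<comment> \<open>Passing to the real part of x^* x + y does not increase the norm and replaces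
      y by a self-adjoint element of I, to which \<open>sa\<close> applies.\<close>
    let ?y = "(1/2) \<odot> (y \<oplus> star A y)"
    have yI: "?y \<in> I" "star A ?y = ?y"
      using y I_star[OF y] by (simp_all add: I_add I_smult star_smult star_add M.a_comm)
    have "?xx \<oplus> ?y = (1/2) \<odot> ((?xx \<oplus> y) \<oplus> star A (?xx \<oplus> y))"
    proof -
      have "(?xx \<oplus> y) \<oplus> star A (?xx \<oplus> y) = (?xx \<oplus> ?xx) \<oplus> (y \<oplus> star A y)"
        using xx y by (simp add: star_add M.a_ac)
      moreover have "(1/2) \<odot> (?xx \<oplus> ?xx) = ?xx"
        using xx smult_add_left[of ?xx "1/2" "1/2"] by (simp add: smult_add_right)
      ultimately show ?thesis using x y by (simp add: smult_add_right)
    qed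
    then have "cnorm A (?xx \<oplus> ?y) \<le> 1/2 * (cnorm A (?xx \<oplus> y) + cnorm A (star A (?xx \<oplus> y)))"
      using cnorm_triangle[of "?xx \<oplus> y" "star A (?xx \<oplus> y)"] xx y by (simp add: cnorm_smult)
    also have "\<dots> = cnorm A (?xx \<oplus> y)" using cnorm_star[of "?xx \<oplus> y"] xx y by simp
    finally show "(quot_norm x)\<^sup>2 \<le> cnorm A (?xx \<oplus> y)" using sa[OF yI] by simp
  qed
qed

end

text \<open>Independent of a model of the quotient: every axiom of B is transported along the
  surjection h, and the norm of B is prescribed by \<open>quot_norm\<close>.\<close>

locale closed_ideal_quotient = closed_ideal A I
  for A :: "'a cstar" (structure) and I +
  fixes B :: "'b cstar" and h :: "'a \<Rightarrow> 'b"
  assumes h_surj: "h ` carrier A = carrier B"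
    and h_add: "\<lbrakk>x \<in> carrier A; y \<in> carrier A\<rbrakk> \<Longrightarrow> h x \<oplus>\<^bsub>B\<^esub> h y = h (x \<oplus> y)"
    and h_mult: "\<lbrakk>x \<in> carrier A; y \<in> carrier A\<rbrakk> \<Longrightarrow> h x \<otimes>\<^bsub>B\<^esub> h y = h (x \<otimes> y)"
    and h_smult: "x \<in> carrier A \<Longrightarrow> c \<odot>\<^bsub>B\<^esub> h x = h (c \<odot> x)"
    and h_star: "x \<in> carrier A \<Longrightarrow> star B (h x) = h (star A x)"
    and h_zero: "\<zero>\<^bsub>B\<^esub> = h \<zero>" and h_one: "\<one>\<^bsub>B\<^esub> = h \<one>"
    and h_eq: "\<lbrakk>x \<in> carrier A; y \<in> carrier A\<rbrakk> \<Longrightarrow> h x = h y \<longleftrightarrow> x \<ominus> y \<in> I"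
    and h_norm: "x \<in> carrier A \<Longrightarrow> cnorm B (h x) = quot_norm x"
begin

lemma h_closed: "x \<in> carrier A \<Longrightarrow> h x \<in> carrier B"
  using h_surj by blast

lemma h_cases: assumes "b \<in> carrier B" obtains x where "x \<in> carrier A" "b = h x"
  using assms h_surj by blast

lemmas h_simps = h_add h_mult h_smult h_star h_zero h_one h_closed

lemma module_quotient: "Module.module complex_field B"
proof (rule moduleI[OF cring_complex_field])
  show "abelian_group B"
  proof (rule abelian_groupI)
    fix b assume "b \<in> carrier B"
    then obtain x where x: "x \<in> carrier A" "b = h x" by (rule h_cases)
    then have "h (\<ominus> x) \<oplus>\<^bsub>B\<^esub> b = \<zero>\<^bsub>B\<^esub>" by (simp add: h_simps M.l_neg)
    then show "\<exists>y\<in>carrier B. y \<oplus>\<^bsub>B\<^esub> b = \<zero>\<^bsub>B\<^esub>" using x h_closed by blast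
  qed (auto elim!: h_cases simp: h_simps M.a_ac)
qed (auto elim!: h_cases simp: h_simps smult_add_left smult_add_right smult_smult)

lemma h_kernel: "x \<in> carrier A \<Longrightarrow> h x = h \<zero> \<longleftrightarrow> x \<in> I"
  using h_eq[of x \<zero>] minus_as_smult[of \<zero>] by (simp add: M.minus_eq)

lemma normed_space_quotient: "normed_space B (cnorm B)"
proof -
  interpret B: Module.module complex_field B by (rule module_quotient)
  show ?thesis
    by unfold_locales
      (auto elim!: h_cases simp: h_simps h_norm quot_norm_nonneg quot_norm_eq_zero h_kernel
        quot_norm_triangle quot_norm_smult)
qed

lemma h_minus: "\<lbrakk>x \<in> carrier A; y \<in> carrier A\<rbrakk> \<Longrightarrow> h x \<ominus>\<^bsub>B\<^esub> h y = h (x \<ominus> y)"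
proof -
  interpret B: normed_space B "cnorm B" by (rule normed_space_quotient)
  show "\<lbrakk>x \<in> carrier A; y \<in> carrier A\<rbrakk> \<Longrightarrow> h x \<ominus>\<^bsub>B\<^esub> h y = h (x \<ominus> y)"
    by (simp add: B.M.minus_eq B.minus_as_smult h_simps M.minus_eq minus_as_smult)
qed

text \<open>The quotient norm is an infimum over a coset, so a strict bound on it is met by some
  representative.\<close>

lemma h_lift:
  assumes "x \<in> carrier A" "b \<in> carrier B" "cnorm B (b \<ominus>\<^bsub>B\<^esub> h x) < e"
  shows "\<exists>y\<in>carrier A. h y = b \<and> cnorm A (y \<ominus> x) < e"
proof -
  obtain z where z: "z \<in> carrier A" "b = h z" using assms(2) by (rule h_cases)
  have "quot_norm (z \<ominus> x) < e" using assms z by (simp add: h_minus h_norm)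
  then obtain i where i: "i \<in> I" "cnorm A ((z \<ominus> x) \<oplus> i) < e"
    using quot_norm_approx[of "z \<ominus> x" e] z assms(1) by auto
  have "(z \<oplus> i) \<ominus> x = (z \<ominus> x) \<oplus> i" "(z \<oplus> i) \<ominus> z = i"
    using z(1) i(1) assms(1) by (simp_all add: cstar_ring_simps)
  then show ?thesis
    using i z h_eq[of "z \<oplus> i" z] by (intro bexI[of _ "z \<oplus> i"]) simp_all
qed

text \<open>A subsequence with geometric steps is lifted term by term to a sequence with geometric
  steps in A. The image of its limit is the limit of the subsequence, hence of the whole Cauchy
  sequence.\<close>

lemma complete_quotient: "norm_complete B (cnorm B)"
proof -
  interpret B: normed_space B "cnorm B" by (rule normed_space_quotient)
  show ?thesis unfolding B.norm_complete_iff
  proof (intro allI impI)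
    fix f :: "nat \<Rightarrow> 'b" assume f: "\<forall>k. f k \<in> carrier B"
      and C: "\<forall>e>0. \<exists>N. \<forall>m\<ge>N. \<forall>k\<ge>N. cnorm B (f m \<ominus>\<^bsub>B\<^esub> f k) < e"
    have "\<exists>N. \<forall>m\<ge>N. \<forall>k\<ge>N. cnorm B (f m \<ominus>\<^bsub>B\<^esub> f k) < (1/2) ^ j" for j :: nat
      using C by simp
    then obtain N where N: "\<And>j m k. \<lbrakk>m \<ge> N j; k \<ge> N j\<rbrakk> \<Longrightarrow> cnorm B (f m \<ominus>\<^bsub>B\<^esub> f k) < (1/2) ^ j"
      by metis
    \<comment> \<open>Partial sums make both r j and r (Suc j) at least N j, whatever the order of
      the N i.\<close>
    define r where "r j = (\<Sum>i\<le>j. N i)" for j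
    have r: "N j \<le> r j" "N j \<le> r (Suc j)" for j
    proof -
      show "N j \<le> r j" for j unfolding r_def by (rule member_le_sum) auto
      then show "N j \<le> r (Suc j)" for j by (simp add: r_def trans_le_add1)
    qed
    have "\<exists>x. \<forall>j. (x j \<in> carrier A \<and> h (x j) = f (r j)) \<and> cnorm A (x (Suc j) \<ominus> x j) < (1/2) ^ j"
    proof (rule dependent_nat_choice)
      show "\<exists>x. x \<in> carrier A \<and> h x = f (r 0)" using f h_cases by metis
      show "\<exists>y. (y \<in> carrier A \<and> h y = f (r (Suc j))) \<and> cnorm A (y \<ominus> x) < (1/2) ^ j"
        if x: "x \<in> carrier A \<and> h x = f (r j)" for x j
      proof -
        have "cnorm B (f (r (Suc j)) \<ominus>\<^bsub>B\<^esub> h x) < (1/2) ^ j" using N[OF r(2) r(1)] x by simp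
        then show ?thesis using h_lift[of x "f (r (Suc j))"] f x by blast
      qed
    qed
    then obtain x where x: "\<And>j. x j \<in> carrier A" "\<And>j. h (x j) = f (r j)"
      and step: "\<And>j. cnorm A (x (Suc j) \<ominus> x j) < (1/2) ^ j" by blast
    obtain l where l: "nlim x l"
      using fast_Cauchy_nlim[OF complete x(1) less_imp_le[OF step]] by blast
    have lc: "l \<in> carrier A" using l by (rule nlim_closed)
    have xl: "cnorm B (f (r j) \<ominus>\<^bsub>B\<^esub> h l) \<le> cnorm A (x j \<ominus> l)" for j
      using quot_norm_le_cnorm[of "x j \<ominus> l"] x(1)[of j] lc by (simp add: x(2)[symmetric] h_minus h_norm)
    have "\<exists>k0. \<forall>k\<ge>k0. cnorm B (f k \<ominus>\<^bsub>B\<^esub> h l) < e" if e: "0 < e" for e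
    proof -
      have "\<forall>\<^sub>F j in sequentially. cnorm A (x j \<ominus> l) < e/2"
        using l e order_tendstoD(2)[of "\<lambda>j. cnorm A (x j \<ominus> l)" 0 sequentially "e/2"]
        unfolding nlim_def by linarith
      then obtain j0 where j0: "\<And>j. j \<ge> j0 \<Longrightarrow> cnorm A (x j \<ominus> l) < e/2"
        by (auto simp: eventually_sequentially)
      obtain j1 where j1: "(1/2) ^ j1 < e/2" using real_arch_pow_inv[of "e/2" "1/2"] e by auto
      define j where "j = max j0 j1"
      have pw: "(1/2) ^ j \<le> (1/2::real) ^ j1" and jj: "j0 \<le> j"
        by (auto intro!: power_decreasing simp: j_def)
      have "cnorm B (f k \<ominus>\<^bsub>B\<^esub> h l) < e" if "k \<ge> N j" for k
        using B.nrm_minus_triangle[OF f[rule_format, of k] f[rule_format, of "r j"] h_closed[OF lc]]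
          N[OF that r(1)] xl[of j] j0[OF jj] j1 pw by linarith
      then show ?thesis by blast
    qed
    then show "\<exists>l\<in>carrier B. (\<lambda>k. cnorm B (f k \<ominus>\<^bsub>B\<^esub> l)) \<longlonglongrightarrow> 0"
      using h_closed[OF lc] B.nrm_nonneg f by (intro bexI[of _ "h l"]) (simp_all add: LIMSEQ_iff)
  qed
qed

lemma quotient_cstar: "unital_cstar_algebra B"
proof -
  interpret B: Module.module complex_field B by (rule module_quotient)
  show ?thesis
  proof unfold_locales
    show "norm_complete B (cnorm B)" by (rule complete_quotient)
  qed (auto elim!: h_cases simp: h_simps h_norm quot_norm_nonneg quot_norm_eq_zero h_kernel
        quot_norm_triangle quot_norm_smult quot_norm_mult quot_norm_cstar_identity mult_assoc
        mult_add_left mult_add_right mult_smult_left mult_smult_right star_add star_smult star_mult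
        mult_one_left mult_one_right)
qed

lemma quotient_star_hom: "h \<in> star_hom A B"
  by (rule star_homI) (simp_all add: h_simps)

end

section \<open>Two models of the quotient: representatives and cosets\<close>

context closed_ideal
begin

text \<open>
  A system of representatives carries the quotient structure on the type of the algebra itself, to
  which the universal property of the relative Cuntz--Pimsner algebra is restricted.
\<close>

definition rep :: "'a \<Rightarrow> 'a"
  where "rep x = (SOME y. y \<in> carrier A \<and> x \<ominus> y \<in> I)"

lemma rep: "x \<in> carrier A \<Longrightarrow> rep x \<in> carrier A" "x \<in> carrier A \<Longrightarrow> x \<ominus> rep x \<in> I"
proof -
  assume x: "x \<in> carrier A"
  have "rep x \<in> carrier A \<and> x \<ominus> rep x \<in> I"
    unfolding rep_def by (rule someI[of "\<lambda>y. y \<in> carrier A \<and> x \<ominus> y \<in> I" x]) (simp add: minus_self x)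
  then show "rep x \<in> carrier A" "x \<ominus> rep x \<in> I" by auto
qed

lemma congI_sym: "\<lbrakk>x \<in> carrier A; y \<in> carrier A; x \<ominus> y \<in> I\<rbrakk> \<Longrightarrow> y \<ominus> x \<in> I"
  using I_smult[of "x \<ominus> y" "- 1"] minus_minus_swap[of x y] minus_as_smult[of "x \<ominus> y"] by simp

lemma congI_trans: "\<lbrakk>x \<in> carrier A; y \<in> carrier A; z \<in> carrier A; x \<ominus> y \<in> I; y \<ominus> z \<in> I\<rbrakk> \<Longrightarrow> x \<ominus> z \<in> I"
  using I_add[of "x \<ominus> y" "y \<ominus> z"] minus_split[of x y z] by simp

text \<open>For congruent elements the predicates under \<open>SOME\<close> coincide, so the same
  element is chosen.\<close>

lemma rep_eq_iff:
  assumes "x \<in> carrier A" "y \<in> carrier A"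
  shows "rep x = rep y \<longleftrightarrow> x \<ominus> y \<in> I"
proof
  assume "rep x = rep y"
  then show "x \<ominus> y \<in> I"
    using rep[OF assms(1)] rep[OF assms(2)] assms congI_trans[of x "rep x" y] congI_sym[of y "rep y"] by simp
next
  assume xy: "x \<ominus> y \<in> I"
  have "y \<ominus> z \<in> I \<longleftrightarrow> x \<ominus> z \<in> I" if "z \<in> carrier A" for z
    using assms that xy congI_trans[of x y z] congI_trans[of y x z] congI_sym[of x y] by blast
  then have "(\<lambda>z. z \<in> carrier A \<and> x \<ominus> z \<in> I) = (\<lambda>z. z \<in> carrier A \<and> y \<ominus> z \<in> I)" by blast
  then show "rep x = rep y" unfolding rep_def by simp
qed

definition rep_quotient :: "'a cstar"
  where "rep_quotient = \<lparr>carrier = rep ` carrier A, monoid.mult = (\<lambda>x y. rep (x \<otimes> y)), one = rep \<one>,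
    zero = rep \<zero>, add = (\<lambda>x y. rep (x \<oplus> y)), smult = (\<lambda>c x. rep (c \<odot> x)),
    star = (\<lambda>x. rep (star A x)), cnorm = quot_norm\<rparr>"

lemma cong_add: "\<lbrakk>x \<in> carrier A; y \<in> carrier A; x' \<in> carrier A; y' \<in> carrier A; x \<ominus> x' \<in> I; y \<ominus> y' \<in> I\<rbrakk>
    \<Longrightarrow> (x \<oplus> y) \<ominus> (x' \<oplus> y') \<in> I"
  by (simp add: minus_add_distrib I_add)

lemma cong_mult:
  assumes "x \<in> carrier A" "y \<in> carrier A" "x' \<in> carrier A" "y' \<in> carrier A" "x \<ominus> x' \<in> I" "y \<ominus> y' \<in> I"
  shows "(x \<otimes> y) \<ominus> (x' \<otimes> y') \<in> I"
proof -
  have "(x \<otimes> y) \<ominus> (x' \<otimes> y') = (x \<ominus> x') \<otimes> y \<oplus> x' \<otimes> (y \<ominus> y')"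
    using assms minus_split[of "x \<otimes> y" "x' \<otimes> y" "x' \<otimes> y'"] by (simp add: mult_minus_left mult_minus_right)
  then show ?thesis using assms by (simp add: I_add I_l_closed I_r_closed)
qed

lemma cong_smult: "\<lbrakk>x \<in> carrier A; x' \<in> carrier A; x \<ominus> x' \<in> I\<rbrakk> \<Longrightarrow> c \<odot> x \<ominus> c \<odot> x' \<in> I"
  by (simp add: smult_minus_right[symmetric] I_smult)

lemma cong_star: "\<lbrakk>x \<in> carrier A; x' \<in> carrier A; x \<ominus> x' \<in> I\<rbrakk> \<Longrightarrow> star A x \<ominus> star A x' \<in> I"
  by (simp add: star_minus[symmetric] I_star)

lemma quot_norm_cong:
  assumes "x \<in> carrier A" "y \<in> carrier A" "x \<ominus> y \<in> I"
  shows "quot_norm x = quot_norm y"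
proof -
  have le: "quot_norm x \<le> quot_norm y" if "x \<in> carrier A" "y \<in> carrier A" "x \<ominus> y \<in> I" for x y
    using quot_norm_triangle[of "x \<ominus> y" y] quot_norm_eq_zero[of "x \<ominus> y"] that by (simp add: add_minus_cancel)
  show ?thesis using le[OF assms] le[OF assms(2,1) congI_sym[OF assms]] by simp
qed

lemma rep_quotient: "closed_ideal_quotient A I rep_quotient rep"
proof unfold_locales
  note R = rep congI_sym[OF _ rep(1) rep(2)]
  fix x y c assume x: "x \<in> carrier A" and y: "y \<in> carrier A"
  show "rep x \<oplus>\<^bsub>rep_quotient\<^esub> rep y = rep (x \<oplus> y)"
    using x y by (simp add: rep_quotient_def rep_eq_iff R cong_add)
  show "rep x \<otimes>\<^bsub>rep_quotient\<^esub> rep y = rep (x \<otimes> y)"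
    using x y by (simp add: rep_quotient_def rep_eq_iff R cong_mult)
next
  note R = rep congI_sym[OF _ rep(1) rep(2)]
  fix x c assume x: "x \<in> carrier A"
  show "c \<odot>\<^bsub>rep_quotient\<^esub> rep x = rep (c \<odot> x)"
    using x by (simp add: rep_quotient_def rep_eq_iff R cong_smult)
  show "star rep_quotient (rep x) = rep (star A x)"
    using x by (simp add: rep_quotient_def rep_eq_iff R cong_star)
  show "cnorm rep_quotient (rep x) = quot_norm x"
    using x quot_norm_cong[of "rep x" x] by (simp add: rep_quotient_def R)
qed (simp_all add: rep_eq_iff, simp_all add: rep_quotient_def)

lemma coset_eq_iff: "\<lbrakk>x \<in> carrier A; y \<in> carrier A\<rbrakk> \<Longrightarrow> I +> x = I +> y \<longleftrightarrow> x \<ominus> y \<in> I"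
  using U.quotient_eq_iff_same_a_r_cos[OF ideal_axioms] by simp

lemma coset_mem:
  assumes "x \<in> carrier A" "y \<in> I +> x"
  shows "y \<in> carrier A" "y \<ominus> x \<in> I"
proof -
  obtain i where i: "i \<in> I" "y = i \<oplus> x" using assms(2) by (auto simp: a_r_coset_def')
  show "y \<in> carrier A" using i assms(1) by simp
  have "y \<ominus> x = i" using i assms(1) by (simp add: M.minus_eq M.a_assoc M.r_neg)
  then show "y \<ominus> x \<in> I" using i by simp
qed

text \<open>\<open>cstar_quot\<close> defines scalar multiplication and star as unions over a coset.
  For an operation that respects congruence all members of the union are equal.\<close>

lemma coset_UN:
  assumes x: "x \<in> carrier A" and g: "\<And>y. y \<in> carrier A \<Longrightarrow> g y \<in> carrier A"
    and cong: "\<And>y. \<lbrakk>y \<in> carrier A; y \<ominus> x \<in> I\<rbrakk> \<Longrightarrow> g y \<ominus> g x \<in> I"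
  shows "(\<Union>y\<in>I +> x. I +> g y) = I +> g x"
proof -
  have "I +> g y = I +> g x" if "y \<in> I +> x" for y
    using coset_mem[OF x that] coset_eq_iff[of "g y" "g x"] g x cong by simp
  moreover have "x \<in> I +> x" using x by (rule a_rcos_self)
  ultimately show ?thesis by blast
qed

text \<open>Carries the isomorphism obtained on representatives over to the crossed product, whose
  elements are cosets.\<close>

lemma coset_map_iso: "(\<lambda>x. I +> x) \<in> star_iso rep_quotient (cstar_quot A I)"
proof -
  have c: "I +> rep x = I +> x" if "x \<in> carrier A" for x
    using that rep congI_sym by (simp add: coset_eq_iff)
  have carr: "carrier (cstar_quot A I) = (\<lambda>x. I +> x) ` carrier A"
    by (auto simp: cstar_quot_def FactRing_def A_RCOSETS_def')
  show ?thesis unfolding star_iso_def mem_Collect_eq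
  proof
    show "(\<lambda>x. I +> x) \<in> star_hom rep_quotient (cstar_quot A I)"
    proof (rule star_homI)
      fix x y c assume x: "x \<in> carrier rep_quotient" and y: "y \<in> carrier rep_quotient"
      have xA: "x \<in> carrier A" and yA: "y \<in> carrier A" using x y rep by (auto simp: rep_quotient_def)
      show "I +> x \<in> carrier (cstar_quot A I)" using xA carr by blast
      show "I +> (x \<oplus>\<^bsub>rep_quotient\<^esub> y) = (I +> x) \<oplus>\<^bsub>cstar_quot A I\<^esub> (I +> y)"
        using xA yA by (simp add: rep_quotient_def cstar_quot_def FactRing_def c a_rcos_sum)
      show "I +> (x \<otimes>\<^bsub>rep_quotient\<^esub> y) = (I +> x) \<otimes>\<^bsub>cstar_quot A I\<^esub> (I +> y)"
        using xA yA by (simp add: rep_quotient_def cstar_quot_def FactRing_def c rcoset_mult_add)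
      show "I +> (star rep_quotient x) = star (cstar_quot A I) (I +> x)"
        using xA by (simp add: rep_quotient_def cstar_quot_def c coset_UN cong_star)
      show "I +> (c \<odot>\<^bsub>rep_quotient\<^esub> x) = c \<odot>\<^bsub>cstar_quot A I\<^esub> (I +> x)"
        using xA by (simp add: rep_quotient_def cstar_quot_def c coset_UN cong_smult)
    qed
    show "bij_betw (\<lambda>x. I +> x) (carrier rep_quotient) (carrier (cstar_quot A I))"
      unfolding bij_betw_def
    proof
      show "inj_on (\<lambda>x. I +> x) (carrier rep_quotient)"
        by (rule inj_onI) (auto simp: rep_quotient_def c coset_eq_iff rep_eq_iff)
      show "(\<lambda>x. I +> x) ` carrier rep_quotient = carrier (cstar_quot A I)"
        by (auto simp: carr rep_quotient_def c image_image)
    qed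
  qed
qed

end

lemma (in unital_cstar_algebra) closed_ideal_generated:
  assumes "G \<subseteq> carrier A"
  shows "closed_ideal A (closed_ideal_generated A G)" and "G \<subseteq> closed_ideal_generated A G"
    and "\<lbrakk>ideal J A; closedin (cstar_topology A) J; G \<subseteq> J\<rbrakk> \<Longrightarrow> closed_ideal_generated A G \<subseteq> J"
proof -
  let ?F = "{I. ideal I A \<and> closedin (cstar_topology A) I \<and> G \<subseteq> I}"
  have "carrier A \<in> ?F"
    using assms U.oneideal by (auto simp: closedin_iff)
  then have ne: "?F \<noteq> {}" by blast
  have "ideal (\<Inter>?F) A" using ne by (intro U.i_Intersect) auto
  moreover have "closedin (cstar_topology A) (\<Inter>?F)" using ne by (intro closedin_Inter) auto
  ultimately show "closed_ideal A (closed_ideal_generated A G)"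
    unfolding closed_ideal_generated_def
    by (intro closed_ideal.intro closed_ideal_axioms.intro unital_cstar_algebra_axioms)
  show "G \<subseteq> closed_ideal_generated A G" by (auto simp: closed_ideal_generated_def)
  show "\<lbrakk>ideal J A; closedin (cstar_topology A) J; G \<subseteq> J\<rbrakk> \<Longrightarrow> closed_ideal_generated A G \<subseteq> J"
    by (auto simp: closed_ideal_generated_def)
qed

section \<open>Toeplitz representations and compact operators\<close>

lemma nlim_linear:
  assumes "normed_space V nV" "normed_space W nW" "linear_map V W f"
    and bound: "\<And>x. x \<in> carrier V \<Longrightarrow> nW (f x) \<le> c * nV x" and lim: "normed_space.nlim V nV g x"
  shows "normed_space.nlim W nW (\<lambda>k. f (g k)) (f x)"
proof -
  interpret V: normed_space V nV by fact
  interpret W: normed_space W nW by fact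
  note f = linear_mapD[OF assms(3)] and fm = linear_map_minus(1)[OF assms(3,1,2)]
  note g = V.nlim_closed[OF lim]
  show ?thesis
  proof (rule W.nlimI)
    show "nW (f (g k) \<ominus>\<^bsub>W\<^esub> f x) \<le> c * nV (g k \<ominus>\<^bsub>V\<^esub> x)" for k
      using bound[of "g k \<ominus>\<^bsub>V\<^esub> x"] g by (simp add: fm)
    show "(\<lambda>k. c * nV (g k \<ominus>\<^bsub>V\<^esub> x)) \<longlonglongrightarrow> 0"
      using lim by (simp add: V.nlim_def tendsto_mult_right_zero)
  qed (use f g in auto)
qed

lemma (in cstar_algebra) cstar_subalgebra:
  assumes D: "submodule D complex_field A" "closedin (cstar_topology A) D"
    and mult: "\<And>x y. \<lbrakk>x \<in> D; y \<in> D\<rbrakk> \<Longrightarrow> x \<otimes> y \<in> D" and star: "\<And>x. x \<in> D \<Longrightarrow> star A x \<in> D"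
  shows "cstar_algebra (A\<lparr>carrier := D\<rparr>)"
proof -
  note sub = submoduleD[OF D(1)]
  have c: "x \<in> D \<Longrightarrow> x \<in> carrier A" for x using sub(1) by blast
  interpret D: Module.module complex_field "A\<lparr>carrier := D\<rparr>"
    by (rule submodule.submodule_is_module[OF D(1)]) (rule module_axioms)
  \<comment> \<open>Additive inverses in a record depend on its carrier, so those of the subalgebra
    are first identified with those of A.\<close>
  have minus: "x \<ominus>\<^bsub>A\<lparr>carrier := D\<rparr>\<^esub> y = x \<ominus> y" if "x \<in> D" "y \<in> D" for x y
  proof -
    have y: "(- 1) \<odot> y \<in> D" using sub(4)[of "- 1" y] that by simp
    have "\<ominus>\<^bsub>A\<lparr>carrier := D\<rparr>\<^esub> y = (- 1) \<odot> y"
      by (rule D.M.minus_equality) (use that y c in \<open>simp_all add: minus_as_smult[symmetric] M.l_neg\<close>)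
    then show ?thesis using that c D.M.minus_eq[of x y] M.minus_eq[of x y] by (simp add: minus_as_smult)
  qed
  have ns: "normed_space (A\<lparr>carrier := D\<rparr>) (cnorm A)"
    by unfold_locales (auto dest: c intro: cnorm_triangle simp: cnorm_nonneg cnorm_eq_zero cnorm_smult)
  interpret N: normed_space "A\<lparr>carrier := D\<rparr>" "cnorm A" by (rule ns)
  have "norm_complete (A\<lparr>carrier := D\<rparr>) (cnorm A)"
    unfolding N.norm_complete_iff
  proof (intro allI impI)
    fix f :: "nat \<Rightarrow> 'a" assume f: "\<forall>k. f k \<in> carrier (A\<lparr>carrier := D\<rparr>)"
      and C: "\<forall>e>0. \<exists>N. \<forall>m\<ge>N. \<forall>k\<ge>N. cnorm A (f m \<ominus>\<^bsub>A\<lparr>carrier := D\<rparr>\<^esub> f k) < e"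
    have fD: "f k \<in> D" for k using f by simp
    have fA: "f k \<in> carrier A" for k using fD c by blast
    have C': "\<exists>N. \<forall>m\<ge>N. \<forall>k\<ge>N. cnorm A (f m \<ominus> f k) < e" if "0 < e" for e
      using C that fD by (simp add: minus)
    obtain l where l: "nlim f l" using nlim_exists[OF complete fA C'] by blast
    have "l \<in> D" by (rule nlim_in_closed[OF l D(2) fD])
    then show "\<exists>l\<in>carrier (A\<lparr>carrier := D\<rparr>). (\<lambda>k. cnorm A (f k \<ominus>\<^bsub>A\<lparr>carrier := D\<rparr>\<^esub> l)) \<longlonglongrightarrow> 0"
      using l fD by (intro bexI[of _ l]) (simp_all add: minus nlim_def)
  qed
  then show ?thesis
    by unfold_locales
      (simp_all add: c mult star cnorm_triangle cnorm_mult mult_assoc mult_add_left mult_add_right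
        mult_smult_left mult_smult_right star_add star_smult star_mult cnorm_nonneg cnorm_eq_zero
        cnorm_smult cstar_identity)
qed

lemma (in unital_hilbert_module) nlim_raction:
  assumes "X.nlim f x" "a \<in> carrier A"
  shows "X.nlim (\<lambda>k. raction X (f k) a) (raction X x a)"
  by (rule nlim_linear[OF X.normed_space_axioms X.normed_space_axioms _ _ assms(1), of _ "cnorm A a"])
    (use assms hn_raction in \<open>auto simp: linear_map_def raction_add_left raction_smult_left mult.commute\<close>)

lemma (in unital_hilbert_module) nlim_ip:
  assumes "X.nlim f x" "X.nlim g y"
  shows "A.nlim (\<lambda>k. ip X (f k) (g k)) (ip X x y)"
proof (rule A.nlimI)
  note c = X.nlim_closed[OF assms(1)] X.nlim_closed[OF assms(2)]
  show "ip X (f k) (g k) \<in> carrier A" "ip X x y \<in> carrier A" for k using c by simp_all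
  show "cnorm A (ip X (f k) (g k) \<ominus>\<^bsub>A\<^esub> ip X x y)
      \<le> hn (f k \<ominus>\<^bsub>X\<^esub> x) * hn (g k) + hn x * hn (g k \<ominus>\<^bsub>X\<^esub> y)" for k
    using A.nrm_minus_triangle[of "ip X (f k) (g k)" "ip X x (g k)" "ip X x y"] c
      Cauchy_Schwarz[of "f k \<ominus>\<^bsub>X\<^esub> x" "g k"] Cauchy_Schwarz[of x "g k \<ominus>\<^bsub>X\<^esub> y"]
    by (simp add: ip_minus_left ip_minus_right)
  have "(\<lambda>k. hn (f k \<ominus>\<^bsub>X\<^esub> x) * hn (g k) + hn x * hn (g k \<ominus>\<^bsub>X\<^esub> y)) \<longlonglongrightarrow> 0 * hn y + hn x * 0"
    using assms by (intro tendsto_intros X.nlim_nrm[OF assms(2)]) (simp_all add: X.nlim_def)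
  then show "(\<lambda>k. hn (f k \<ominus>\<^bsub>X\<^esub> x) * hn (g k) + hn x * hn (g k \<ominus>\<^bsub>X\<^esub> y)) \<longlonglongrightarrow> 0" by simp
qed

lemma (in unital_hilbert_module) nlim_adjointable:
  assumes "F \<in> carrier (adjointables A X)" "X.nlim f x"
  shows "X.nlim (\<lambda>k. F (f k)) (F x)"
  by (rule nlim_linear[OF X.normed_space_axioms X.normed_space_axioms _ _ assms(2), of _ "opnorm F"])
    (use assms opnorm_bound in \<open>auto simp: linear_map_def adjointable_add adjointable_smult\<close>)

text \<open>An isometric \<pi> makes \<psi> isometric, since |\<psi> x|^2 = |\<pi> <x,x>|. So \<psi>
  is injective with closed range, and operators on X can be read off from products with \<psi>
  m.\<close>

locale isometric_toeplitz = unital_hilbert_module A X + T: unital_cstar_algebra T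
  for A :: "'a cstar" and X :: "('a, 'm) hilbert_mod" and T :: "'b cstar" +
  fixes \<psi> :: "'m \<Rightarrow> 'b" and \<pi> :: "'a \<Rightarrow> 'b"
  assumes psi_linear: "linear_map X T \<psi>" and pi_hom: "\<pi> \<in> star_hom A T"
    and psi_raction: "\<lbrakk>x \<in> carrier X; a \<in> carrier A\<rbrakk> \<Longrightarrow> \<psi> (raction X x a) = \<psi> x \<otimes>\<^bsub>T\<^esub> \<pi> a"
    and psi_ip: "\<lbrakk>x \<in> carrier X; y \<in> carrier X\<rbrakk> \<Longrightarrow> star T (\<psi> x) \<otimes>\<^bsub>T\<^esub> \<psi> y = \<pi> (ip X x y)"
    and pi_isometric: "a \<in> carrier A \<Longrightarrow> cnorm T (\<pi> a) = cnorm A a"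
begin

lemmas psi = linear_mapD[OF psi_linear] and pih = star_homD[OF pi_hom]
lemmas psi_minus = linear_map_minus(1)[OF psi_linear X.normed_space_axioms T.normed_space_axioms]
  and pi_minus = linear_map_minus(1)[OF star_hom_linear[OF pi_hom] A.normed_space_axioms T.normed_space_axioms]

lemma psi_closed [simp]: "x \<in> carrier X \<Longrightarrow> \<psi> x \<in> carrier T" by (rule psi)

lemma psi_isometric: "x \<in> carrier X \<Longrightarrow> cnorm T (\<psi> x) = hn x"
proof -
  assume x: "x \<in> carrier X"
  have "(cnorm T (\<psi> x))\<^sup>2 = (hn x)\<^sup>2"
    using T.cstar_identity[of "\<psi> x"] x by (simp add: psi_ip pi_isometric hn_square)
  then show ?thesis using T.cnorm_nonneg[of "\<psi> x"] x by (simp add: power2_eq_iff_nonneg)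
qed

lemma psi_inj: "\<lbrakk>x \<in> carrier X; y \<in> carrier X; \<psi> x = \<psi> y\<rbrakk> \<Longrightarrow> x = y"
  using psi_isometric[of "x \<ominus>\<^bsub>X\<^esub> y"] psi_minus[of x y] hn_eq_zero[of "x \<ominus>\<^bsub>X\<^esub> y"]
  by (simp add: T.minus_self X.minus_eq_zero_iff)

lemma pi_inj: "\<lbrakk>x \<in> carrier A; y \<in> carrier A; \<pi> x = \<pi> y\<rbrakk> \<Longrightarrow> x = y"
  using pi_isometric[of "x \<ominus>\<^bsub>A\<^esub> y"] pi_minus[of x y] A.cnorm_eq_zero[of "x \<ominus>\<^bsub>A\<^esub> y"] pih(1)
  by (simp add: T.minus_self A.minus_eq_zero_iff)

lemma nlim_psi: "X.nlim f x \<Longrightarrow> T.nlim (\<lambda>k. \<psi> (f k)) (\<psi> x)"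
  by (rule nlim_linear[OF X.normed_space_axioms T.normed_space_axioms psi_linear, of 1])
    (simp_all add: psi_isometric)

text \<open>A relation, because several elements of T may induce the same operator; a redundancy is
  exactly such a coincidence. On the closed span of the products \<psi> x times the adjoint of
  \<psi> y it becomes a bijection with the compact operators.\<close>

definition act :: "'b \<Rightarrow> ('m \<Rightarrow> 'm) \<Rightarrow> bool"
  where "act k F \<longleftrightarrow> k \<in> carrier T \<and> F \<in> carrier (adjointables A X) \<and>
    (\<forall>m\<in>carrier X. k \<otimes>\<^bsub>T\<^esub> \<psi> m = \<psi> (F m))"

lemma actD: "act k F \<Longrightarrow> k \<in> carrier T" "act k F \<Longrightarrow> F \<in> carrier (adjointables A X)"
  "\<lbrakk>act k F; m \<in> carrier X\<rbrakk> \<Longrightarrow> k \<otimes>\<^bsub>T\<^esub> \<psi> m = \<psi> (F m)"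
  by (auto simp: act_def)

lemma act_unique: "\<lbrakk>act k F; act k G\<rbrakk> \<Longrightarrow> F = G"
  using actD by (intro adjointable_eqI psi_inj) (auto, metis)

lemma act_zero: "act \<zero>\<^bsub>T\<^esub> \<zero>\<^bsub>adjointables A X\<^esub>"
  using adjointables_closed(1) linear_map_minus(2)[OF psi_linear X.normed_space_axioms T.normed_space_axioms]
  by (simp add: act_def)

lemma act_add: "\<lbrakk>act k F; act l G\<rbrakk> \<Longrightarrow> act (k \<oplus>\<^bsub>T\<^esub> l) (F \<oplus>\<^bsub>adjointables A X\<^esub> G)"
  using adjointables_closed(2)[of F G] by (simp add: act_def T.mult_add_left psi)

lemma act_smult: "act k F \<Longrightarrow> act (c \<odot>\<^bsub>T\<^esub> k) (c \<odot>\<^bsub>adjointables A X\<^esub> F)"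
  using adjointables_closed(3)[of F c] by (simp add: act_def T.mult_smult_left psi)

lemma act_mult: "\<lbrakk>act k F; act l G\<rbrakk> \<Longrightarrow> act (k \<otimes>\<^bsub>T\<^esub> l) (F \<otimes>\<^bsub>adjointables A X\<^esub> G)"
  using adjointables_closed(4)[of F G] by (simp add: act_def T.mult_assoc compose_def)

text \<open>That the adjoint of k also maps the range of \<psi> into itself is part of the
  hypotheses; for elements of the span \<open>act_star_span\<close> provides it.\<close>

lemma act_star:
  assumes "act k F" "act (star T k) G"
  shows "star (adjointables A X) F = G"
proof (rule adjointable_star_eqI)
  fix x y assume x: "x \<in> carrier X" and y: "y \<in> carrier X"
  note F = actD[OF assms(1)] and G = actD[OF assms(2)]
  have "\<pi> (ip X (F x) y) = star T (k \<otimes>\<^bsub>T\<^esub> \<psi> x) \<otimes>\<^bsub>T\<^esub> \<psi> y"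
    using F x y by (simp add: psi_ip[symmetric])
  also have "\<dots> = star T (\<psi> x) \<otimes>\<^bsub>T\<^esub> (star T k \<otimes>\<^bsub>T\<^esub> \<psi> y)"
    using F(1) x y by (simp add: T.star_mult T.mult_assoc)
  also have "\<dots> = \<pi> (ip X x (G y))" using G x y by (simp add: psi_ip)
  finally show "ip X (F x) y = ip X x (G y)" using F G x y by (intro pi_inj) simp_all
qed (use actD assms in auto)

lemma act_rank_one:
  "\<lbrakk>x \<in> carrier X; y \<in> carrier X\<rbrakk> \<Longrightarrow> act (\<psi> x \<otimes>\<^bsub>T\<^esub> star T (\<psi> y)) (rank_one X x y)"
  using rank_one_adjointable(1)[of x y]
  by (simp add: act_def T.mult_assoc psi_ip) (simp add: rank_one_def psi_raction)

text \<open>Builds a finite sum of rank-one operators in parallel with the matching sum in T. It is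
  a relation since at this point the sum in T is not known to depend on the operator alone.\<close>

inductive fin_rank :: "('m \<Rightarrow> 'm) \<Rightarrow> 'b \<Rightarrow> bool" where
  zero: "fin_rank \<zero>\<^bsub>adjointables A X\<^esub> \<zero>\<^bsub>T\<^esub>"
| step: "\<lbrakk>fin_rank F k; x \<in> carrier X; y \<in> carrier X\<rbrakk>
    \<Longrightarrow> fin_rank (F \<oplus>\<^bsub>adjointables A X\<^esub> rank_one X x y) (k \<oplus>\<^bsub>T\<^esub> \<psi> x \<otimes>\<^bsub>T\<^esub> star T (\<psi> y))"

lemma fin_rank_act: "fin_rank F k \<Longrightarrow> act k F"
  by (induction rule: fin_rank.induct) (simp_all only: act_zero act_add act_rank_one)

lemma fin_rank_closed: "fin_rank F k \<Longrightarrow> k \<in> carrier T" "fin_rank F k \<Longrightarrow> F \<in> carrier (adjointables A X)"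
  using fin_rank_act actD by blast+

lemma fin_rank_rank_one:
  assumes "x \<in> carrier X" "y \<in> carrier X"
  shows "fin_rank (rank_one X x y) (\<psi> x \<otimes>\<^bsub>T\<^esub> star T (\<psi> y))"
  using fin_rank.step[OF fin_rank.zero assms] rank_one_adjointable(1)[OF assms] assms
  by (simp only: L.M.l_zero T.M.l_zero T.mult_closed T.star_closed psi_closed)

lemma fin_rank_add:
  assumes "fin_rank G l" "fin_rank F k"
  shows "fin_rank (F \<oplus>\<^bsub>adjointables A X\<^esub> G) (k \<oplus>\<^bsub>T\<^esub> l)"
  using assms
proof (induction rule: fin_rank.induct)
  case zero
  then show ?case using fin_rank_closed[OF zero] by (simp only: L.M.r_zero T.M.r_zero)
next
  case (step G l x y)
  note c = fin_rank_closed[OF step.prems] fin_rank_closed[OF step.hyps(1)]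
  have "fin_rank ((F \<oplus>\<^bsub>adjointables A X\<^esub> G) \<oplus>\<^bsub>adjointables A X\<^esub> rank_one X x y)
      ((k \<oplus>\<^bsub>T\<^esub> l) \<oplus>\<^bsub>T\<^esub> \<psi> x \<otimes>\<^bsub>T\<^esub> star T (\<psi> y))"
    by (rule fin_rank.step[OF step.IH[OF step.prems] step.hyps(2,3)])
  then show ?case using c rank_one_adjointable(1)[OF step.hyps(2,3)] step.hyps(2,3)
    by (simp only: L.M.a_assoc T.M.a_assoc T.mult_closed T.star_closed psi_closed)
qed

text \<open>G composed with the rank-one operator of x, y is that of G x, y, and l (\<psi> x) =
  \<psi> (G x) on the side of T.\<close>

lemma fin_rank_mult_left:
  assumes "act l G" "fin_rank F k"
  shows "fin_rank (G \<otimes>\<^bsub>adjointables A X\<^esub> F) (l \<otimes>\<^bsub>T\<^esub> k)"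
  using assms(2)
proof (induction rule: fin_rank.induct)
  case zero
  note G = actD[OF assms(1)]
  have "G \<zero>\<^bsub>X\<^esub> = \<zero>\<^bsub>X\<^esub>" using adjointable_smult[OF G(2), of "\<zero>\<^bsub>X\<^esub>" 0] G(2) by simp
  then have "G \<otimes>\<^bsub>adjointables A X\<^esub> \<zero>\<^bsub>adjointables A X\<^esub> = \<zero>\<^bsub>adjointables A X\<^esub>"
    by (auto simp: compose_def intro!: restrict_ext)
  then show ?case using G(1) fin_rank.zero by (simp del: adjointables_simps)
next
  case (step F k x y)
  note G = actD[OF assms(1)] and c = fin_rank_closed[OF step.hyps(1)]
  note R = rank_one_adjointable(1)[OF step.hyps(2,3)]
  have Gx: "G x \<in> carrier X" using G(2) step.hyps by simp
  have GR: "G \<otimes>\<^bsub>adjointables A X\<^esub> rank_one X x y = rank_one X (G x) y"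
  proof (rule act_unique[OF act_mult[OF assms(1) act_rank_one[OF step.hyps(2,3)]]])
    show "act (l \<otimes>\<^bsub>T\<^esub> (\<psi> x \<otimes>\<^bsub>T\<^esub> star T (\<psi> y))) (rank_one X (G x) y)"
      using act_rank_one[OF Gx step.hyps(3)] G(1) step.hyps G(3)[OF step.hyps(2)]
      by (simp add: T.mult_assoc[symmetric])
  qed
  have "G \<otimes>\<^bsub>adjointables A X\<^esub> (F \<oplus>\<^bsub>adjointables A X\<^esub> rank_one X x y)
      = G \<otimes>\<^bsub>adjointables A X\<^esub> F \<oplus>\<^bsub>adjointables A X\<^esub> G \<otimes>\<^bsub>adjointables A X\<^esub> rank_one X x y"
    using G(2) c(2) R by (auto simp: compose_def adjointable_add intro!: restrict_ext)
  moreover have "l \<otimes>\<^bsub>T\<^esub> (k \<oplus>\<^bsub>T\<^esub> \<psi> x \<otimes>\<^bsub>T\<^esub> star T (\<psi> y)) = l \<otimes>\<^bsub>T\<^esub> k \<oplus>\<^bsub>T\<^esub> \<psi> (G x) \<otimes>\<^bsub>T\<^esub> star T (\<psi> y)"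
    using G c step.hyps by (simp add: T.mult_add_right T.mult_assoc[symmetric])
  ultimately show ?case using fin_rank.step[OF step.IH Gx step.hyps(3)] GR
    by (simp del: adjointables_simps)
qed

text \<open>A scalar is the operator c id, induced by c times the unit of T, so this is a left
  multiplication.\<close>

lemma fin_rank_smult: "fin_rank F k \<Longrightarrow> fin_rank (c \<odot>\<^bsub>adjointables A X\<^esub> F) (c \<odot>\<^bsub>T\<^esub> k)"
proof -
  assume f: "fin_rank F k"
  let ?G = "c \<odot>\<^bsub>adjointables A X\<^esub> (\<lambda>x\<in>carrier X. x)"
  have "(\<lambda>x\<in>carrier X. x) \<in> carrier (adjointables A X)" by (rule adjointableI[where G = "\<lambda>x. x"]) auto
  then have "act \<one>\<^bsub>T\<^esub> (\<lambda>x\<in>carrier X. x)" by (simp add: act_def T.mult_one_left)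
  then have "fin_rank (?G \<otimes>\<^bsub>adjointables A X\<^esub> F) ((c \<odot>\<^bsub>T\<^esub> \<one>\<^bsub>T\<^esub>) \<otimes>\<^bsub>T\<^esub> k)"
    by (intro fin_rank_mult_left[OF act_smult f])
  moreover have "?G \<otimes>\<^bsub>adjointables A X\<^esub> F = c \<odot>\<^bsub>adjointables A X\<^esub> F"
    using fin_rank_closed(2)[OF f] by (auto simp: compose_def intro!: restrict_ext)
  ultimately show ?thesis using fin_rank_closed(1)[OF f] by (simp add: T.mult_smult_left T.mult_one_left)
qed

lemma fin_rank_minus: "\<lbrakk>fin_rank F k; fin_rank G l\<rbrakk>
    \<Longrightarrow> fin_rank (F \<ominus>\<^bsub>adjointables A X\<^esub> G) (k \<ominus>\<^bsub>T\<^esub> l)"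
  using fin_rank_add[OF fin_rank_smult[of G l "- 1"], of F k] fin_rank_closed[of F k] fin_rank_closed[of G l]
  by (simp only: L.M.minus_eq T.M.minus_eq L.minus_as_smult T.minus_as_smult)

lemma fin_rank_star:
  assumes "fin_rank F k"
  shows "fin_rank (star (adjointables A X) F) (star T k)"
proof -
  have "\<exists>G. fin_rank G (star T k)"
    using assms
  proof (induction rule: fin_rank.induct)
    case zero
    then show ?case using fin_rank.zero by auto
  next
    case (step F k x y)
    then show ?case
      using fin_rank.step[of _ "star T k" y x] fin_rank_closed(1)[of F k]
      by (auto simp: T.star_add T.star_mult)
  qed
  then obtain G where G: "fin_rank G (star T k)" by blast
  then have "star (adjointables A X) F = G" using act_star[OF fin_rank_act[OF assms] fin_rank_act[OF G]] by simp
  then show ?thesis using G by simp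
qed

text \<open>Each summand of k becomes \<psi> (G x) times the adjoint of \<psi> y, of norm at most
  |G| |x| |y|. The sum of the |x| |y| serves as C and depends only on k.\<close>

lemma fin_rank_left_bound:
  assumes "fin_rank F k"
  obtains C where "0 \<le> C" "\<And>l G. act l G \<Longrightarrow> cnorm T (l \<otimes>\<^bsub>T\<^esub> k) \<le> C * opnorm G"
proof -
  have "\<exists>C\<ge>0. \<forall>l G. act l G \<longrightarrow> cnorm T (l \<otimes>\<^bsub>T\<^esub> k) \<le> C * opnorm G"
    using assms
  proof (induction rule: fin_rank.induct)
    case zero
    then show ?case by (intro exI[of _ 0]) (auto simp: act_def)
  next
    case (step F k x y)
    then obtain C where C: "C \<ge> 0" "\<And>l G. act l G \<Longrightarrow> cnorm T (l \<otimes>\<^bsub>T\<^esub> k) \<le> C * opnorm G" by blast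
    have "cnorm T (l \<otimes>\<^bsub>T\<^esub> (k \<oplus>\<^bsub>T\<^esub> \<psi> x \<otimes>\<^bsub>T\<^esub> star T (\<psi> y))) \<le> (C + hn x * hn y) * opnorm G"
      if a: "act l G" for l G
    proof -
      note G = actD[OF a] and k = fin_rank_closed(1)[OF step.hyps(1)]
      have "l \<otimes>\<^bsub>T\<^esub> (k \<oplus>\<^bsub>T\<^esub> \<psi> x \<otimes>\<^bsub>T\<^esub> star T (\<psi> y)) = l \<otimes>\<^bsub>T\<^esub> k \<oplus>\<^bsub>T\<^esub> \<psi> (G x) \<otimes>\<^bsub>T\<^esub> star T (\<psi> y)"
        using G k step.hyps by (simp add: T.mult_add_right T.mult_assoc[symmetric])
      then have "cnorm T (l \<otimes>\<^bsub>T\<^esub> (k \<oplus>\<^bsub>T\<^esub> \<psi> x \<otimes>\<^bsub>T\<^esub> star T (\<psi> y)))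
          \<le> cnorm T (l \<otimes>\<^bsub>T\<^esub> k) + cnorm T (\<psi> (G x)) * cnorm T (star T (\<psi> y))"
        using T.cnorm_triangle[of "l \<otimes>\<^bsub>T\<^esub> k" "\<psi> (G x) \<otimes>\<^bsub>T\<^esub> star T (\<psi> y)"]
          T.cnorm_mult[of "\<psi> (G x)" "star T (\<psi> y)"] G k step.hyps by simp
      also have "\<dots> \<le> C * opnorm G + (opnorm G * hn x) * hn y"
        using C(2)[OF a] opnorm_bound[OF G(2) step.hyps(2)] G step.hyps
        by (intro add_mono) (simp_all add: T.cnorm_star psi_isometric mult_right_mono)
      finally show ?thesis by (simp add: algebra_simps)
    qed
    then show ?case using C(1) step.hyps by (intro exI[of _ "C + hn x * hn y"]) simp
  qed
  then show thesis using that by blast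
qed

lemma opnorm_compose:
  assumes "F \<in> carrier (adjointables A X)" "G \<in> carrier (adjointables A X)" "opnorm F \<le> a" "opnorm G \<le> b"
  shows "opnorm (F \<otimes>\<^bsub>adjointables A X\<^esub> G) \<le> a * b"
proof (rule opnorm_le)
  have ab: "0 \<le> a" "0 \<le> b" using assms opnorm_nonneg order_trans by blast+
  then show "0 \<le> a * b" by simp
  show "hn ((F \<otimes>\<^bsub>adjointables A X\<^esub> G) x) \<le> a * b * hn x" if x: "x \<in> carrier X" for x
  proof -
    have "hn (F (G x)) \<le> opnorm F * hn (G x)" using assms x by (intro opnorm_bound) simp_all
    also have "\<dots> \<le> a * (b * hn x)"
      using assms x ab opnorm_bound[OF assms(2) x] mult_right_mono[OF assms(4), of "hn x"]
      by (intro mult_mono) auto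
    finally show ?thesis using x by (simp add: compose_def mult.assoc)
  qed
qed

text \<open>
  Since $\|h\|^{2^n} = \|h^{2^n - 1}h\| \le C\|D\|^{2^n - 1}$ with $C$ independent of $n$.
\<close>

lemma fin_rank_self_adjoint_norm:
  assumes f: "fin_rank D h" and sa: "star T h = h"
  shows "cnorm T h \<le> opnorm D"
proof (rule field_le_epsilon)
  fix e :: real assume e: "0 < e"
  \<comment> \<open>The summand e makes d positive, so that it may be divided by even if D is
    0.\<close>
  define d where "d = opnorm D + e"
  note c = fin_rank_closed[OF f]
  have d: "0 < d" "opnorm D \<le> d" using e opnorm_nonneg[OF c(2)] by (simp_all add: d_def)
  obtain C where C: "0 \<le> C" "\<And>l G. act l G \<Longrightarrow> cnorm T (l \<otimes>\<^bsub>T\<^esub> h) \<le> C * opnorm G"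
    using fin_rank_left_bound[OF f] by blast
  have id: "(\<lambda>x\<in>carrier X. x) \<in> carrier (adjointables A X)" by (rule adjointableI[where G = "\<lambda>x. x"]) auto
  then have act1: "act \<one>\<^bsub>T\<^esub> (\<lambda>x\<in>carrier X. x)" by (simp add: act_def T.mult_one_left)
  have id1: "opnorm (\<lambda>x\<in>carrier X. x) \<le> 1" by (rule opnorm_le) simp_all
  \<comment> \<open>H is h^(2^n) and E is h^(2^n - 1). The bound for the operator of E is multiplied
    by d to avoid the exponent 2^n - 1.\<close>
  define P where "P n H E \<longleftrightarrow> star T H = H \<and> cnorm T H = cnorm T h ^ (2^n) \<and> H = E \<otimes>\<^bsub>T\<^esub> h \<and>
    (\<exists>F. act H F \<and> opnorm F \<le> d ^ (2^n)) \<and> (\<exists>G. act E G \<and> opnorm G * d \<le> d ^ (2^n))" for n :: nat and H E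
  have "\<exists>H E. P n H E" for n
  proof (induction n)
    case 0
    have "P 0 h \<one>\<^bsub>T\<^esub>"
      unfolding P_def using sa c fin_rank_act[OF f] d act1 id1 by (auto simp: T.mult_one_left)
    then show ?case by blast
  next
    case (Suc n)
    then obtain H E F G where H: "star T H = H" "cnorm T H = cnorm T h ^ (2^n)" "H = E \<otimes>\<^bsub>T\<^esub> h"
      and F: "act H F" "opnorm F \<le> d ^ (2^n)" and G: "act E G" "opnorm G * d \<le> d ^ (2^n)"
      unfolding P_def by blast
    have HT: "H \<in> carrier T" and ET: "E \<in> carrier T" using actD F G by auto
    have "opnorm (F \<otimes>\<^bsub>adjointables A X\<^esub> F) \<le> d ^ (2^n) * d ^ (2^n)"
      using actD(2)[OF F(1)] F(2) by (intro opnorm_compose)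
    moreover have "opnorm (F \<otimes>\<^bsub>adjointables A X\<^esub> G) * d \<le> d ^ (2^n) * d ^ (2^n)"
    proof -
      have "opnorm (F \<otimes>\<^bsub>adjointables A X\<^esub> G) * d \<le> (d ^ (2^n) * opnorm G) * d"
        using actD(2)[OF F(1)] actD(2)[OF G(1)] F(2) d by (intro mult_right_mono opnorm_compose) simp_all
      also have "\<dots> \<le> d ^ (2^n) * d ^ (2^n)"
        using G(2) d by (simp add: mult.assoc)
      finally show ?thesis .
    qed
    moreover have "star T (H \<otimes>\<^bsub>T\<^esub> H) = H \<otimes>\<^bsub>T\<^esub> H" using HT H by (simp add: T.star_mult)
    moreover have "cnorm T (H \<otimes>\<^bsub>T\<^esub> H) = cnorm T h ^ (2 ^ Suc n)"
      using T.cnorm_square[OF HT H(1)] H(2) by (simp add: power_mult[symmetric] mult.commute)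
    moreover have "H \<otimes>\<^bsub>T\<^esub> H = (H \<otimes>\<^bsub>T\<^esub> E) \<otimes>\<^bsub>T\<^esub> h"
      using H(3) HT ET c(1) by (metis T.mult_assoc)
    moreover have "d ^ (2 ^ Suc n) = d ^ (2^n) * d ^ (2^n)" by (simp add: power_add[symmetric] mult_2)
    ultimately have "P (Suc n) (H \<otimes>\<^bsub>T\<^esub> H) (H \<otimes>\<^bsub>T\<^esub> E)"
      unfolding P_def using act_mult[OF F(1) F(1)] act_mult[OF F(1) G(1)] by metis
    then show ?case by blast
  qed
  then have b: "(cnorm T h / d) ^ (2^n) \<le> C / d" for n
  proof -
    obtain H E G where H: "cnorm T H = cnorm T h ^ (2^n)" "H = E \<otimes>\<^bsub>T\<^esub> h"
      and G: "act E G" "opnorm G * d \<le> d ^ (2^n)"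
      using \<open>\<And>n. \<exists>H E. P n H E\<close>[of n] unfolding P_def by blast
    have "cnorm T h ^ (2^n) * d \<le> C * opnorm G * d" using C(2)[OF G(1)] H d by simp
    also have "\<dots> \<le> C * d ^ (2^n)" using mult_left_mono[OF G(2) C(1)] by (simp add: mult.assoc)
    finally show ?thesis using d by (simp add: power_divide field_simps)
  qed
  have "cnorm T h / d \<le> 1"
  proof (rule ccontr)
    assume "\<not> ?thesis"
    then obtain n where "C / d < (cnorm T h / d) ^ n" using real_arch_pow[of "cnorm T h / d" "C/d"] by auto
    also have "\<dots> \<le> (cnorm T h / d) ^ (2^n)"
      using \<open>\<not> cnorm T h / d \<le> 1\<close> by (intro power_increasing) (simp_all add: less_imp_le)
    finally show False using b[of n] by simp
  qed
  then show "cnorm T h \<le> opnorm D + e" using d by (simp add: d_def field_simps)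
qed

lemma opnorm_star_le:
  assumes F: "F \<in> carrier (adjointables A X)"
  shows "opnorm (star (adjointables A X) F) \<le> opnorm F"
proof (rule opnorm_le[OF opnorm_nonneg[OF F]])
  fix x assume x: "x \<in> carrier X"
  let ?y = "star (adjointables A X) F x"
  have y: "?y \<in> carrier X" using star_adjointable(1)[OF F] x by simp
  have "(hn ?y)\<^sup>2 = cnorm A (ip X (F ?y) x)" using star_adjointable(2)[OF F y x] y by (simp add: hn_square)
  also have "\<dots> \<le> (opnorm F * hn ?y) * hn x"
    using Cauchy_Schwarz[of "F ?y" x] opnorm_bound[OF F y] F x y
    by (meson adjointable_closed hn_nonneg mult_right_mono order_trans)
  finally have le: "hn ?y * hn ?y \<le> (opnorm F * hn x) * hn ?y" by (simp add: power2_eq_square mult_ac)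
  show "hn ?y \<le> opnorm F * hn x"
  proof (cases "hn ?y = 0")
    case True
    then show ?thesis using opnorm_nonneg[OF F] x by simp
  next
    case False
    then have "0 < hn ?y" using hn_nonneg[OF y] by linarith
    then show ?thesis using le by simp
  qed
qed

text \<open>The pair F F^*, k k^* is again of finite rank and self-adjoint, so |k|^2 = |k k^*| is at
  most |F F^*|, hence at most |F|^2.\<close>

lemma fin_rank_norm:
  assumes f: "fin_rank F k"
  shows "cnorm T k \<le> opnorm F"
proof (rule power2_le_imp_le)
  note c = fin_rank_closed[OF f]
  let ?G = "star (adjointables A X) F"
  have "fin_rank (F \<otimes>\<^bsub>adjointables A X\<^esub> ?G) (k \<otimes>\<^bsub>T\<^esub> star T k)"
    by (rule fin_rank_mult_left[OF fin_rank_act[OF f] fin_rank_star[OF f]])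
  then have "cnorm T (k \<otimes>\<^bsub>T\<^esub> star T k) \<le> opnorm (F \<otimes>\<^bsub>adjointables A X\<^esub> ?G)"
    using c by (intro fin_rank_self_adjoint_norm) (simp_all add: T.star_mult del: adjointables_simps)
  also have "\<dots> \<le> opnorm F * opnorm F"
    using c star_adjointable(1)[OF c(2)] opnorm_star_le[OF c(2)] by (intro opnorm_compose) simp_all
  finally show "(cnorm T k)\<^sup>2 \<le> (opnorm F)\<^sup>2"
    using T.cstar_identity'[OF c(1)] by (simp add: power2_eq_square)
  show "0 \<le> opnorm F" by (rule opnorm_nonneg[OF c(2)])
qed

end

section \<open>Compact operators and the closed span of rank-one elements\<close>

context isometric_toeplitz
begin

text \<open>The algebra C of the overview, here for any isometric representation.\<close>

definition rank_one_span :: "'b set"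
  where "rank_one_span = closed_span T {\<psi> x \<otimes>\<^bsub>T\<^esub> star T (\<psi> y) | x y. x \<in> carrier X \<and> y \<in> carrier X}"

lemma rank_one_gens: "{\<psi> x \<otimes>\<^bsub>T\<^esub> star T (\<psi> y) | x y. x \<in> carrier X \<and> y \<in> carrier X} \<subseteq> carrier T"
  by auto

lemma rank_one_op_gens: "{rank_one X x y | x y. x \<in> carrier X \<and> y \<in> carrier X} \<subseteq> carrier (adjointables A X)"
  using rank_one_adjointable(1) by auto

lemmas span_facts = closed_span_facts[OF T.normed_space_axioms rank_one_gens, folded rank_one_span_def]
lemmas compacts_facts = closed_span_facts[OF L.normed_space_axioms rank_one_op_gens, folded compacts_def]
lemmas span_sub = T.submoduleD[OF span_facts(1)]
lemmas compacts_sub = L.submoduleD[OF compacts_facts(1)]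

lemma span_closed: "k \<in> rank_one_span \<Longrightarrow> k \<in> carrier T"
  using span_sub(1) by blast

lemma compacts_closed: "F \<in> compacts A X \<Longrightarrow> F \<in> carrier (adjointables A X)"
  using compacts_sub(1) by blast

lemma span_gen: "\<lbrakk>x \<in> carrier X; y \<in> carrier X\<rbrakk> \<Longrightarrow> \<psi> x \<otimes>\<^bsub>T\<^esub> star T (\<psi> y) \<in> rank_one_span"
  using span_facts(4) by blast

lemma compacts_gen: "\<lbrakk>x \<in> carrier X; y \<in> carrier X\<rbrakk> \<Longrightarrow> rank_one X x y \<in> compacts A X"
  using compacts_facts(4) by blast

lemma span_induct:
  assumes "submodule W complex_field T" "closedin (cstar_topology T) W"
    "\<And>x y. \<lbrakk>x \<in> carrier X; y \<in> carrier X\<rbrakk> \<Longrightarrow> \<psi> x \<otimes>\<^bsub>T\<^esub> star T (\<psi> y) \<in> W"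
  shows "rank_one_span \<subseteq> W"
  using assms by (intro span_facts(6)) auto

lemma fin_rank_in_span: "fin_rank F k \<Longrightarrow> F \<in> compacts A X \<and> k \<in> rank_one_span"
  by (induction rule: fin_rank.induct)
    (simp_all only: span_sub(2,3) compacts_sub(2,3) span_gen compacts_gen simp_thms)

lemma lin_span_fin_rank:
  assumes "k \<in> lin_span T {\<psi> x \<otimes>\<^bsub>T\<^esub> star T (\<psi> y) | x y. x \<in> carrier X \<and> y \<in> carrier X}"
  shows "\<exists>F. fin_rank F k"
proof -
  have "submodule {k. \<exists>F. fin_rank F k} complex_field T" (is "submodule ?W _ _")
  proof (rule T.submoduleI')
    show "?W \<subseteq> carrier T" using fin_rank_closed(1) by blast
    show "\<zero>\<^bsub>T\<^esub> \<in> ?W" using fin_rank.zero by blast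
    show "x \<oplus>\<^bsub>T\<^esub> y \<in> ?W" if "x \<in> ?W" "y \<in> ?W" for x y
      using that fin_rank_add unfolding mem_Collect_eq by blast
    show "c \<odot>\<^bsub>T\<^esub> x \<in> ?W" if "x \<in> ?W" for c x
      using that fin_rank_smult unfolding mem_Collect_eq by blast
  qed
  then have "lin_span T {\<psi> x \<otimes>\<^bsub>T\<^esub> star T (\<psi> y) | x y. x \<in> carrier X \<and> y \<in> carrier X} \<subseteq> ?W"
    by (rule T.lin_span_least) (auto intro: fin_rank_rank_one)
  then show ?thesis using assms by auto
qed

lemma lin_span_op_fin_rank:
  assumes "F \<in> lin_span (adjointables A X) {rank_one X x y | x y. x \<in> carrier X \<and> y \<in> carrier X}"
  shows "\<exists>k. fin_rank F k"
proof -
  have "submodule {F. \<exists>k. fin_rank F k} complex_field (adjointables A X)" (is "submodule ?W _ _")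
  proof (rule L.submoduleI')
    show "?W \<subseteq> carrier (adjointables A X)" using fin_rank_closed(2) by blast
    show "\<zero>\<^bsub>adjointables A X\<^esub> \<in> ?W" using fin_rank.zero by blast
    show "x \<oplus>\<^bsub>adjointables A X\<^esub> y \<in> ?W" if "x \<in> ?W" "y \<in> ?W" for x y
      using that fin_rank_add unfolding mem_Collect_eq by blast
    show "c \<odot>\<^bsub>adjointables A X\<^esub> x \<in> ?W" if "x \<in> ?W" for c x
      using that fin_rank_smult unfolding mem_Collect_eq by blast
  qed
  then have "lin_span (adjointables A X) {rank_one X x y | x y. x \<in> carrier X \<and> y \<in> carrier X} \<subseteq> ?W"
    by (rule L.lin_span_least) (auto intro: fin_rank_rank_one)
  then show ?thesis using assms by auto
qed

text \<open>F is a limit of finite-rank operators. By \<open>fin_rank_norm\<close> their partners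
  form a Cauchy sequence, whose limit acts as F.\<close>

lemma compacts_lift:
  assumes F: "F \<in> compacts A X"
  shows "\<exists>k\<in>rank_one_span. act k F"
proof -
  obtain f where f: "L.nlim f F" and "\<forall>n. f n \<in> lin_span (adjointables A X) {rank_one X x y | x y. x \<in> carrier X \<and> y \<in> carrier X}"
    using compacts_facts(5)[OF F] by blast
  then have "\<forall>n. \<exists>k. fin_rank (f n) k" using lin_span_op_fin_rank by blast
  then obtain g where g: "\<And>n. fin_rank (f n) (g n)" by metis
  have gc: "g n \<in> carrier T" and fc: "f n \<in> carrier (adjointables A X)" for n
    using fin_rank_closed[OF g] by auto
  have "\<exists>N. \<forall>m\<ge>N. \<forall>k\<ge>N. cnorm T (g m \<ominus>\<^bsub>T\<^esub> g k) < e" if "0 < e" for e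
    using L.nlim_Cauchy[OF f that] fin_rank_norm[OF fin_rank_minus[OF g g]] by (meson order_le_less_trans)
  then obtain k where k: "T.nlim g k" using T.nlim_exists[OF T.complete, of g] gc by blast
  have kc: "k \<in> carrier T" using k by (rule T.nlim_closed)
  have Fc: "F \<in> carrier (adjointables A X)" using F by (rule compacts_closed)
  have "k \<otimes>\<^bsub>T\<^esub> \<psi> m = \<psi> (F m)" if m: "m \<in> carrier X" for m
  proof -
    have "X.nlim (\<lambda>n. f n m) (F m)"
    proof (rule X.nlimI)
      show "hn (f n m \<ominus>\<^bsub>X\<^esub> F m) \<le> opnorm (f n \<ominus>\<^bsub>adjointables A X\<^esub> F) * hn m" for n
        using opnorm_bound[of "f n \<ominus>\<^bsub>adjointables A X\<^esub> F" m] fc Fc m by (simp add: adjointables_minus)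
      show "(\<lambda>n. opnorm (f n \<ominus>\<^bsub>adjointables A X\<^esub> F) * hn m) \<longlonglongrightarrow> 0"
        using f by (simp add: L.nlim_def tendsto_mult_left_zero)
    qed (use fc Fc m in auto)
    then have "T.nlim (\<lambda>n. \<psi> (f n m)) (\<psi> (F m))" by (rule nlim_psi)
    moreover have "(\<lambda>n. \<psi> (f n m)) = (\<lambda>n. g n \<otimes>\<^bsub>T\<^esub> \<psi> m)"
      using actD(3)[OF fin_rank_act[OF g] m] by simp
    moreover have "T.nlim (\<lambda>n. g n \<otimes>\<^bsub>T\<^esub> \<psi> m) (k \<otimes>\<^bsub>T\<^esub> \<psi> m)"
      using m by (intro T.nlim_mult k T.nlim_const) simp
    ultimately show ?thesis using T.nlim_unique by metis
  qed
  then have "act k F" using kc Fc by (simp add: act_def)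
  moreover have "k \<in> rank_one_span"
    using T.nlim_in_closed[OF k span_facts(2)] fin_rank_in_span[OF g] by blast
  ultimately show ?thesis by blast
qed

lemma span_star: "k \<in> rank_one_span \<Longrightarrow> star T k \<in> rank_one_span"
proof -
  have "rank_one_span \<subseteq> {k \<in> carrier T. star T k \<in> rank_one_span}" (is "_ \<subseteq> ?W")
  proof (rule span_induct)
    show "submodule ?W complex_field T"
      by (rule T.submoduleI') (use span_sub in \<open>auto simp: T.star_add T.star_smult\<close>)
    show "closedin (cstar_topology T) ?W"
    proof (rule T.closedinI)
      fix f l assume l: "T.nlim f l" and f: "\<And>k. f k \<in> ?W"
      have "star T l \<in> rank_one_span"
        by (rule T.nlim_in_closed[OF T.nlim_star[OF l] span_facts(2)]) (use f in auto)
      then show "l \<in> ?W" using T.nlim_closed(2)[OF l] by simp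
    qed auto
    show "\<psi> x \<otimes>\<^bsub>T\<^esub> star T (\<psi> y) \<in> ?W" if "x \<in> carrier X" "y \<in> carrier X" for x y
      using span_gen[of y x] that by (simp add: T.star_mult)
  qed
  then show "k \<in> rank_one_span \<Longrightarrow> star T k \<in> rank_one_span" by auto
qed

text \<open>k (\<psi> m) is a limit of elements \<psi> (f n m). As \<psi> is isometric the f n m are
  Cauchy, and X is complete.\<close>

lemma span_psi:
  assumes k: "k \<in> rank_one_span" and m: "m \<in> carrier X"
  shows "\<exists>n\<in>carrier X. k \<otimes>\<^bsub>T\<^esub> \<psi> m = \<psi> n"
proof -
  obtain g where g: "T.nlim g k" and "\<forall>n. g n \<in> lin_span T {\<psi> x \<otimes>\<^bsub>T\<^esub> star T (\<psi> y) | x y. x \<in> carrier X \<and> y \<in> carrier X}"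
    using span_facts(5)[OF k] by blast
  then have "\<forall>n. \<exists>F. fin_rank F (g n)" using lin_span_fin_rank by blast
  then obtain f where f: "\<And>n. fin_rank (f n) (g n)" by metis
  have fm: "f n m \<in> carrier X" for n using fin_rank_closed(2)[OF f] m by simp
  have gm: "g n \<otimes>\<^bsub>T\<^esub> \<psi> m = \<psi> (f n m)" for n using actD(3)[OF fin_rank_act[OF f] m] .
  have lim: "T.nlim (\<lambda>n. \<psi> (f n m)) (k \<otimes>\<^bsub>T\<^esub> \<psi> m)"
    using T.nlim_mult[OF g T.nlim_const[of "\<psi> m"]] m by (simp add: gm)
  have eq: "cnorm T (\<psi> (f n m) \<ominus>\<^bsub>T\<^esub> \<psi> (f l m)) = hn (f n m \<ominus>\<^bsub>X\<^esub> f l m)" for n l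
    using fm by (simp add: psi_isometric psi_minus[symmetric])
  have "\<exists>N. \<forall>n\<ge>N. \<forall>l\<ge>N. hn (f n m \<ominus>\<^bsub>X\<^esub> f l m) < e" if "0 < e" for e
    using T.nlim_Cauchy[OF lim that] unfolding eq .
  then obtain n where n: "X.nlim (\<lambda>n. f n m) n" using X.nlim_exists[OF complete, of "\<lambda>n. f n m"] fm by blast
  then show ?thesis using T.nlim_unique[OF lim nlim_psi[OF n]] X.nlim_closed(2)[OF n] by blast
qed

text \<open>Both k and its adjoint map the range of \<psi> into itself, which yields an operator
  together with its adjoint. It is compact because the distance of the finite-rank operators from it
  is bounded by the distance of their partners from k.\<close>

lemma span_lower:
  assumes k: "k \<in> rank_one_span"
  shows "\<exists>F\<in>compacts A X. act k F"
proof -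
  obtain F where F: "\<And>m. m \<in> carrier X \<Longrightarrow> F m \<in> carrier X \<and> k \<otimes>\<^bsub>T\<^esub> \<psi> m = \<psi> (F m)"
    using span_psi[OF k] by metis
  obtain G where G: "\<And>m. m \<in> carrier X \<Longrightarrow> G m \<in> carrier X \<and> star T k \<otimes>\<^bsub>T\<^esub> \<psi> m = \<psi> (G m)"
    using span_psi[OF span_star[OF k]] by metis
  have kc: "k \<in> carrier T" using k by (rule span_closed)
  define F' where "F' = restrict F (carrier X)"
  have F'L: "F' \<in> carrier (adjointables A X)"
  proof (rule adjointableI[where G = G])
    show "F' \<in> carrier X \<rightarrow>\<^sub>E carrier X" using F by (auto simp: F'_def)
    show "G x \<in> carrier X" if "x \<in> carrier X" for x using G that by blast
    fix x y assume x: "x \<in> carrier X" and y: "y \<in> carrier X"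
    have "\<pi> (ip X (F x) y) = star T (k \<otimes>\<^bsub>T\<^esub> \<psi> x) \<otimes>\<^bsub>T\<^esub> \<psi> y"
      using F[OF x] y by (simp add: psi_ip)
    also have "\<dots> = star T (\<psi> x) \<otimes>\<^bsub>T\<^esub> (star T k \<otimes>\<^bsub>T\<^esub> \<psi> y)"
      using kc x y by (simp add: T.star_mult T.mult_assoc)
    also have "\<dots> = \<pi> (ip X x (G y))" using G[OF y] x by (simp add: psi_ip)
    finally show "ip X (F' x) y = ip X x (G y)" using F[OF x] G[OF y] x y by (intro pi_inj) (simp_all add: F'_def)
  qed
  then have act: "act k F'" using F kc by (simp add: act_def F'_def)
  obtain g where g: "T.nlim g k" and "\<forall>n. g n \<in> lin_span T {\<psi> x \<otimes>\<^bsub>T\<^esub> star T (\<psi> y) | x y. x \<in> carrier X \<and> y \<in> carrier X}"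
    using span_facts(5)[OF k] by blast
  then have "\<forall>n. \<exists>F. fin_rank F (g n)" using lin_span_fin_rank by blast
  then obtain f where f: "\<And>n. fin_rank (f n) (g n)" by metis
  have gc: "g n \<in> carrier T" and fc: "f n \<in> carrier (adjointables A X)" for n
    using fin_rank_closed[OF f] by auto
  have "L.nlim f F'"
  proof (rule L.nlimI[OF fc F'L])
    show "opnorm (f n \<ominus>\<^bsub>adjointables A X\<^esub> F') \<le> cnorm T (g n \<ominus>\<^bsub>T\<^esub> k)" for n
    proof (rule opnorm_le)
      fix x assume x: "x \<in> carrier X"
      have "hn ((f n \<ominus>\<^bsub>adjointables A X\<^esub> F') x) = cnorm T (\<psi> (f n x) \<ominus>\<^bsub>T\<^esub> \<psi> (F' x))"
        using fc F'L x by (simp add: adjointables_minus psi_isometric psi_minus[symmetric])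
      also have "\<dots> = cnorm T ((g n \<ominus>\<^bsub>T\<^esub> k) \<otimes>\<^bsub>T\<^esub> \<psi> x)"
        using actD(3)[OF fin_rank_act[OF f] x] actD(3)[OF act x] gc kc x by (simp add: T.mult_minus_left)
      also have "\<dots> \<le> cnorm T (g n \<ominus>\<^bsub>T\<^esub> k) * hn x"
        using T.cnorm_mult[of "g n \<ominus>\<^bsub>T\<^esub> k" "\<psi> x"] gc kc x by (simp add: psi_isometric)
      finally show "hn ((f n \<ominus>\<^bsub>adjointables A X\<^esub> F') x) \<le> cnorm T (g n \<ominus>\<^bsub>T\<^esub> k) * hn x" .
    qed (use gc kc in \<open>simp add: T.cnorm_nonneg\<close>)
    show "(\<lambda>n. cnorm T (g n \<ominus>\<^bsub>T\<^esub> k)) \<longlonglongrightarrow> 0" using g by (simp add: T.nlim_def)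
  qed
  then have "F' \<in> compacts A X" using L.nlim_in_closed[OF _ compacts_facts(2)] fin_rank_in_span[OF f] by blast
  then show ?thesis using act by blast
qed

text \<open>For a generator, k (\<psi> x) is some \<psi> n, so the product with k is a generator
  again; the general case follows by linearity and limits.\<close>

lemma span_mult:
  assumes k: "k \<in> rank_one_span" and l: "l \<in> rank_one_span"
  shows "k \<otimes>\<^bsub>T\<^esub> l \<in> rank_one_span"
proof -
  have kc: "k \<in> carrier T" using k by (rule span_closed)
  have "rank_one_span \<subseteq> {l \<in> carrier T. k \<otimes>\<^bsub>T\<^esub> l \<in> rank_one_span}" (is "_ \<subseteq> ?W")
  proof (rule span_induct)
    show "submodule ?W complex_field T"
      by (rule T.submoduleI') (use span_sub kc in \<open>auto simp: T.mult_add_right T.mult_smult_right\<close>)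
    show "closedin (cstar_topology T) ?W"
    proof (rule T.closedinI)
      fix f l assume l: "T.nlim f l" and f: "\<And>k. f k \<in> ?W"
      have "k \<otimes>\<^bsub>T\<^esub> l \<in> rank_one_span"
        by (rule T.nlim_in_closed[OF T.nlim_mult[OF T.nlim_const[OF kc] l] span_facts(2)]) (use f in auto)
      then show "l \<in> ?W" using T.nlim_closed(2)[OF l] by simp
    qed auto
    show "\<psi> x \<otimes>\<^bsub>T\<^esub> star T (\<psi> y) \<in> ?W" if "x \<in> carrier X" "y \<in> carrier X" for x y
      using span_psi[OF k that(1)] span_gen that kc by (auto simp: T.mult_assoc[symmetric])
  qed
  then show ?thesis using l by auto
qed

text \<open>The elements l with k l = 0 form a closed subspace containing all generators, hence the
  adjoint of k; and k k^* = 0 forces k = 0.\<close>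

lemma span_unique:
  assumes k: "k \<in> rank_one_span" and z: "\<And>m. m \<in> carrier X \<Longrightarrow> k \<otimes>\<^bsub>T\<^esub> \<psi> m = \<zero>\<^bsub>T\<^esub>"
  shows "k = \<zero>\<^bsub>T\<^esub>"
proof -
  have kc: "k \<in> carrier T" using k by (rule span_closed)
  have "rank_one_span \<subseteq> {l \<in> carrier T. k \<otimes>\<^bsub>T\<^esub> l = \<zero>\<^bsub>T\<^esub>}" (is "_ \<subseteq> ?W")
  proof (rule span_induct)
    show "submodule ?W complex_field T"
      by (rule T.submoduleI') (use kc in \<open>auto simp: T.mult_add_right T.mult_smult_right\<close>)
    show "closedin (cstar_topology T) ?W"
    proof (rule T.closedinI)
      fix f l assume l: "T.nlim f l" and f: "\<And>k. f k \<in> ?W"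
      have "T.nlim (\<lambda>n. \<zero>\<^bsub>T\<^esub>) (k \<otimes>\<^bsub>T\<^esub> l)" using T.nlim_mult[OF T.nlim_const[OF kc] l] f by simp
      then have "k \<otimes>\<^bsub>T\<^esub> l = \<zero>\<^bsub>T\<^esub>" using T.nlim_unique[OF _ T.nlim_const[OF T.M.zero_closed]] by blast
      then show "l \<in> ?W" using T.nlim_closed(2)[OF l] by simp
    qed auto
    show "\<psi> x \<otimes>\<^bsub>T\<^esub> star T (\<psi> y) \<in> ?W" if "x \<in> carrier X" "y \<in> carrier X" for x y
      using z[OF that(1)] that kc by (simp add: T.mult_assoc[symmetric])
  qed
  then have "k \<otimes>\<^bsub>T\<^esub> star T k = \<zero>\<^bsub>T\<^esub>" using span_star[OF k] by auto
  then have "star T k = \<zero>\<^bsub>T\<^esub>" using T.star_mult_self_eq_zero[of "star T k"] kc by simp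
  then have "star T (star T k) = \<zero>\<^bsub>T\<^esub>" by simp
  then show ?thesis using kc by simp
qed

lemma act_span_unique:
  assumes "k \<in> rank_one_span" "l \<in> rank_one_span" "act k F" "act l F"
  shows "k = l"
proof -
  have c: "k \<in> carrier T" "l \<in> carrier T" using assms(1,2) span_closed by blast+
  have "k \<ominus>\<^bsub>T\<^esub> l = \<zero>\<^bsub>T\<^esub>"
  proof (rule span_unique[OF span_sub(5)[OF assms(1,2)]])
    fix m assume m: "m \<in> carrier X"
    show "(k \<ominus>\<^bsub>T\<^esub> l) \<otimes>\<^bsub>T\<^esub> \<psi> m = \<zero>\<^bsub>T\<^esub>"
      using c m actD(2)[OF assms(3)] by (simp add: T.mult_minus_left actD(3)[OF assms(3) m]
        actD(3)[OF assms(4) m] T.minus_self)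
  qed
  then show ?thesis using c by (simp add: T.minus_eq_zero_iff)
qed

text \<open>This is the homomorphism induced by (\<psi>,\<pi>) on the compact operators:
  \<open>compacts_lift\<close> gives existence of k and \<open>act_span_unique\<close> its
  uniqueness.\<close>

definition compact_hom :: "('m \<Rightarrow> 'm) \<Rightarrow> 'b"
  where "compact_hom F = (THE k. k \<in> rank_one_span \<and> act k F)"

lemma compact_hom_eqI: "\<lbrakk>k \<in> rank_one_span; act k F\<rbrakk> \<Longrightarrow> compact_hom F = k"
  unfolding compact_hom_def using act_span_unique by blast

lemma compact_hom: "F \<in> compacts A X \<Longrightarrow> compact_hom F \<in> rank_one_span"
  "F \<in> compacts A X \<Longrightarrow> act (compact_hom F) F"
  using compacts_lift[of F] compact_hom_eqI by auto

lemma act_in_compacts: "\<lbrakk>k \<in> rank_one_span; act k F\<rbrakk> \<Longrightarrow> F \<in> compacts A X"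
  using span_lower[of k] act_unique by blast

lemma act_star_span: "\<lbrakk>k \<in> rank_one_span; act k F\<rbrakk> \<Longrightarrow> act (star T k) (star (adjointables A X) F)"
  using span_lower[OF span_star[of k]] act_star by blast

lemma induced_hom_compact_hom: "induced_hom A X T \<psi> compact_hom"
  unfolding induced_hom_def
proof (intro conjI ballI)
  show "compact_hom \<in> star_hom (adjointables A X\<lparr>carrier := compacts A X\<rparr>) T"
  proof (rule star_homI)
    fix F G c
    assume "F \<in> carrier (adjointables A X\<lparr>carrier := compacts A X\<rparr>)"
      and "G \<in> carrier (adjointables A X\<lparr>carrier := compacts A X\<rparr>)"
    then have F: "F \<in> compacts A X" and G: "G \<in> compacts A X" by simp_all
    note kF = compact_hom[OF F] and kG = compact_hom[OF G]
    show "compact_hom F \<in> carrier T" using kF span_closed by blast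
    show "compact_hom (F \<oplus>\<^bsub>adjointables A X\<lparr>carrier := compacts A X\<rparr>\<^esub> G) = compact_hom F \<oplus>\<^bsub>T\<^esub> compact_hom G"
      using kF kG by (intro compact_hom_eqI) (simp_all add: span_sub act_add del: adjointables_simps)
    show "compact_hom (F \<otimes>\<^bsub>adjointables A X\<lparr>carrier := compacts A X\<rparr>\<^esub> G) = compact_hom F \<otimes>\<^bsub>T\<^esub> compact_hom G"
      using kF kG by (intro compact_hom_eqI) (simp_all add: span_mult act_mult del: adjointables_simps)
    show "compact_hom (c \<odot>\<^bsub>adjointables A X\<lparr>carrier := compacts A X\<rparr>\<^esub> F) = c \<odot>\<^bsub>T\<^esub> compact_hom F"
      using kF by (intro compact_hom_eqI) (simp_all add: span_sub act_smult del: adjointables_simps)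
    show "compact_hom (star (adjointables A X\<lparr>carrier := compacts A X\<rparr>) F) = star T (compact_hom F)"
      using kF by (intro compact_hom_eqI) (simp_all add: span_star act_star_span)
  qed
  show "compact_hom (rank_one X x y) = \<psi> x \<otimes>\<^bsub>T\<^esub> star T (\<psi> y)" if "x \<in> carrier X" "y \<in> carrier X" for x y
    using that by (intro compact_hom_eqI span_gen act_rank_one)
qed

text \<open>
  Automatic continuity is used for $k \mapsto \rho(F_k)$ on the closed span, which is a
  $C^*$-subalgebra of $T$; completeness of the compact operators is not needed.
\<close>

lemma induced_hom_factor:
  assumes B: "unital_cstar_algebra B" and s: "\<sigma> \<in> star_hom T B" and rho: "induced_hom A X B \<psi>' \<rho>"
    and eq: "\<And>x. x \<in> carrier X \<Longrightarrow> \<sigma> (\<psi> x) = \<psi>' x"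
    and k: "k \<in> rank_one_span" "act k F"
  shows "\<rho> F = \<sigma> k"
proof -
  interpret B: unital_cstar_algebra B by fact
  let ?D = "T\<lparr>carrier := rank_one_span\<rparr>"
  have D: "cstar_algebra ?D"
    by (rule T.cstar_subalgebra[OF span_facts(1,2)]) (simp_all add: span_mult span_star)
  \<comment> \<open>The inverse of \<open>compact_hom\<close>. Choice makes it total, and on the
    span it is determined by \<open>act_unique\<close>.\<close>
  define \<Lambda> where "\<Lambda> k = (SOME F. act k F)" for k
  have L: "act k (\<Lambda> k)" if k': "k \<in> rank_one_span" for k
  proof -
    obtain F where "act k F" using span_lower[OF k'] by blast
    then show ?thesis unfolding \<Lambda>_def by (rule someI[of "act k"])
  qed
  have L_eq: "\<Lambda> k = F" if "k \<in> rank_one_span" "act k F" for k F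
    using act_unique[OF L[OF that(1)] that(2)] .
  have Lc: "\<Lambda> k \<in> compacts A X" if "k \<in> rank_one_span" for k
    using act_in_compacts[OF that L[OF that]] .
  have "\<rho> \<in> star_hom (adjointables A X\<lparr>carrier := compacts A X\<rparr>) B"
    using rho by (simp add: induced_hom_def)
  note rD = star_homD[OF this, simplified, folded adjointables_simps]
  note sD = star_homD[OF s]
  define g where "g k = \<rho> (\<Lambda> k)" for k
  have g: "g \<in> star_hom ?D B"
  proof (rule star_homI)
    fix k l c assume "k \<in> carrier ?D" "l \<in> carrier ?D"
    then have k: "k \<in> rank_one_span" and l: "l \<in> rank_one_span" by simp_all
    show "g k \<in> carrier B" using rD(1)[OF Lc[OF k]] by (simp add: g_def)
    have "\<Lambda> (k \<oplus>\<^bsub>T\<^esub> l) = \<Lambda> k \<oplus>\<^bsub>adjointables A X\<^esub> \<Lambda> l"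
      using k l by (intro L_eq act_add L span_sub)
    then show "g (k \<oplus>\<^bsub>?D\<^esub> l) = g k \<oplus>\<^bsub>B\<^esub> g l"
      using rD(2)[OF Lc[OF k] Lc[OF l]] by (simp add: g_def del: adjointables_simps)
    have "\<Lambda> (k \<otimes>\<^bsub>T\<^esub> l) = \<Lambda> k \<otimes>\<^bsub>adjointables A X\<^esub> \<Lambda> l"
      using k l by (intro L_eq act_mult L span_mult)
    then show "g (k \<otimes>\<^bsub>?D\<^esub> l) = g k \<otimes>\<^bsub>B\<^esub> g l"
      using rD(4)[OF Lc[OF k] Lc[OF l]] by (simp add: g_def del: adjointables_simps)
    have "\<Lambda> (c \<odot>\<^bsub>T\<^esub> k) = c \<odot>\<^bsub>adjointables A X\<^esub> \<Lambda> k"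
      using k span_sub(4)[of c k] by (intro L_eq act_smult L) simp_all
    then show "g (c \<odot>\<^bsub>?D\<^esub> k) = c \<odot>\<^bsub>B\<^esub> g k"
      using rD(3)[OF Lc[OF k]] by (simp add: g_def del: adjointables_simps)
    have "\<Lambda> (star T k) = star (adjointables A X) (\<Lambda> k)"
      using k by (intro L_eq act_star_span L span_star)
    then show "g (star ?D k) = star B (g k)"
      using rD(5)[OF Lc[OF k]] by (simp add: g_def)
  qed
  note gD = star_homD[OF g, simplified]
  let ?W = "{k \<in> rank_one_span. g k = \<sigma> k}"
  have "rank_one_span \<subseteq> ?W"
  proof (rule span_induct)
    show "submodule ?W complex_field T"
    proof (rule T.submoduleI')
      have "g \<zero>\<^bsub>T\<^esub> = 0 \<odot>\<^bsub>B\<^esub> g \<zero>\<^bsub>T\<^esub>" "\<sigma> \<zero>\<^bsub>T\<^esub> = 0 \<odot>\<^bsub>B\<^esub> \<sigma> \<zero>\<^bsub>T\<^esub>"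
        using gD(3)[OF span_sub(2), of 0] sD(3)[of "\<zero>\<^bsub>T\<^esub>" 0] by simp_all
      then show "\<zero>\<^bsub>T\<^esub> \<in> ?W" using gD(1) sD(1) span_sub(2) by simp
    qed (use gD sD span_sub span_closed in auto)
    show "closedin (cstar_topology T) ?W"
    proof (rule T.closedinI)
      fix f l assume l: "T.nlim f l" and f: "\<And>k. f k \<in> ?W"
      have lC: "l \<in> rank_one_span" using T.nlim_in_closed[OF l span_facts(2)] f by auto
      have fC: "f n \<in> rank_one_span" for n using f by auto
      note c = span_closed[OF lC] span_closed[OF fC]
      have "B.nlim (\<lambda>n. g (f n)) (g l)"
      proof (rule B.nlimI)
        show "cnorm B (g (f n) \<ominus>\<^bsub>B\<^esub> g l) \<le> cnorm T (f n \<ominus>\<^bsub>T\<^esub> l)" for n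
        proof -
          have "(- 1) \<odot>\<^bsub>T\<^esub> l \<in> rank_one_span" using span_sub(4)[of "- 1" l] lC by simp
          then have "g (f n \<ominus>\<^bsub>T\<^esub> l) = g (f n) \<ominus>\<^bsub>B\<^esub> g l"
            using c fC lC gD(2)[of "f n" "(- 1) \<odot>\<^bsub>T\<^esub> l"] gD(3)[of l "- 1"] gD(1)
            by (simp add: T.M.minus_eq B.M.minus_eq T.minus_as_smult B.minus_as_smult)
          then show ?thesis
            using star_hom_contractive[OF D B g, of "f n \<ominus>\<^bsub>T\<^esub> l"] span_sub(5)[OF fC lC] by simp
        qed
        show "(\<lambda>n. cnorm T (f n \<ominus>\<^bsub>T\<^esub> l)) \<longlonglongrightarrow> 0" using l by (simp add: T.nlim_def)
      qed (use gD(1) fC lC in auto)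
      moreover have "B.nlim (\<lambda>n. \<sigma> (f n)) (\<sigma> l)"
        by (rule nlim_linear[OF T.normed_space_axioms B.normed_space_axioms star_hom_linear[OF s] _ l, of 1])
          (use star_hom_contractive[OF T.cstar_algebra_axioms B s] in simp)
      moreover have "(\<lambda>n. g (f n)) = (\<lambda>n. \<sigma> (f n))" using f by auto
      ultimately have "g l = \<sigma> l" using B.nlim_unique by metis
      then show "l \<in> ?W" using lC by simp
    qed (use span_closed in auto)
    fix x y assume x: "x \<in> carrier X" and y: "y \<in> carrier X"
    have "\<Lambda> (\<psi> x \<otimes>\<^bsub>T\<^esub> star T (\<psi> y)) = rank_one X x y"
      using x y by (intro L_eq span_gen act_rank_one)
    then have "g (\<psi> x \<otimes>\<^bsub>T\<^esub> star T (\<psi> y)) = \<psi>' x \<otimes>\<^bsub>B\<^esub> star B (\<psi>' y)"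
      using rho x y by (simp add: g_def induced_hom_def)
    also have "\<dots> = \<sigma> (\<psi> x \<otimes>\<^bsub>T\<^esub> star T (\<psi> y))" using x y by (simp add: sD eq)
    finally show "\<psi> x \<otimes>\<^bsub>T\<^esub> star T (\<psi> y) \<in> ?W" using span_gen[OF x y] by simp
  qed
  then show ?thesis using k L_eq[OF k] by (auto simp: g_def)
qed

end

section \<open>The Toeplitz representation of Exel's bimodule\<close>

text \<open>Extension by density, via a graph: \<open>R x t\<close> relates x to the limits t of f
  along sequences whose images under q tend to x. That f factors through q is a consequence of
  \<open>iso\<close>, as are existence and uniqueness of t.\<close>

lemma isometric_extension:
  assumes U: "normed_space U nU" and V: "normed_space V nV" and W: "normed_space W nW"
    and complete: "norm_complete W nW" and q: "linear_map U V q" and f: "linear_map U W f"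
    and iso: "\<And>a. a \<in> carrier U \<Longrightarrow> nW (f a) = nV (q a)"
    and dense: "Abstract_Topology.closure_of (norm_topology V nV) (q ` carrier U) = carrier V"
  obtains \<psi> where "linear_map V W \<psi>" "\<And>a. a \<in> carrier U \<Longrightarrow> \<psi> (q a) = f a"
    "\<And>x. x \<in> carrier V \<Longrightarrow> nW (\<psi> x) = nV x"
proof -
  interpret U: normed_space U nU by fact
  interpret V: normed_space V nV by fact
  interpret W: normed_space W nW by fact
  note qD = linear_mapD[OF q] and fD = linear_mapD[OF f]
  have qsub: "q ` carrier U \<subseteq> carrier V" using qD(1) by blast
  have approx: "\<exists>g. (\<forall>k. g k \<in> carrier U) \<and> V.nlim (\<lambda>k. q (g k)) x" if x: "x \<in> carrier V" for x
  proof -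
    have e: "\<exists>y\<in>q ` carrier U. nV (x \<ominus>\<^bsub>V\<^esub> y) < e" if "0 < e" for e
      using x that V.in_closure_iff[OF qsub, of x] by (simp only: dense) blast
    obtain h where h: "V.nlim h x" "\<And>k. h k \<in> q ` carrier U" using V.approx_nlim[OF x qsub e] by blast
    then have "\<forall>k. \<exists>a. a \<in> carrier U \<and> h k = q a" by blast
    then obtain g where g: "\<And>k. g k \<in> carrier U \<and> h k = q (g k)" by metis
    then have "h = (\<lambda>k. q (g k))" by auto
    then show ?thesis using h(1) g by blast
  qed
  define R where "R x t \<longleftrightarrow> (\<exists>g. (\<forall>k. g k \<in> carrier U) \<and> V.nlim (\<lambda>k. q (g k)) x \<and> W.nlim (\<lambda>k. f (g k)) t)" for x t
  have diff: "nW (f a \<ominus>\<^bsub>W\<^esub> f b) = nV (q a \<ominus>\<^bsub>V\<^esub> q b)" if "a \<in> carrier U" "b \<in> carrier U" for a b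
    using iso[of "a \<ominus>\<^bsub>U\<^esub> b"] that linear_map_minus(1)[OF q U V that] linear_map_minus(1)[OF f U W that] by simp
  have ex: "\<exists>t. R x t" if x: "x \<in> carrier V" for x
  proof -
    obtain g where g: "\<And>k. g k \<in> carrier U" "V.nlim (\<lambda>k. q (g k)) x" using approx[OF x] by blast
    have "\<exists>N. \<forall>m\<ge>N. \<forall>k\<ge>N. nW (f (g m) \<ominus>\<^bsub>W\<^esub> f (g k)) < e" if "0 < e" for e
      using V.nlim_Cauchy[OF g(2) that] by (simp add: diff g(1))
    then obtain t where "W.nlim (\<lambda>k. f (g k)) t"
      using W.nlim_exists[OF complete, of "\<lambda>k. f (g k)"] fD(1)[OF g(1)] by blast
    then show ?thesis using g unfolding R_def by blast
  qed
  have uniq: "t = s" if t: "R x t" and s: "R x s" for x t s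
  proof -
    obtain g h where g: "\<And>k. g k \<in> carrier U" "V.nlim (\<lambda>k. q (g k)) x" "W.nlim (\<lambda>k. f (g k)) t"
      and h: "\<And>k. h k \<in> carrier U" "V.nlim (\<lambda>k. q (h k)) x" "W.nlim (\<lambda>k. f (h k)) s"
      using t s unfolding R_def by blast
    have x: "x \<in> carrier V" and c: "t \<in> carrier W" "s \<in> carrier W"
      using V.nlim_closed(2)[OF g(2)] W.nlim_closed(2)[OF g(3)] W.nlim_closed(2)[OF h(3)] by auto
    have "(\<lambda>k. nW (f (g k) \<ominus>\<^bsub>W\<^esub> f (h k))) \<longlonglongrightarrow> nW (t \<ominus>\<^bsub>W\<^esub> s)"
      by (rule W.nlim_nrm[OF W.nlim_minus[OF g(3) h(3)]])
    moreover have "(\<lambda>k. nV (q (g k) \<ominus>\<^bsub>V\<^esub> q (h k))) \<longlonglongrightarrow> nV (x \<ominus>\<^bsub>V\<^esub> x)"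
      by (rule V.nlim_nrm[OF V.nlim_minus[OF g(2) h(2)]])
    ultimately have "nW (t \<ominus>\<^bsub>W\<^esub> s) = nV (x \<ominus>\<^bsub>V\<^esub> x)"
      using LIMSEQ_unique by (simp add: diff g(1) h(1))
    then show ?thesis using c x by (simp add: V.minus_self W.nrm_eq_zero W.minus_eq_zero_iff)
  qed
  obtain \<psi> where \<psi>: "\<And>x. x \<in> carrier V \<Longrightarrow> R x (\<psi> x)" using ex by metis
  have R_add: "R (x \<oplus>\<^bsub>V\<^esub> y) (t \<oplus>\<^bsub>W\<^esub> s)" if t: "R x t" and s: "R y s" for x y t s
  proof -
    obtain g h where g: "\<And>k. g k \<in> carrier U" "V.nlim (\<lambda>k. q (g k)) x" "W.nlim (\<lambda>k. f (g k)) t"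
      and h: "\<And>k. h k \<in> carrier U" "V.nlim (\<lambda>k. q (h k)) y" "W.nlim (\<lambda>k. f (h k)) s"
      using t s unfolding R_def by blast
    show ?thesis unfolding R_def using V.nlim_add[OF g(2) h(2)] W.nlim_add[OF g(3) h(3)] g(1) h(1)
      by (intro exI[of _ "\<lambda>k. g k \<oplus>\<^bsub>U\<^esub> h k"]) (simp add: qD fD)
  qed
  have R_smult: "R (c \<odot>\<^bsub>V\<^esub> x) (c \<odot>\<^bsub>W\<^esub> t)" if t: "R x t" for x t c
  proof -
    obtain g where g: "\<And>k. g k \<in> carrier U" "V.nlim (\<lambda>k. q (g k)) x" "W.nlim (\<lambda>k. f (g k)) t"
      using t unfolding R_def by blast
    show ?thesis unfolding R_def using V.nlim_smult[OF g(2)] W.nlim_smult[OF g(3)] g(1)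
      by (intro exI[of _ "\<lambda>k. c \<odot>\<^bsub>U\<^esub> g k"]) (simp add: qD fD)
  qed
  show thesis
  proof (rule that[of \<psi>])
    show "linear_map V W \<psi>" unfolding linear_map_def
    proof (intro conjI ballI allI funcsetI)
      fix x c assume x: "x \<in> carrier V"
      show "\<psi> x \<in> carrier W" using \<psi>[OF x] W.nlim_closed(2) unfolding R_def by blast
      show "\<psi> (c \<odot>\<^bsub>V\<^esub> x) = c \<odot>\<^bsub>W\<^esub> \<psi> x" using x by (intro uniq[OF \<psi> R_smult[OF \<psi>]]) simp_all
      fix y assume y: "y \<in> carrier V"
      show "\<psi> (x \<oplus>\<^bsub>V\<^esub> y) = \<psi> x \<oplus>\<^bsub>W\<^esub> \<psi> y" using x y by (intro uniq[OF \<psi> R_add[OF \<psi> \<psi>]]) simp_all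
    qed
    show "nW (\<psi> x) = nV x" if x: "x \<in> carrier V" for x
    proof -
      obtain g where g: "\<And>k. g k \<in> carrier U" "V.nlim (\<lambda>k. q (g k)) x" "W.nlim (\<lambda>k. f (g k)) (\<psi> x)"
        using \<psi>[OF x] unfolding R_def by blast
      show ?thesis
        using LIMSEQ_unique[OF W.nlim_nrm[OF g(3)]] V.nlim_nrm[OF g(2)] by (simp add: iso g(1))
    qed
    show "\<psi> (q a) = f a" if a: "a \<in> carrier U" for a
    proof (rule uniq[OF \<psi>[OF qD(1)[OF a]]])
      show "R (q a) (f a)" unfolding R_def
        using a V.nlim_const[OF qD(1)[OF a]] W.nlim_const[OF fD(1)[OF a]] by (intro exI[of _ "\<lambda>k. a"]) simp
    qed
  qed
qed

lemma star_hom_nlim: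
  assumes T: "cstar_algebra T" and B: "unital_cstar_algebra B" and f: "f \<in> star_hom T B"
    and lim: "normed_space.nlim T (cnorm T) g x"
  shows "normed_space.nlim B (cnorm B) (\<lambda>k. f (g k)) (f x)"
proof -
  interpret T: cstar_algebra T by fact
  interpret B: unital_cstar_algebra B by fact
  show ?thesis
    by (rule nlim_linear[OF T.normed_space_axioms B.normed_space_axioms star_hom_linear[OF f] _ lim, of 1])
      (use star_hom_contractive[OF T B f] in simp)
qed

lemma cstar_generated_induct:
  assumes "cstar_generated T G = carrier T" "cstar_algebra T" "D \<subseteq> carrier T" "G \<subseteq> D" "\<zero>\<^bsub>T\<^esub> \<in> D"
    and "\<And>x y. \<lbrakk>x \<in> D; y \<in> D\<rbrakk> \<Longrightarrow> x \<oplus>\<^bsub>T\<^esub> y \<in> D" "\<And>c x. x \<in> D \<Longrightarrow> c \<odot>\<^bsub>T\<^esub> x \<in> D"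
    and "\<And>x y. \<lbrakk>x \<in> D; y \<in> D\<rbrakk> \<Longrightarrow> x \<otimes>\<^bsub>T\<^esub> y \<in> D" "\<And>x. x \<in> D \<Longrightarrow> star T x \<in> D"
    and "\<And>f l. \<lbrakk>normed_space.nlim T (cnorm T) f l; \<And>k. f k \<in> D\<rbrakk> \<Longrightarrow> l \<in> D"
  shows "carrier T = D"
proof -
  interpret T: cstar_algebra T by fact
  have "submodule D complex_field T" using assms(3,5-7) by (rule T.submoduleI')
  moreover have "closedin (cstar_topology T) D" using assms(3,10) by (rule T.closedinI)
  ultimately have "cstar_generated T G \<subseteq> D"
    unfolding cstar_generated_def using assms(4,8,9) by (intro Inter_lower) simp
  then show ?thesis using assms(1,3) by blast
qed

lemma star_hom_eq_on_generated:
  assumes gen: "cstar_generated T G = carrier T" and T: "cstar_algebra T" and B: "unital_cstar_algebra B"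
    and f: "f \<in> star_hom T B" and g: "g \<in> star_hom T B"
    and G: "G \<subseteq> carrier T" and eq: "\<And>x. x \<in> G \<Longrightarrow> f x = g x" and x: "x \<in> carrier T"
  shows "f x = g x"
proof -
  interpret T: cstar_algebra T by fact
  interpret B: unital_cstar_algebra B by fact
  note fD = star_homD[OF f] and gD = star_homD[OF g]
  let ?D = "{x \<in> carrier T. f x = g x}"
  have "carrier T = ?D"
  proof (rule cstar_generated_induct[OF gen T])
    show "\<zero>\<^bsub>T\<^esub> \<in> ?D"
      using linear_map_minus(2)[OF star_hom_linear[OF f] T.normed_space_axioms B.normed_space_axioms
          T.M.zero_closed T.M.zero_closed]
        linear_map_minus(2)[OF star_hom_linear[OF g] T.normed_space_axioms B.normed_space_axioms
          T.M.zero_closed T.M.zero_closed]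
      using T.M.zero_closed by simp
    show "l \<in> ?D" if h: "T.nlim h l" "\<And>k. h k \<in> ?D" for h l
    proof -
      have "(\<lambda>k. f (h k)) = (\<lambda>k. g (h k))" using h(2) by auto
      then have "f l = g l"
        using B.nlim_unique star_hom_nlim[OF T B f h(1)] star_hom_nlim[OF T B g h(1)] by metis
      then show ?thesis using T.nlim_closed(2)[OF h(1)] by simp
    qed
  qed (use G eq fD gD in auto)
  then show ?thesis using x by blast
qed

text \<open>The axioms of a C*-algebra never mention \<open>one\<close>, so a unit found later can
  be written into \<open>Ob\<close>. Differences are formed in the additive monoid, which the update
  does not reach.\<close>

lemma cstar_algebra_update_one:
  assumes "cstar_algebra B"
  shows "cstar_algebra (B\<lparr>one := e\<rparr>)"
proof -
  have am: "add_monoid (B\<lparr>one := e\<rparr>) = add_monoid B" by simp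
  have "norm_dist (B\<lparr>one := e\<rparr>) (cnorm (B\<lparr>one := e\<rparr>)) = norm_dist B (cnorm B)"
    by (intro ext) (simp add: norm_dist_def a_minus_def a_inv_def am)
  then have "norm_complete (B\<lparr>one := e\<rparr>) (cnorm (B\<lparr>one := e\<rparr>)) = norm_complete B (cnorm B)"
    by (simp add: norm_complete_def)
  then show ?thesis
    using assms unfolding cstar_algebra_def cstar_algebra_axioms_def Module.module_def module_axioms_def
      abelian_group_def abelian_monoid_def abelian_group_axioms_def am
    by simp
qed

text \<open>Of T only covariance and injectivity of \<open>iA\<close> are assumed. Both universal
  properties enter in \<open>exel_isomorphism\<close> alone.\<close>

locale exel_covariant = unital_hilbert_module A M + T: unital_cstar_algebra T
  for A :: "'a cstar" and M :: "('a, 'm) hilbert_mod" and T :: "'u cstar" +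
  fixes \<alpha> L :: "'a \<Rightarrow> 'a" and \<phi> :: "'a \<Rightarrow> 'm \<Rightarrow> 'm" and q :: "'a \<Rightarrow> 'm" and iA :: "'a \<Rightarrow> 'u" and S :: 'u
  assumes alpha: "\<alpha> \<in> star_hom A A" and transfer: "transfer_operator A \<alpha> L"
    and bimodule: "exel_bimodule A \<alpha> L M \<phi> q" and covariant: "toeplitz_covariant A \<alpha> L T iA S"
    and inj: "inj_on iA (carrier A)"
begin

lemma q_linear: "linear_map A M q"
  and q_ip: "\<lbrakk>m \<in> carrier A; n \<in> carrier A\<rbrakk> \<Longrightarrow> ip M (q m) (q n) = L (star A m \<otimes>\<^bsub>A\<^esub> n)"
  and q_raction: "\<lbrakk>m \<in> carrier A; a \<in> carrier A\<rbrakk> \<Longrightarrow> raction M (q m) a = q (m \<otimes>\<^bsub>A\<^esub> \<alpha> a)"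
  and phi_q: "\<lbrakk>a \<in> carrier A; b \<in> carrier A\<rbrakk> \<Longrightarrow> \<phi> a (q b) = q (a \<otimes>\<^bsub>A\<^esub> b)"
  and q_dense: "Abstract_Topology.closure_of (norm_topology M (hnorm A M)) (q ` carrier A) = carrier M"
  and phi_hom: "\<phi> \<in> star_hom A (adjointables A M)"
  using bimodule by (auto simp: exel_bimodule_def hilbert_bimodule_def hilbert_bimodule_axioms_def)

lemma iA_hom: "iA \<in> star_hom A T" and iA_one: "iA \<one>\<^bsub>A\<^esub> = \<one>\<^bsub>T\<^esub>" and S_closed [simp]: "S \<in> carrier T"
  and S_iA: "a \<in> carrier A \<Longrightarrow> S \<otimes>\<^bsub>T\<^esub> iA a = iA (\<alpha> a) \<otimes>\<^bsub>T\<^esub> S"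
  and S_iA_S: "a \<in> carrier A \<Longrightarrow> star T S \<otimes>\<^bsub>T\<^esub> iA a \<otimes>\<^bsub>T\<^esub> S = iA (L a)"
  using covariant by (auto simp: toeplitz_covariant_def)

lemma L_closed: "a \<in> carrier A \<Longrightarrow> L a \<in> carrier A"
  using transfer by (auto simp: transfer_operator_def linear_map_def)

lemmas alphaD = star_homD[OF alpha] and iAD = star_homD[OF iA_hom] and qD = linear_mapD[OF q_linear]
  and phiD = star_homD[OF phi_hom]

lemma iA_isometric: "a \<in> carrier A \<Longrightarrow> cnorm T (iA a) = cnorm A a"
  by (rule star_hom_isometric[OF A.unital_cstar_algebra_axioms T.unital_cstar_algebra_axioms iA_hom iA_one inj])

lemma q_approx:
  assumes "m \<in> carrier M"
  obtains g where "\<And>k. g k \<in> carrier A" "X.nlim (\<lambda>k. q (g k)) m"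
proof -
  have qsub: "q ` carrier A \<subseteq> carrier M" using qD(1) by blast
  have e: "\<exists>y\<in>q ` carrier A. hn (m \<ominus>\<^bsub>M\<^esub> y) < e" if "0 < e" for e
    using assms that X.in_closure_iff[OF qsub, of m] by (simp only: q_dense) blast
  obtain h where h: "X.nlim h m" "\<And>k. h k \<in> q ` carrier A" using X.approx_nlim[OF assms qsub e] by blast
  then have "\<forall>k. \<exists>a. a \<in> carrier A \<and> h k = q a" by blast
  then obtain g where g: "\<And>k. g k \<in> carrier A \<and> h k = q (g k)" by metis
  then have "h = (\<lambda>k. q (g k))" by auto
  then show thesis using g h(1) that by blast
qed

lemma adjointable_eq_on_q:
  assumes F: "F \<in> carrier (adjointables A M)" and G: "G \<in> carrier (adjointables A M)"
    and eq: "\<And>b. b \<in> carrier A \<Longrightarrow> F (q b) = G (q b)"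
  shows "F = G"
proof (rule adjointable_eqI[OF F G])
  fix m assume "m \<in> carrier M"
  then obtain g where g: "\<And>k. g k \<in> carrier A" "X.nlim (\<lambda>k. q (g k)) m" using q_approx by blast
  have "(\<lambda>k. F (q (g k))) = (\<lambda>k. G (q (g k)))" using eq g(1) by simp
  then show "F m = G m"
    using X.nlim_unique nlim_adjointable[OF F g(2)] nlim_adjointable[OF G g(2)] by metis
qed

text \<open>Covariance turns the square of the left side into the norm of L(a^* a), which is <q a, q
  a>. Hence q a determines the element i_A(a)S, and the assignment is isometric.\<close>

lemma iA_S_norm:
  assumes a: "a \<in> carrier A"
  shows "cnorm T (iA a \<otimes>\<^bsub>T\<^esub> S) = hn (q a)"
proof -
  have "star T (iA a \<otimes>\<^bsub>T\<^esub> S) \<otimes>\<^bsub>T\<^esub> (iA a \<otimes>\<^bsub>T\<^esub> S) = iA (L (star A a \<otimes>\<^bsub>A\<^esub> a))"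
    using a S_iA_S[of "star A a \<otimes>\<^bsub>A\<^esub> a"] by (simp add: T.star_mult iAD T.mult_assoc)
  then have "(cnorm T (iA a \<otimes>\<^bsub>T\<^esub> S))\<^sup>2 = (hn (q a))\<^sup>2"
    using a T.cstar_identity[of "iA a \<otimes>\<^bsub>T\<^esub> S"] by (simp add: iAD(1) iA_isometric L_closed hn_square qD(1) q_ip)
  then show ?thesis
    using a by (simp add: power2_eq_iff_nonneg T.cnorm_nonneg iAD(1) qD(1))
qed

text \<open>\<open>isometric_extension\<close> provides existence; since the range of q is dense,
  the three clauses determine the choice on the carrier of M.\<close>

definition \<psi> :: "'m \<Rightarrow> 'u"
  where "\<psi> = (SOME \<psi>. linear_map M T \<psi> \<and> (\<forall>a\<in>carrier A. \<psi> (q a) = iA a \<otimes>\<^bsub>T\<^esub> S) \<and>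
    (\<forall>m\<in>carrier M. cnorm T (\<psi> m) = hn m))"

lemma psi_map: "linear_map M T \<psi>"
  and psi_q: "a \<in> carrier A \<Longrightarrow> \<psi> (q a) = iA a \<otimes>\<^bsub>T\<^esub> S"
  and psi_norm: "m \<in> carrier M \<Longrightarrow> cnorm T (\<psi> m) = hn m"
proof -
  have f: "linear_map A T (\<lambda>a. iA a \<otimes>\<^bsub>T\<^esub> S)"
    by (auto simp: linear_map_def iAD T.mult_add_left T.mult_smult_left)
  have ex: "\<exists>\<psi>. linear_map M T \<psi> \<and> (\<forall>a\<in>carrier A. \<psi> (q a) = iA a \<otimes>\<^bsub>T\<^esub> S) \<and>
    (\<forall>m\<in>carrier M. cnorm T (\<psi> m) = hn m)"
    by (rule isometric_extension[OF A.normed_space_axioms X.normed_space_axioms T.normed_space_axioms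
        T.complete q_linear f iA_S_norm q_dense]) blast+
  from someI_ex[OF ex, folded \<psi>_def] show "linear_map M T \<psi>"
    "a \<in> carrier A \<Longrightarrow> \<psi> (q a) = iA a \<otimes>\<^bsub>T\<^esub> S" "m \<in> carrier M \<Longrightarrow> cnorm T (\<psi> m) = hn m"
    by auto
qed

lemma psi_nlim: "X.nlim f m \<Longrightarrow> T.nlim (\<lambda>k. \<psi> (f k)) (\<psi> m)"
  by (rule nlim_linear[OF X.normed_space_axioms T.normed_space_axioms psi_map, of 1]) (simp_all add: psi_norm)

lemma iA_nlim: "A.nlim f a \<Longrightarrow> T.nlim (\<lambda>k. iA (f k)) (iA a)"
  by (rule star_hom_nlim[OF A.cstar_algebra_axioms T.unital_cstar_algebra_axioms iA_hom])

lemma psi_phi: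
  assumes a: "a \<in> carrier A" and m: "m \<in> carrier M"
  shows "\<psi> (\<phi> a m) = iA a \<otimes>\<^bsub>T\<^esub> \<psi> m"
proof -
  obtain g where g: "\<And>k. g k \<in> carrier A" "X.nlim (\<lambda>k. q (g k)) m" using q_approx[OF m] by blast
  have "(\<lambda>k. \<psi> (\<phi> a (q (g k)))) = (\<lambda>k. iA a \<otimes>\<^bsub>T\<^esub> \<psi> (q (g k)))"
    using a g(1) by (simp add: phi_q psi_q iAD T.mult_assoc)
  then show ?thesis
    using T.nlim_unique[OF psi_nlim[OF nlim_adjointable[OF phiD(1)[OF a] g(2)]]]
      T.nlim_mult[OF T.nlim_const[OF iAD(1)[OF a]] psi_nlim[OF g(2)]] by simp
qed

text \<open>Both identities are checked on the range of q, where the right action comes from the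
  commutation of S with A and the form from the compression by S, and are then extended by
  limits.\<close>

lemma isometric_toeplitz_psi: "isometric_toeplitz A M T \<psi> iA"
proof unfold_locales
  show "linear_map M T \<psi>" by (rule psi_map)
  show "iA \<in> star_hom A T" by (rule iA_hom)
  show "cnorm T (iA a) = cnorm A a" if "a \<in> carrier A" for a using that by (rule iA_isometric)
  show "\<psi> (raction M x a) = \<psi> x \<otimes>\<^bsub>T\<^esub> iA a" if x: "x \<in> carrier M" and a: "a \<in> carrier A" for x a
  proof -
    obtain g where g: "\<And>k. g k \<in> carrier A" "X.nlim (\<lambda>k. q (g k)) x" using q_approx[OF x] by blast
    have "(\<lambda>k. \<psi> (raction M (q (g k)) a)) = (\<lambda>k. \<psi> (q (g k)) \<otimes>\<^bsub>T\<^esub> iA a)"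
      using a g(1) by (simp add: q_raction psi_q iAD alphaD(1) T.mult_assoc S_iA)
    then show ?thesis
      using T.nlim_unique[OF psi_nlim[OF nlim_raction[OF g(2) a]]]
        T.nlim_mult[OF psi_nlim[OF g(2)] T.nlim_const[OF iAD(1)[OF a]]] by simp
  qed
  show "star T (\<psi> x) \<otimes>\<^bsub>T\<^esub> \<psi> y = iA (ip M x y)" if x: "x \<in> carrier M" and y: "y \<in> carrier M" for x y
  proof -
    obtain g where g: "\<And>k. g k \<in> carrier A" "X.nlim (\<lambda>k. q (g k)) x" using q_approx[OF x] by blast
    obtain h where h: "\<And>k. h k \<in> carrier A" "X.nlim (\<lambda>k. q (h k)) y" using q_approx[OF y] by blast
    have "star T (\<psi> (q a)) \<otimes>\<^bsub>T\<^esub> \<psi> (q b) = iA (ip M (q a) (q b))" if "a \<in> carrier A" "b \<in> carrier A" for a b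
      using that S_iA_S[of "star A a \<otimes>\<^bsub>A\<^esub> b"] by (simp add: psi_q q_ip T.star_mult iAD T.mult_assoc)
    then have "(\<lambda>k. star T (\<psi> (q (g k))) \<otimes>\<^bsub>T\<^esub> \<psi> (q (h k))) = (\<lambda>k. iA (ip M (q (g k)) (q (h k))))"
      using g(1) h(1) by simp
    then show ?thesis
      using T.nlim_unique[OF iA_nlim[OF nlim_ip[OF g(2) h(2)]]]
        T.nlim_mult[OF T.nlim_star[OF psi_nlim[OF g(2)]] psi_nlim[OF h(2)]] by simp
  qed
qed

end

sublocale exel_covariant \<subseteq> isometric_toeplitz A M T \<psi> iA
  by (rule isometric_toeplitz_psi)

context exel_covariant
begin

text \<open>On the range of q the two sets of generators agree once c is replaced by its adjoint.
  The remaining generators of \<open>rank_one_span\<close> are limits of these.\<close>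

lemma span_eq: "rank_one_span = closed_span T
    {iA b \<otimes>\<^bsub>T\<^esub> S \<otimes>\<^bsub>T\<^esub> star T S \<otimes>\<^bsub>T\<^esub> iA c | b c. b \<in> carrier A \<and> c \<in> carrier A}" (is "_ = closed_span T ?G")
proof
  have G: "?G \<subseteq> carrier T" using iAD(1) by auto
  note facts = closed_span_facts[OF T.normed_space_axioms G]
  have qq: "\<psi> (q b) \<otimes>\<^bsub>T\<^esub> star T (\<psi> (q c)) = iA b \<otimes>\<^bsub>T\<^esub> S \<otimes>\<^bsub>T\<^esub> star T S \<otimes>\<^bsub>T\<^esub> iA (star A c)"
    if "b \<in> carrier A" "c \<in> carrier A" for b c
    using that by (simp add: psi_q iAD T.star_mult T.mult_assoc)
  show "rank_one_span \<subseteq> closed_span T ?G"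
  proof (rule span_induct[OF facts(1,2)])
    fix x y assume x: "x \<in> carrier M" and y: "y \<in> carrier M"
    obtain g where g: "\<And>k. g k \<in> carrier A" "X.nlim (\<lambda>k. q (g k)) x" using q_approx[OF x] by blast
    obtain h where h: "\<And>k. h k \<in> carrier A" "X.nlim (\<lambda>k. q (h k)) y" using q_approx[OF y] by blast
    show "\<psi> x \<otimes>\<^bsub>T\<^esub> star T (\<psi> y) \<in> closed_span T ?G"
    proof (rule T.nlim_in_closed[OF T.nlim_mult[OF nlim_psi[OF g(2)] T.nlim_star[OF nlim_psi[OF h(2)]]] facts(2)])
      fix k
      have "\<psi> (q (g k)) \<otimes>\<^bsub>T\<^esub> star T (\<psi> (q (h k))) \<in> ?G"
        unfolding qq[OF g(1) h(1)] using g(1)[of k] A.star_closed[OF h(1)[of k]] by blast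
      then show "\<psi> (q (g k)) \<otimes>\<^bsub>T\<^esub> star T (\<psi> (q (h k))) \<in> closed_span T ?G" using facts(4) by blast
    qed
  qed
  have "?G \<subseteq> rank_one_span"
  proof
    fix k assume "k \<in> ?G"
    then obtain b c where bc: "b \<in> carrier A" "c \<in> carrier A"
      "k = iA b \<otimes>\<^bsub>T\<^esub> S \<otimes>\<^bsub>T\<^esub> star T S \<otimes>\<^bsub>T\<^esub> iA c" by blast
    then have "k = \<psi> (q b) \<otimes>\<^bsub>T\<^esub> star T (\<psi> (q (star A c)))" using qq[of b "star A c"] by simp
    then show "k \<in> rank_one_span" using bc span_gen[of "q b" "q (star A c)"] qD(1) by simp
  qed
  then show "closed_span T ?G \<subseteq> rank_one_span" using facts(6)[OF span_facts(1,2)] by blast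
qed

text \<open>A redundancy tests k only against the elements i_A(b)S = \<psi> (q b). An element of the
  span acts as some adjointable F, and F agrees with \<phi> a everywhere once it does so on the
  dense range of q.\<close>

lemma redundancy_iff: "redundancy A T iA S a k \<longleftrightarrow> a \<in> carrier A \<and> k \<in> rank_one_span \<and> act k (\<phi> a)"
proof (cases "a \<in> carrier A \<and> k \<in> rank_one_span")
  case True
  then have a: "a \<in> carrier A" and k: "k \<in> rank_one_span" and kc: "k \<in> carrier T" using span_closed by auto
  obtain F where F: "act k F" using span_lower[OF k] by blast
  have "(\<forall>b\<in>carrier A. iA a \<otimes>\<^bsub>T\<^esub> iA b \<otimes>\<^bsub>T\<^esub> S = k \<otimes>\<^bsub>T\<^esub> iA b \<otimes>\<^bsub>T\<^esub> S) \<longleftrightarrow>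
      (\<forall>b\<in>carrier A. \<psi> (\<phi> a (q b)) = k \<otimes>\<^bsub>T\<^esub> \<psi> (q b))"
    using a kc by (intro ball_cong refl) (simp add: psi_phi qD(1) psi_q iAD T.mult_assoc)
  also have "\<dots> \<longleftrightarrow> act k (\<phi> a)"
  proof
    assume eq: "\<forall>b\<in>carrier A. \<psi> (\<phi> a (q b)) = k \<otimes>\<^bsub>T\<^esub> \<psi> (q b)"
    have "F = \<phi> a"
    proof (rule adjointable_eq_on_q[OF actD(2)[OF F] phiD(1)[OF a]])
      fix b assume b: "b \<in> carrier A"
      show "F (q b) = \<phi> a (q b)"
        using eq b actD(3)[OF F qD(1)[OF b]] actD(2)[OF F] phiD(1)[OF a] qD(1)[OF b]
        by (intro psi_inj) simp_all
    qed
    then show "act k (\<phi> a)" using F by simp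
  qed (simp add: actD(3) qD(1))
  finally show ?thesis using True unfolding redundancy_def span_eq[symmetric] by simp
qed (auto simp: redundancy_def span_eq)

end

section \<open>Units and limits for arbitrary Toeplitz representations\<close>

lemma (in unital_hilbert_module) raction_one: "x \<in> carrier X \<Longrightarrow> raction X x \<one>\<^bsub>A\<^esub> = x"
  by (rule ip_eqI) (simp_all add: ip_raction_left A.mult_one_left)

text \<open>\<psi> is contractive for any Toeplitz representation, because |\<psi> x|^2 = |\<pi>
  <x,x>| and \<pi> is contractive.\<close>

lemma (in unital_hilbert_module) toeplitz_nlim:
  assumes B: "unital_cstar_algebra B" and rep: "toeplitz_representation A X \<phi> B \<psi> \<pi>" and lim: "X.nlim f x"
  shows "normed_space.nlim B (cnorm B) (\<lambda>k. \<psi> (f k)) (\<psi> x)"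
proof -
  interpret B: unital_cstar_algebra B by fact
  have lin: "linear_map X B \<psi>" and pi: "\<pi> \<in> star_hom A B"
    and ip: "\<And>x y. \<lbrakk>x \<in> carrier X; y \<in> carrier X\<rbrakk> \<Longrightarrow> star B (\<psi> x) \<otimes>\<^bsub>B\<^esub> \<psi> y = \<pi> (ip X x y)"
    using rep by (auto simp: toeplitz_representation_def)
  have "cnorm B (\<psi> x) \<le> 1 * hn x" if x: "x \<in> carrier X" for x
  proof -
    have "(cnorm B (\<psi> x))\<^sup>2 = cnorm B (\<pi> (ip X x x))"
      unfolding B.cstar_identity[OF linear_mapD(1)[OF lin x], symmetric] ip[OF x x] ..
    also have "\<dots> \<le> (hn x)\<^sup>2"
      unfolding hn_square[OF x] by (rule star_hom_contractive[OF A.cstar_algebra_axioms B pi ip_closed[OF x x]])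
    finally have "cnorm B (\<psi> x) \<le> hn x" by (rule power2_le_imp_le) (rule hn_nonneg[OF x])
    then show ?thesis by simp
  qed
  then show ?thesis by (rule nlim_linear[OF X.normed_space_axioms B.normed_space_axioms lin _ lim])
qed

context exel_covariant
begin

text \<open>A star homomorphism need not be unital; here it follows from \<open>iA_one\<close>,
  because \<psi> is injective and intertwines \<phi> with \<open>iA\<close>.\<close>

lemma phi_one: "m \<in> carrier M \<Longrightarrow> \<phi> \<one>\<^bsub>A\<^esub> m = m"
  by (rule psi_inj) (simp_all add: adjointable_closed[OF phiD(1)] psi_phi iA_one T.mult_one_left)

text \<open>The image of the unit of A is neutral for the generators, as both actions on M are
  unital, and the elements for which it is neutral form a closed star-subalgebra. Applied to
  \<open>Ob\<close>, this makes it an admissible target of the Toeplitz algebra.\<close>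

lemma toeplitz_generated_unit:
  assumes B: "cstar_algebra B" and rep: "toeplitz_representation A M \<phi> B \<psi>' \<pi>'"
    and gen: "cstar_generated B (\<psi>' ` carrier M \<union> \<pi>' ` carrier A) = carrier B"
  shows "unital_cstar_algebra (B\<lparr>one := \<pi>' \<one>\<^bsub>A\<^esub>\<rparr>)"
proof -
  interpret B: cstar_algebra B by fact
  have lin: "linear_map M B \<psi>'" and pi: "\<pi>' \<in> star_hom A B"
    and right: "\<And>x a. \<lbrakk>x \<in> carrier M; a \<in> carrier A\<rbrakk> \<Longrightarrow> \<psi>' (raction M x a) = \<psi>' x \<otimes>\<^bsub>B\<^esub> \<pi>' a"
    and left: "\<And>x a. \<lbrakk>x \<in> carrier M; a \<in> carrier A\<rbrakk> \<Longrightarrow> \<psi>' (\<phi> a x) = \<pi>' a \<otimes>\<^bsub>B\<^esub> \<psi>' x"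
    and ip: "\<And>x y. \<lbrakk>x \<in> carrier M; y \<in> carrier M\<rbrakk> \<Longrightarrow> star B (\<psi>' x) \<otimes>\<^bsub>B\<^esub> \<psi>' y = \<pi>' (ip M x y)"
    using rep by (auto simp: toeplitz_representation_def)
  note piD = star_homD[OF pi]
  define e where "e = \<pi>' \<one>\<^bsub>A\<^esub>"
  have e: "e \<in> carrier B" by (simp add: e_def piD)
  have es: "star B e = e" using piD(5)[of "\<one>\<^bsub>A\<^esub>"] by (simp add: e_def)
  let ?D = "{x \<in> carrier B. e \<otimes>\<^bsub>B\<^esub> x = x \<and> x \<otimes>\<^bsub>B\<^esub> e = x}"
  have "\<psi>' x \<in> ?D" if x: "x \<in> carrier M" for x
    using right[OF x A.one_closed] left[OF x A.one_closed] linear_mapD(1)[OF lin x]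
    by (simp add: phi_one[OF x] raction_one[OF x] e_def)
  moreover have "\<pi>' a \<in> ?D" if a: "a \<in> carrier A" for a
    using piD(4)[OF a A.one_closed] piD(4)[OF A.one_closed a] piD(1)[OF a] a
    by (simp add: A.mult_one_left A.mult_one_right e_def)
  ultimately have G: "\<psi>' ` carrier M \<union> \<pi>' ` carrier A \<subseteq> ?D" by blast
  have "carrier B = ?D"
  proof (rule cstar_generated_induct[OF gen B _ G])
    fix x assume x: "x \<in> ?D"
    then have xc: "x \<in> carrier B" and ex: "e \<otimes>\<^bsub>B\<^esub> x = x" and xe: "x \<otimes>\<^bsub>B\<^esub> e = x" by auto
    show "x \<otimes>\<^bsub>B\<^esub> y \<in> ?D" if y: "y \<in> ?D" for y
    proof -
      have yc: "y \<in> carrier B" and ye: "y \<otimes>\<^bsub>B\<^esub> e = y" using y by auto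
      show ?thesis using B.mult_assoc[OF e xc yc] B.mult_assoc[OF xc yc e] ex ye xc yc by simp
    qed
    have "star B (e \<otimes>\<^bsub>B\<^esub> x) = star B x \<otimes>\<^bsub>B\<^esub> e" "star B (x \<otimes>\<^bsub>B\<^esub> e) = e \<otimes>\<^bsub>B\<^esub> star B x"
      using B.star_mult[OF e xc] B.star_mult[OF xc e] by (simp_all only: es)
    then show "star B x \<in> ?D" using xc by (simp add: ex xe)
  next
    show "l \<in> ?D" if h: "B.nlim h l" "\<And>k. h k \<in> ?D" for h l
    proof -
      have "(\<lambda>k. e \<otimes>\<^bsub>B\<^esub> h k) = h" "(\<lambda>k. h k \<otimes>\<^bsub>B\<^esub> e) = h" using h(2) by auto
      then show ?thesis
        using B.nlim_unique[OF B.nlim_mult[OF B.nlim_const[OF e] h(1)], of l]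
          B.nlim_unique[OF B.nlim_mult[OF h(1) B.nlim_const[OF e]], of l] h(1) B.nlim_closed(2)[OF h(1)]
        by simp
    qed
  qed (use e in \<open>auto simp: B.mult_add_left B.mult_add_right B.mult_smult_left B.mult_smult_right\<close>)
  then have unit: "e \<otimes>\<^bsub>B\<^esub> x = x" "x \<otimes>\<^bsub>B\<^esub> e = x" if "x \<in> carrier B" for x
    using that by blast+
  interpret B1: cstar_algebra "B\<lparr>one := e\<rparr>" by (rule cstar_algebra_update_one[OF B])
  have "unital_cstar_algebra (B\<lparr>one := e\<rparr>)"
    by unfold_locales (simp_all add: e unit)
  then show ?thesis by (simp add: e_def)
qed

end

lemma toeplitz_representation_compose:
  assumes B: "cstar_algebra B" and rep: "toeplitz_representation A X \<phi> B \<psi> \<pi>" and h: "h \<in> star_hom B C"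
  shows "toeplitz_representation A X \<phi> C (\<lambda>x. h (\<psi> x)) (\<lambda>a. h (\<pi> a))"
proof -
  have lin: "linear_map X B \<psi>" and pi: "\<pi> \<in> star_hom A B"
    using rep by (auto simp: toeplitz_representation_def)
  have "linear_map X C (\<lambda>x. h (\<psi> x))"
    using linear_mapD[OF lin] star_homD[OF h] by (auto simp: linear_map_def)
  moreover have "star C (h (\<psi> x)) \<otimes>\<^bsub>C\<^esub> h (\<psi> y) = h (star B (\<psi> x) \<otimes>\<^bsub>B\<^esub> \<psi> y)"
    if "x \<in> carrier X" "y \<in> carrier X" for x y
    using linear_mapD(1)[OF lin] star_homD[OF h] cstar_algebra.star_closed[OF B] that by simp
  ultimately show ?thesis
    using rep star_hom_compose[OF pi h] star_homD[OF h] linear_mapD(1)[OF lin] star_homD(1)[OF pi]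
    by (simp add: toeplitz_representation_def)
qed

context exel_covariant
begin

text \<open>For a in K the pair of i_A(a) and \<open>compact_hom (\<phi> a)\<close> is a redundancy,
  and the quotient by I identifies its two members; this is coisometry for h composed with
  \<open>compact_hom\<close>.\<close>

lemma coisometric_compose:
  assumes I: "closed_ideal T I" and B: "closed_ideal_quotient T I B h"
    and red: "\<And>a k. \<lbrakk>redundancy A T iA S a k; a \<in> K\<rbrakk> \<Longrightarrow> iA a \<ominus>\<^bsub>T\<^esub> k \<in> I"
    and K: "K \<subseteq> J_ideal A M \<phi>"
  shows "coisometric_on K A M \<phi> B (\<lambda>m. h (\<psi> m)) (\<lambda>a. h (iA a))"
proof -
  interpret I: closed_ideal T I by fact
  interpret Q: closed_ideal_quotient T I B h by fact
  note hD = star_homD[OF Q.quotient_star_hom]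
  have "induced_hom A M B (\<lambda>m. h (\<psi> m)) (\<lambda>F. h (compact_hom F))"
    unfolding induced_hom_def
  proof (intro conjI ballI)
    show "(\<lambda>F. h (compact_hom F)) \<in> star_hom (adjointables A M\<lparr>carrier := compacts A M\<rparr>) B"
      using induced_hom_compact_hom by (intro star_hom_compose[OF _ Q.quotient_star_hom]) (simp add: induced_hom_def)
    show "h (compact_hom (rank_one M x y)) = h (\<psi> x) \<otimes>\<^bsub>B\<^esub> star B (h (\<psi> y))"
      if "x \<in> carrier M" "y \<in> carrier M" for x y
      using induced_hom_compact_hom that by (simp add: induced_hom_def hD)
  qed
  moreover have "h (compact_hom (\<phi> a)) = h (iA a)" if a: "a \<in> K" for a
  proof -
    have aA: "a \<in> carrier A" and pa: "\<phi> a \<in> compacts A M" using a K by (auto simp: J_ideal_def)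
    note c = compact_hom[OF pa]
    have "redundancy A T iA S a (compact_hom (\<phi> a))" using aA c by (simp add: redundancy_iff)
    then have "iA a \<ominus>\<^bsub>T\<^esub> compact_hom (\<phi> a) \<in> I" using a by (rule red)
    then show ?thesis using Q.h_eq[OF iAD(1)[OF aA] span_closed[OF c(1)]] by simp
  qed
  ultimately show ?thesis unfolding coisometric_on_def by blast
qed

text \<open>\<sigma> composed with \<psi> is \<psi>', first on the range of q and then by density.
  As k lies in the span and acts as \<phi> a, that operator is compact, so a lies in K. Then \<rho>
  (\<phi> a) is \<pi>' a by coisometry and \<sigma> k by \<open>induced_hom_factor\<close>.\<close>

lemma redundancy_vanishes:
  assumes B: "unital_cstar_algebra B" and rep: "toeplitz_representation A M \<phi> B \<psi>' \<pi>'"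
    and coiso: "coisometric_on K A M \<phi> B \<psi>' \<pi>'"
    and s: "\<sigma> \<in> star_hom T B" and sA: "\<And>a. a \<in> carrier A \<Longrightarrow> \<sigma> (iA a) = \<pi>' a"
    and sS: "\<sigma> S = \<psi>' (q \<one>\<^bsub>A\<^esub>)"
    and red: "redundancy A T iA S a k" and K: "a \<in> J_ideal A M \<phi> \<Longrightarrow> a \<in> K"
  shows "\<sigma> (iA a) = \<sigma> k"
proof -
  interpret B: unital_cstar_algebra B by fact
  note sD = star_homD[OF s]
  have left: "\<And>x a. \<lbrakk>x \<in> carrier M; a \<in> carrier A\<rbrakk> \<Longrightarrow> \<psi>' (\<phi> a x) = \<pi>' a \<otimes>\<^bsub>B\<^esub> \<psi>' x"
    using rep by (auto simp: toeplitz_representation_def)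
  have sq: "\<sigma> (\<psi> (q b)) = \<psi>' (q b)" if b: "b \<in> carrier A" for b
    using left[OF qD(1)[OF A.one_closed] b] b
    by (simp add: psi_q sD iAD(1) sA sS phi_q A.mult_one_right)
  have sp: "\<sigma> (\<psi> x) = \<psi>' x" if x: "x \<in> carrier M" for x
  proof -
    obtain g where g: "\<And>k. g k \<in> carrier A" "X.nlim (\<lambda>k. q (g k)) x" using q_approx[OF x] by blast
    have "(\<lambda>k. \<sigma> (\<psi> (q (g k)))) = (\<lambda>k. \<psi>' (q (g k)))" using sq g(1) by simp
    then show ?thesis
      using B.nlim_unique[OF star_hom_nlim[OF T.cstar_algebra_axioms B s nlim_psi[OF g(2)]]]
        toeplitz_nlim[OF B rep g(2)] by simp
  qed
  have a: "a \<in> carrier A" and k: "k \<in> rank_one_span" "act k (\<phi> a)" using red by (auto simp: redundancy_iff)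
  have "a \<in> J_ideal A M \<phi>" using a act_in_compacts[OF k] by (simp add: J_ideal_def)
  then have "a \<in> K" by (rule K)
  moreover obtain \<rho> where \<rho>: "induced_hom A M B \<psi>' \<rho>" "\<forall>a\<in>K. \<rho> (\<phi> a) = \<pi>' a"
    using coiso by (auto simp: coisometric_on_def)
  ultimately have "\<rho> (\<phi> a) = \<sigma> (iA a)" using a by (simp add: sA)
  moreover have "\<rho> (\<phi> a) = \<sigma> k" by (rule induced_hom_factor[OF B s \<rho>(1) sp k])
  ultimately show ?thesis by simp
qed

end

lemma kernel_closed_ideal:
  assumes T: "unital_cstar_algebra T" and B: "unital_cstar_algebra B" and f: "f \<in> star_hom T B"
  shows "ideal {x \<in> carrier T. f x = \<zero>\<^bsub>B\<^esub>} T"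
    and "closedin (cstar_topology T) {x \<in> carrier T. f x = \<zero>\<^bsub>B\<^esub>}"
proof -
  interpret T: unital_cstar_algebra T by fact
  interpret B: unital_cstar_algebra B by fact
  note fD = star_homD[OF f]
  have f0: "f \<zero>\<^bsub>T\<^esub> = \<zero>\<^bsub>B\<^esub>"
    using linear_map_minus(2)[OF star_hom_linear[OF f] T.normed_space_axioms B.normed_space_axioms
        T.M.zero_closed T.M.zero_closed] .
  let ?J = "{x \<in> carrier T. f x = \<zero>\<^bsub>B\<^esub>}"
  have "submodule ?J complex_field T"
    by (rule T.submoduleI') (auto simp: fD f0)
  then have "subgroup ?J (add_monoid T)" by (rule submodule.axioms(1))
  then show "ideal ?J T"
    by (intro idealI T.U.ring_axioms) (auto simp: fD)
  show "closedin (cstar_topology T) ?J"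
  proof (rule T.closedinI)
    fix h l assume h: "T.nlim h l" "\<And>k. h k \<in> ?J"
    have "(\<lambda>k. f (h k)) = (\<lambda>k. \<zero>\<^bsub>B\<^esub>)" using h(2) by auto
    then have "f l = \<zero>\<^bsub>B\<^esub>"
      using B.nlim_unique[OF star_hom_nlim[OF T.cstar_algebra_axioms B f h(1)]]
        B.nlim_const[OF B.M.zero_closed] by simp
    then show "l \<in> ?J" using T.nlim_closed(2)[OF h(1)] by simp
  qed auto
qed

lemma toeplitz_update_one:
  "toeplitz_representation A X \<phi> (B\<lparr>one := e\<rparr>) \<psi> \<pi> = toeplitz_representation A X \<phi> B \<psi> \<pi>"
  "coisometric_on K A X \<phi> (B\<lparr>one := e\<rparr>) \<psi> \<pi> = coisometric_on K A X \<phi> B \<psi> \<pi>"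
  "star_hom T (B\<lparr>one := e\<rparr>) = star_hom T B"
  by (simp_all add: toeplitz_representation_def coisometric_on_def induced_hom_def star_hom_def linear_map_def)

section \<open>The two mutually inverse homomorphisms\<close>

lemma exel_isomorphism:
  fixes A :: "'a cstar" and T :: "'u cstar" and M :: "('a, 'm) hilbert_mod" and Ob :: "'u cstar"
  assumes K_def: "K = A_alphaA_A A \<alpha> \<inter> J_ideal A M \<phi>" and I_def: "I = redundancy_ideal A \<alpha> T iA S"
    and cov: "exel_covariant A M T \<alpha> L \<phi> q iA S" and toep: "toeplitz_algebra A \<alpha> L T iA S"
    and cp: "relative_cuntz_pimsner K A M \<phi> Ob kM kA"
  shows "\<exists>\<theta>\<in>star_iso Ob (cstar_quot T I).
    (\<forall>a\<in>carrier A. \<theta> (kA a) = I +>\<^bsub>T\<^esub> iA a) \<and> \<theta> (kM (q \<one>\<^bsub>A\<^esub>)) = I +>\<^bsub>T\<^esub> S"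
proof -
  interpret exel_covariant A M T \<alpha> L \<phi> q iA S by (rule cov)
  let ?G = "{iA a \<ominus>\<^bsub>T\<^esub> k | a k. redundancy A T iA S a k \<and> a \<in> A_alphaA_A A \<alpha>}"
  have GT: "?G \<subseteq> carrier T" using span_closed iAD(1) by (auto simp: redundancy_iff)
  have I: "I = closed_ideal_generated T ?G" by (simp add: I_def redundancy_ideal_def)
  have genI: "?G \<subseteq> I" unfolding I by (rule T.closed_ideal_generated(2)[OF GT])
  interpret I: closed_ideal T I unfolding I by (rule T.closed_ideal_generated(1)[OF GT])
  \<comment> \<open>E models the crossed product inside the carrier of T, with \<kappa> in the role
    of the quotient map, so it is an admissible target for \<open>Ouniv\<close>.\<close>
  define E where "E = I.rep_quotient"
  define \<kappa> where "\<kappa> = I.rep"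
  interpret Q: closed_ideal_quotient T I E \<kappa> unfolding E_def \<kappa>_def by (rule I.rep_quotient)
  interpret E: unital_cstar_algebra E by (rule Q.quotient_cstar)
  note kD = star_homD[OF Q.quotient_star_hom]
  have E_carrier: "carrier E = \<kappa> ` carrier T" by (simp add: E_def \<kappa>_def I.rep_quotient_def)

  have Ob: "cstar_algebra Ob" and kTo: "toeplitz_representation A M \<phi> Ob kM kA"
    and kco: "coisometric_on K A M \<phi> Ob kM kA"
    and Ogen: "cstar_generated Ob (kM ` carrier M \<union> kA ` carrier A) = carrier Ob"
    and Ouniv: "\<And>(B :: 'u cstar) \<psi> \<pi>. \<lbrakk>cstar_algebra B; toeplitz_representation A M \<phi> B \<psi> \<pi>;
        coisometric_on K A M \<phi> B \<psi> \<pi>\<rbrakk>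
      \<Longrightarrow> \<exists>\<mu>\<in>star_hom Ob B. (\<forall>x\<in>carrier M. \<psi> x = \<mu> (kM x)) \<and> (\<forall>a\<in>carrier A. \<pi> a = \<mu> (kA a))"
    using cp unfolding relative_cuntz_pimsner_def by blast+
  have Tgen: "cstar_generated T (insert S (iA ` carrier A)) = carrier T"
    and Tuniv: "\<And>(B :: 'u cstar) \<pi> V. \<lbrakk>unital_cstar_algebra B; toeplitz_covariant A \<alpha> L B \<pi> V\<rbrakk>
      \<Longrightarrow> \<exists>\<mu>\<in>star_hom T B. \<mu> \<one>\<^bsub>T\<^esub> = \<one>\<^bsub>B\<^esub> \<and> (\<forall>a\<in>carrier A. \<pi> a = \<mu> (iA a)) \<and> V = \<mu> S"
    using toep unfolding toeplitz_algebra_def by blast+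

  have "toeplitz_representation A M \<phi> T \<psi> iA"
    using psi_map iA_hom psi_raction psi_ip psi_phi by (auto simp: toeplitz_representation_def)
  then have "toeplitz_representation A M \<phi> E (\<lambda>m. \<kappa> (\<psi> m)) (\<lambda>a. \<kappa> (iA a))"
    by (rule toeplitz_representation_compose[OF T.cstar_algebra_axioms _ Q.quotient_star_hom])
  moreover have "coisometric_on K A M \<phi> E (\<lambda>m. \<kappa> (\<psi> m)) (\<lambda>a. \<kappa> (iA a))"
    using genI by (intro coisometric_compose[OF I.closed_ideal_axioms Q.closed_ideal_quotient_axioms])
      (auto simp: K_def)
  ultimately obtain \<theta> where \<theta>: "\<theta> \<in> star_hom Ob E"
    and \<theta>M: "\<And>x. x \<in> carrier M \<Longrightarrow> \<kappa> (\<psi> x) = \<theta> (kM x)" and \<theta>A: "\<And>a. a \<in> carrier A \<Longrightarrow> \<kappa> (iA a) = \<theta> (kA a)"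
    using Ouniv[OF E.cstar_algebra_axioms] by blast

  \<comment> \<open>The same algebra with its unit recorded, as \<open>Tuniv\<close> demands a
    unital target.\<close>
  define O1 where "O1 = Ob\<lparr>one := kA \<one>\<^bsub>A\<^esub>\<rparr>"
  have O1: "unital_cstar_algebra O1"
    unfolding O1_def by (rule toeplitz_generated_unit[OF Ob kTo Ogen])
  interpret O1: unital_cstar_algebra O1 by (rule O1)
  have O1s: "carrier O1 = carrier Ob" by (simp add: O1_def)
  have kTo1: "toeplitz_representation A M \<phi> O1 kM kA" and kco1: "coisometric_on K A M \<phi> O1 kM kA"
    using kTo kco by (simp_all add: O1_def toeplitz_update_one)
  have kMl: "linear_map M O1 kM" and kAh: "kA \<in> star_hom A O1"
    and kright: "\<And>x a. \<lbrakk>x \<in> carrier M; a \<in> carrier A\<rbrakk> \<Longrightarrow> kM (raction M x a) = kM x \<otimes>\<^bsub>O1\<^esub> kA a"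
    and kleft: "\<And>x a. \<lbrakk>x \<in> carrier M; a \<in> carrier A\<rbrakk> \<Longrightarrow> kM (\<phi> a x) = kA a \<otimes>\<^bsub>O1\<^esub> kM x"
    and kip: "\<And>x y. \<lbrakk>x \<in> carrier M; y \<in> carrier M\<rbrakk> \<Longrightarrow> star O1 (kM x) \<otimes>\<^bsub>O1\<^esub> kM y = kA (ip M x y)"
    using kTo1 by (auto simp: toeplitz_representation_def)
  note kAD = star_homD[OF kAh] and kMD = linear_mapD[OF kMl]
  let ?V = "kM (q \<one>\<^bsub>A\<^esub>)"
  have q1: "q \<one>\<^bsub>A\<^esub> \<in> carrier M" by (rule qD(1)[OF A.one_closed])
  have kMq: "kM (q a) = kA a \<otimes>\<^bsub>O1\<^esub> ?V" if a: "a \<in> carrier A" for a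
    using kleft[OF q1 a] a by (simp add: phi_q A.mult_one_right)
  \<comment> \<open>The relations for V = kM (q 1) are images of identities in M: the right action
    of a on q(1) gives q(\<alpha>(a)), and <q(1), q(a)> = L(a).\<close>
  have "toeplitz_covariant A \<alpha> L O1 kA ?V"
    unfolding toeplitz_covariant_def
  proof (intro conjI ballI)
    show "kA \<one>\<^bsub>A\<^esub> = \<one>\<^bsub>O1\<^esub>" by (simp add: O1_def)
    show "?V \<in> carrier O1" by (rule kMD(1)[OF q1])
    fix a assume a: "a \<in> carrier A"
    show "?V \<otimes>\<^bsub>O1\<^esub> kA a = kA (\<alpha> a) \<otimes>\<^bsub>O1\<^esub> ?V"
      using kright[OF q1 a] kMq[OF alphaD(1)[OF a]] a by (simp add: q_raction alphaD(1) A.mult_one_left)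
    show "star O1 ?V \<otimes>\<^bsub>O1\<^esub> kA a \<otimes>\<^bsub>O1\<^esub> ?V = kA (L a)"
      using kip[OF q1 qD(1)[OF a]] kMq[OF a] kAD(1)[OF a] kMD(1)[OF q1] a
      by (simp add: q_ip A.mult_one_left O1.mult_assoc)
  qed (rule kAh)
  then obtain \<sigma> where \<sigma>: "\<sigma> \<in> star_hom T O1" and \<sigma>A: "\<And>a. a \<in> carrier A \<Longrightarrow> \<sigma> (iA a) = kA a" and \<sigma>S: "\<sigma> S = ?V"
    using Tuniv[OF O1] by metis
  note \<sigma>D = star_homD[OF \<sigma>]
  have \<sigma>m: "\<sigma> (x \<ominus>\<^bsub>T\<^esub> y) = \<sigma> x \<ominus>\<^bsub>O1\<^esub> \<sigma> y" if "x \<in> carrier T" "y \<in> carrier T" for x y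
    using linear_map_minus(1)[OF star_hom_linear[OF \<sigma>] T.normed_space_axioms O1.normed_space_axioms that] .
  \<comment> \<open>The kernel of \<sigma> is a closed ideal, so only the generators of I have to be
    tested, and \<open>redundancy_vanishes\<close> covers these.\<close>
  have "I \<subseteq> {x \<in> carrier T. \<sigma> x = \<zero>\<^bsub>O1\<^esub>}"
    unfolding I
  proof (rule T.closed_ideal_generated(3)[OF GT])
    show "?G \<subseteq> {x \<in> carrier T. \<sigma> x = \<zero>\<^bsub>O1\<^esub>}"
    proof
      fix x assume "x \<in> ?G"
      then obtain a k where x: "x = iA a \<ominus>\<^bsub>T\<^esub> k" and red: "redundancy A T iA S a k" and a: "a \<in> A_alphaA_A A \<alpha>"
        by blast
      have aA: "a \<in> carrier A" and kT: "k \<in> carrier T" using red span_closed by (auto simp: redundancy_iff)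
      have "\<sigma> (iA a) = \<sigma> k"
        by (rule redundancy_vanishes[OF O1 kTo1 kco1 \<sigma> \<sigma>A \<sigma>S red]) (use a in \<open>simp_all add: K_def\<close>)
      then show "x \<in> {x \<in> carrier T. \<sigma> x = \<zero>\<^bsub>O1\<^esub>}"
        using iAD(1)[OF aA] kT by (simp add: x \<sigma>m \<sigma>D(1) O1.minus_self)
    qed
  qed (rule kernel_closed_ideal[OF T.unital_cstar_algebra_axioms O1 \<sigma>])+
  \<comment> \<open>\<kappa> x is an element of T congruent to x. So \<sigma> can be applied to the
    elements of E directly and is itself the induced homomorphism from E to O1.\<close>
  then have \<sigma>\<kappa>: "\<sigma> (\<kappa> x) = \<sigma> x" if x: "x \<in> carrier T" for x
    using I.rep[OF x] x \<sigma>m[of x "\<kappa> x"] \<sigma>D(1) O1.minus_eq_zero_iff[of "\<sigma> x" "\<sigma> (\<kappa> x)"]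
    by (auto simp: \<kappa>_def)

  have \<theta>\<sigma>: "\<theta> (\<sigma> x) = \<kappa> x" if x: "x \<in> carrier T" for x
  proof (rule star_hom_eq_on_generated[OF Tgen T.cstar_algebra_axioms E.unital_cstar_algebra_axioms _ Q.quotient_star_hom _ _ x])
    have "\<sigma> \<in> star_hom T Ob" using \<sigma> by (simp add: O1_def toeplitz_update_one)
    then show "(\<lambda>x. \<theta> (\<sigma> x)) \<in> star_hom T E" by (rule star_hom_compose[OF _ \<theta>])
    show "insert S (iA ` carrier A) \<subseteq> carrier T" using iAD(1) by auto
    show "\<theta> (\<sigma> y) = \<kappa> y" if "y \<in> insert S (iA ` carrier A)" for y
      using that \<theta>M[OF q1] \<theta>A by (auto simp: \<sigma>S \<sigma>A psi_q iA_one T.mult_one_left)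
  qed
  have \<sigma>E: "\<sigma> \<in> star_hom E O1"
  proof (rule star_homI)
    fix x y c assume "x \<in> carrier E" "y \<in> carrier E"
    then obtain x' y' where x: "x' \<in> carrier T" "x = \<kappa> x'" and y: "y' \<in> carrier T" "y = \<kappa> y'"
      unfolding E_carrier by blast
    show "\<sigma> x \<in> carrier O1" using x by (simp add: \<sigma>\<kappa> \<sigma>D)
    show "\<sigma> (x \<oplus>\<^bsub>E\<^esub> y) = \<sigma> x \<oplus>\<^bsub>O1\<^esub> \<sigma> y" using x y by (simp add: Q.h_add \<sigma>\<kappa> \<sigma>D)
    show "\<sigma> (x \<otimes>\<^bsub>E\<^esub> y) = \<sigma> x \<otimes>\<^bsub>O1\<^esub> \<sigma> y" using x y by (simp add: Q.h_mult \<sigma>\<kappa> \<sigma>D)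
    show "\<sigma> (c \<odot>\<^bsub>E\<^esub> x) = c \<odot>\<^bsub>O1\<^esub> \<sigma> x" using x by (simp add: Q.h_smult \<sigma>\<kappa> \<sigma>D)
    show "\<sigma> (star E x) = star O1 (\<sigma> x)" using x by (simp add: Q.h_star \<sigma>\<kappa> \<sigma>D)
  qed
  \<comment> \<open>The generators kM m are reached by density: \<sigma> (\<psi> m) = kM m is known
    on the range of q, and both sides are continuous in m.\<close>
  have \<sigma>\<theta>: "\<sigma> (\<theta> x) = x" if x: "x \<in> carrier Ob" for x
  proof (rule star_hom_eq_on_generated[OF Ogen Ob O1 star_hom_compose[OF \<theta> \<sigma>E] _ _ _ x])
    show "(\<lambda>x. x) \<in> star_hom Ob O1" by (rule star_homI) (simp_all add: O1_def)
    show "kM ` carrier M \<union> kA ` carrier A \<subseteq> carrier Ob" using kMD(1) kAD(1) by (auto simp: O1s)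
    have "\<sigma> (\<theta> (kA a)) = kA a" if "a \<in> carrier A" for a
      using that \<theta>A[symmetric] by (simp add: \<sigma>\<kappa> iAD(1) \<sigma>A)
    moreover have "\<sigma> (\<theta> (kM m)) = kM m" if m: "m \<in> carrier M" for m
    proof -
      obtain g where g: "\<And>k. g k \<in> carrier A" "X.nlim (\<lambda>k. q (g k)) m" using q_approx[OF m] by blast
      have "\<sigma> (\<psi> (q b)) = kM (q b)" if b: "b \<in> carrier A" for b
        using b by (simp add: psi_q \<sigma>D iAD(1) \<sigma>A \<sigma>S kMq[OF b])
      then have "(\<lambda>k. \<sigma> (\<psi> (q (g k)))) = (\<lambda>k. kM (q (g k)))" using g(1) by simp
      then have "\<sigma> (\<psi> m) = kM m"
        using O1.nlim_unique[OF star_hom_nlim[OF T.cstar_algebra_axioms O1 \<sigma> nlim_psi[OF g(2)]]]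
          toeplitz_nlim[OF O1 kTo1 g(2)] by simp
      then show ?thesis using m \<theta>M[symmetric] by (simp add: \<sigma>\<kappa>)
    qed
    ultimately show "\<sigma> (\<theta> y) = y" if "y \<in> kM ` carrier M \<union> kA ` carrier A" for y using that by auto
  qed
  have bij: "bij_betw \<theta> (carrier Ob) (carrier E)"
  proof (rule bij_betwI[where g = \<sigma>])
    show "\<theta> \<in> carrier Ob \<rightarrow> carrier E" using star_homD(1)[OF \<theta>] by blast
    show "\<sigma> \<in> carrier E \<rightarrow> carrier Ob" using star_homD(1)[OF \<sigma>E] by (auto simp: O1s)
    show "\<sigma> (\<theta> x) = x" if "x \<in> carrier Ob" for x using that by (rule \<sigma>\<theta>)
    show "\<theta> (\<sigma> y) = y" if "y \<in> carrier E" for y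
      using that unfolding E_carrier by (auto simp: \<sigma>\<kappa> \<theta>\<sigma>)
  qed

  note iso = I.coset_map_iso[folded E_def]
  have coset: "I +>\<^bsub>T\<^esub> \<kappa> x = I +>\<^bsub>T\<^esub> x" if "x \<in> carrier T" for x
    using that I.rep[OF that] I.congI_sym[OF that I.rep(1)[OF that]] by (simp add: I.coset_eq_iff \<kappa>_def)
  show ?thesis
  proof (intro bexI conjI ballI)
    \<comment> \<open>The isomorphism onto E is followed by the one that sends a representative to
      its coset.\<close>
    show "(\<lambda>x. I +>\<^bsub>T\<^esub> \<theta> x) \<in> star_iso Ob (cstar_quot T I)"
      using iso bij star_hom_compose[OF \<theta>] bij_betw_trans[OF bij] unfolding star_iso_def o_def by blast
    show "I +>\<^bsub>T\<^esub> \<theta> (kA a) = I +>\<^bsub>T\<^esub> iA a" if "a \<in> carrier A" for a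
      using coset[OF iAD(1)[OF that]] \<theta>A[OF that] by simp
    show "I +>\<^bsub>T\<^esub> \<theta> ?V = I +>\<^bsub>T\<^esub> S"
      using coset[OF S_closed] \<theta>M[OF q1] by (simp add: psi_q iA_one T.mult_one_left)
  qed
qed

theorem proposition3p10:
  fixes A :: "'a cstar" and \<alpha> L :: "'a \<Rightarrow> 'a"
    and T :: "'u cstar" and iA :: "'a \<Rightarrow> 'u" and S :: 'u
    and M :: "('a, 'm) hilbert_mod" and \<phi> :: "'a \<Rightarrow> 'm \<Rightarrow> 'm" and q :: "'a \<Rightarrow> 'm"
    and Ob :: "'u cstar" and kM :: "'m \<Rightarrow> 'u" and kA :: "'a \<Rightarrow> 'u"
  defines "K\<^sub>\<alpha> \<equiv> A_alphaA_A A \<alpha> \<inter> J_ideal A M \<phi>"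
    and "Q \<equiv> exel_quotient_map A \<alpha> T iA S"
  assumes "unital_cstar_algebra A"
    and "\<alpha> \<in> star_hom A A"
    and "transfer_operator A \<alpha> L"
    and "toeplitz_algebra A \<alpha> L T iA S"
    and "exel_bimodule A \<alpha> L M \<phi> q"
    and "relative_cuntz_pimsner K\<^sub>\<alpha> A M \<phi> Ob kM kA"
  shows "\<exists>\<theta> \<in> star_iso Ob (exel_crossed_product A \<alpha> T iA S).
    (\<forall>a\<in>carrier A. \<theta> (kA a) = Q (iA a)) \<and> \<theta> (kM (q \<one>\<^bsub>A\<^esub>)) = Q S"
proof -
  have "hilbert_module A M"
    using assms(7) by (simp add: exel_bimodule_def hilbert_bimodule_def)
  then have "exel_covariant A M T \<alpha> L \<phi> q iA S"
    using assms(3-7) unfolding toeplitz_algebra_def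
    by (intro exel_covariant.intro exel_covariant_axioms.intro unital_hilbert_module.intro) blast+
  then show ?thesis
    using exel_isomorphism[OF K\<^sub>\<alpha>_def[THEN meta_eq_to_obj_eq] refl _ assms(6,8)]
    unfolding Q_def exel_quotient_map_def exel_crossed_product_def by blast
qed

end
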